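(* Let $G$ be a finitely generated group, and let $Y_1,\ldots,Y_n$ and $Z_1,\ldots,Z_n$ be two families of nontrivial almost invariant subsets of $G$, each over a finitely generated subgroup of $G$, such that the $Y_i$'s are in good position, the $Z_i$'s are in good position, and $Y_i$ is equivalent to $Z_i$ for each $i$. Suppose that no $Y_i$ and no $Z_i$ is invertible. Let $L_Y$ and $L_Z$ denote the cubings constructed (as described in the context) from the posets $(E(Y_1,\ldots,Y_n),\leq)$ and $(E(Z_1,\ldots,Z_n),\leq)$ respectively. Then there is a $G$-equivariant, order preserving bijection from $E(Y_1,\ldots,Y_n)$ to $E(Z_1,\ldots,Z_n)$, which provides a $G$-equivariant isomorphism from $L_Y$ to $L_Z$. Thus the cubing constructed from the poset $(E(X_1,\ldots,X_n),\leq)$ of a family of such almost invariant sets $X_1,\ldots,X_n$ is determined solely by the equivalence classes of $X_1,\ldots,X_n$.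
   Context: Almost invariant sets. For a subgroup $H$ of $G$, $H\backslash G$ is the set of cosets $Hg$, on which $G$ acts on the right. Two sets are almost equal if their symmetric difference is finite. A subset $P$ of a set with right $G$-action is almost invariant if $Pg$ is almost equal to $P$ for all $g\in G$. A subset $X\subset G$ is $H$-almost invariant (almost invariant over $H$) if $hX=X$ for all $h\in H$ and $H\backslash X$ is an almost invariant subset of $H\backslash G$; it is nontrivial if $H\backslash X$ and $H\backslash X^{\ast}$ are both infinite, where $X^{\ast}=G-X$. A subset of $G$ is $H$-finite if it is contained in a finite union of cosets $Hg$. If $X$ is $H$-almost invariant then $gX$ is $gHg^{-1}$-almost invariant. An $H$-almost invariant set $X$ and a $K$-almost invariant set $Y$ are equivalent if their symmetric difference is $H$-finite. $X$ is invertible if $gX=X^{\ast}$ for some $g\in G$. Good position and the order $\leq$. Let $E=E(X_1,\ldots,X_n)=\{gX_i,gX_i^{\ast}:g\in G,1\leq i\leq n\}$. The corners of a pair $(U,V)$ are $U\cap V$, $U^{\ast}\cap V$, $U\cap V^{\ast}$, $U^{\ast}\cap V^{\ast}$. If $U$ is nontrivial $H$-almost invariant and $V$ is nontrivial $K$-almost invariant, a corner is small if it is $H$-finite (equivalently $K$-finite). The $X_i$'s are in good position if, whenever $U,V\in E$ and two of the four corners of $(U,V)$ are small, one of the four corners is empty. In that case, setting $U\leq V$ if and only if $U\cap V^{\ast}$ is empty or is the only small corner of $(U,V)$ defines a partial order on $E$. Ultrafilters. An ultrafilter on $(E,\leq)$ is a subset $V\subset E$ such that (1) for every $A\in E$,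 exactly one of $A\in V$, $A^{\ast}\in V$ holds; (2) if $A\in V$, $B\in E$ and $A\leq B$ then $B\in V$. The cubing $L$ constructed from $(E,\leq)$. Let $\Lambda$ be the cubed complex whose vertices are the ultrafilters on $(E,\leq)$, with an edge joining $V$ and $V'$ if and only if $V'=(V-\{A\})\cup\{A^{\ast}\}$ for some $A\in V$, and, inductively for $n\geq 2$, with one $n$-cube attached to the $(n-1)$-skeleton for each occurrence in it of the boundary of an $n$-cube. $G$ acts on $\Lambda$ via its action by left translation on $E$. Let $\Gamma$ be the Cayley graph of $G$ for a finite generating set, $N_R(g)$ the ball of radius $R$ about $g$ in $\Gamma$, and $\delta A$ the set of edges of $\Gamma$ with exactly one endpoint in $A$. Fix $R>0$ such that whenever $A,B\in E$, $A\leq B$, $g\in A$ and $N_R(g)\subset A$, one has $g\in B$ (such an $R$ exists). For $g\in G$, let $E_R=\{A\in E:\delta A\cap N_R(g)\neq\emptyset\}$ (a finite set), $E_R^{\ast}=E-E_R$, $U_g=\{A\in E_R^{\ast}: g\in A\}$, and $U_1=U_g\cup\{B\in E_R:\exists A\in U_g, A\leq B\}$. Inductively, with $S^{\ast}=\{A^{\ast}:A\in S\}$ for $S\subset E$, if $V_k:=E-(U_k\cup U_k^{\ast})$ is non-empty, choose a minimal element $A_k$ of $V_k$ and let $U_{k+1}=U_k\cup\{B\in V_k: A_k\leq B\}$. This ends after finitely many steps with an ultrafilter $W_g$ on $(E,\leq)$; any $W_g$ obtained in this way is called a basic vertex. All basic vertices lie in a single component $L$ of $\Lambda$, which is $G$-invariant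 and is a cubing (a simply connected $CAT(0)$ cubed complex). An isomorphism of cubings is a homeomorphism taking each cube isometrically onto a cube.
   Formalization: Added hypothesis: for all i, j, Y_j is a translate of Y_i or Y_i^* if and only if Z_j is a translate of Z_i or Z_i^* (automatic without such repetitions); otherwise the claim fails, since E(Y_1,…,Y_n) and E(Z_1,…,Z_n) can have different numbers of G-orbits. *)

theory Defs
  imports "HOL-Analysis.Analysis" "HOL-Algebra.Generated_Groups"
begin

section \<open>Almost invariant sets\<close>

definition finitely_generated :: "('g, 'm) monoid_scheme \<Rightarrow> 'g set \<Rightarrow> bool" where
  "finitely_generated G H \<longleftrightarrow> subgroup H G \<and> (\<exists>T. finite T \<and> T \<subseteq> H \<and> generate G T = H)"

definition almost_equal :: "'p set \<Rightarrow> 'p set \<Rightarrow> bool" where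
  "almost_equal P Q \<longleftrightarrow> finite (sym_diff P Q)"

definition almost_invariant_subset ::
    "('g, 'm) monoid_scheme \<Rightarrow> ('p \<Rightarrow> 'g \<Rightarrow> 'p) \<Rightarrow> 'p set \<Rightarrow> bool" where
  "almost_invariant_subset G act P \<longleftrightarrow>
     (\<forall>g\<in>carrier G. almost_equal ((\<lambda>p. act p g) ` P) P)"

text \<open>The image \<open>H\X\<close> of \<open>X\<close> in the set \<open>H\G\<close> of cosets \<open>Hg\<close>.\<close>

definition coset_image :: "('g, 'm) monoid_scheme \<Rightarrow> 'g set \<Rightarrow> 'g set \<Rightarrow> 'g set set" where
  "coset_image G H X = (\<lambda>x. H #>\<^bsub>G\<^esub> x) ` X"

definition complem :: "('g, 'm) monoid_scheme \<Rightarrow> 'g set \<Rightarrow> 'g set" where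
  "complem G X = carrier G - X"

definition almost_invariant :: "('g, 'm) monoid_scheme \<Rightarrow> 'g set \<Rightarrow> 'g set \<Rightarrow> bool" where
  "almost_invariant G H X \<longleftrightarrow>
     subgroup H G \<and> X \<subseteq> carrier G \<and> (\<forall>h\<in>H. h <#\<^bsub>G\<^esub> X = X) \<and>
     almost_invariant_subset G (\<lambda>C g. C #>\<^bsub>G\<^esub> g) (coset_image G H X)"

definition nontrivial_ai :: "('g, 'm) monoid_scheme \<Rightarrow> 'g set \<Rightarrow> 'g set \<Rightarrow> bool" where
  "nontrivial_ai G H X \<longleftrightarrow>
     almost_invariant G H X \<and>
     infinite (coset_image G H X) \<and> infinite (coset_image G H (complem G X))"

definition H_finite :: "('g, 'm) monoid_scheme \<Rightarrow> 'g set \<Rightarrow> 'g set \<Rightarrow> bool" where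
  "H_finite G H C \<longleftrightarrow>
     (\<exists>F. finite F \<and> F \<subseteq> carrier G \<and> C \<subseteq> (\<Union>g\<in>F. H #>\<^bsub>G\<^esub> g))"

definition equivalent_ai ::
    "('g, 'm) monoid_scheme \<Rightarrow> 'g set \<Rightarrow> 'g set \<Rightarrow> 'g set \<Rightarrow> 'g set \<Rightarrow> bool" where
  "equivalent_ai G H X K Y \<longleftrightarrow>
     almost_invariant G H X \<and> almost_invariant G K Y \<and> H_finite G H (sym_diff X Y)"

definition invertible_ai :: "('g, 'm) monoid_scheme \<Rightarrow> 'g set \<Rightarrow> bool" where
  "invertible_ai G X \<longleftrightarrow> (\<exists>g\<in>carrier G. g <#\<^bsub>G\<^esub> X = complem G X)"

section \<open>The poset of translates\<close>

definition translates ::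
    "('g, 'm) monoid_scheme \<Rightarrow> ('i \<Rightarrow> 'g set) \<Rightarrow> 'i set \<Rightarrow> 'g set set" where
  "translates G X I =
     {B. \<exists>g\<in>carrier G. \<exists>i\<in>I.
        B = g <#\<^bsub>G\<^esub> X i \<or> B = g <#\<^bsub>G\<^esub> complem G (X i)}"

text \<open>The corner of \<open>(U, V)\<close> selected by two signs, \<open>True\<close> standing for the set itself and
  \<open>False\<close> for its complement.\<close>

definition corner :: "('g, 'm) monoid_scheme \<Rightarrow> 'g set \<Rightarrow> 'g set \<Rightarrow> bool \<times> bool \<Rightarrow> 'g set" where
  "corner G U V = (\<lambda>(s, t). (if s then U else complem G U) \<inter> (if t then V else complem G V))"

text \<open>A nontrivial \<open>H\<close>-almost invariant set \<open>U\<close> determines \<open>H\<close> up to commensurability (\<open>H\<close> has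
  finite index in the stabiliser of \<open>U\<close> when \<open>G\<close> is finitely generated), so it does not matter
  which \<open>H\<close> witnesses smallness.\<close>

definition small_corner ::
    "('g, 'm) monoid_scheme \<Rightarrow> 'g set \<Rightarrow> 'g set \<Rightarrow> bool \<times> bool \<Rightarrow> bool" where
  "small_corner G U V c \<longleftrightarrow> (\<exists>H. nontrivial_ai G H U \<and> H_finite G H (corner G U V c))"

definition good_position :: "('g, 'm) monoid_scheme \<Rightarrow> 'g set set \<Rightarrow> bool" where
  "good_position G E \<longleftrightarrow>
     (\<forall>U\<in>E. \<forall>V\<in>E.
        (\<exists>c d. c \<noteq> d \<and> small_corner G U V c \<and> small_corner G U V d) \<longrightarrow>
        (\<exists>c. corner G U V c = {}))"

definition ai_le :: "('g, 'm) monoid_scheme \<Rightarrow> 'g set \<Rightarrow> 'g set \<Rightarrow> bool" where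
  "ai_le G U V \<longleftrightarrow>
     corner G U V (True, False) = {} \<or>
     (\<forall>c. small_corner G U V c \<longleftrightarrow> c = (True, False))"

text \<open>Since \<open>translates\<close> is a set, a member of a family that is a translate of another member, or
  of its complement, is redundant.  Two families are equally redundant if this happens for the
  same pairs of indices; in particular this holds whenever neither family has redundancies.\<close>

definition equally_redundant ::
    "('g, 'm) monoid_scheme \<Rightarrow> ('i \<Rightarrow> 'g set) \<Rightarrow> ('i \<Rightarrow> 'g set) \<Rightarrow> 'i set \<Rightarrow> bool" where
  "equally_redundant G Y Z I \<longleftrightarrow>
     (\<forall>i\<in>I. \<forall>j\<in>I. Y j \<in> translates G Y {i} \<longleftrightarrow> Z j \<in> translates G Z {i})"

section \<open>Cubed complexes\<close>

text \<open>An \<open>n\<close>-cube is given by a set \<open>D\<close> of \<open>n\<close> coordinate directions (only the cardinality of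
  \<open>D\<close> matters) and a map \<open>f\<close> on \<open>Pow D\<close>, where \<open>f S\<close> is the vertex with coordinates 1 in the
  directions in \<open>S\<close> and 0 in the others; \<open>f\<close> is irrelevant outside \<open>Pow D\<close>.  In rule \<open>attach\<close> the
  facets of \<open>(D, f)\<close> form the boundary of an \<open>n\<close>-cube in the \<open>(n-1)\<close>-skeleton.\<close>

inductive cube :: "'v set \<Rightarrow> ('v \<Rightarrow> 'v \<Rightarrow> bool) \<Rightarrow> nat set \<Rightarrow> (nat set \<Rightarrow> 'v) \<Rightarrow> bool"
  for verts :: "'v set" and adj :: "'v \<Rightarrow> 'v \<Rightarrow> bool"
where
  vertex: "f {} \<in> verts \<Longrightarrow> cube verts adj {} f"
| edge: "\<lbrakk>f {} \<in> verts; f {i} \<in> verts; adj (f {}) (f {i})\<rbrakk> \<Longrightarrow> cube verts adj {i} f"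
| attach: "\<lbrakk>finite D; card D \<ge> 2; inj_on f (Pow D);
     \<And>i. i \<in> D \<Longrightarrow> cube verts adj (D - {i}) f;
     \<And>i. i \<in> D \<Longrightarrow> cube verts adj (D - {i}) (\<lambda>S. f (insert i S))\<rbrakk>
   \<Longrightarrow> cube verts adj D f"

type_synonym 'v cubes = "(nat set \<times> (nat set \<Rightarrow> 'v)) set"

text \<open>In the geometric realisation of a set of cubes, the point with coordinates \<open>t\<close> of a cube is
  recorded by its multilinear weights at the vertices of the cube.  The weights of a point in a
  face are the same whether computed in the face or in the cube, so cubes are glued along common
  faces, and reparametrisations of a cube have the same points.\<close>

definition unit_cube :: "nat set \<Rightarrow> (nat \<Rightarrow> real) set" where
  "unit_cube D = D \<rightarrow>\<^sub>E {0..1}"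

definition cube_point :: "nat set \<Rightarrow> (nat set \<Rightarrow> 'v) \<Rightarrow> (nat \<Rightarrow> real) \<Rightarrow> ('v \<Rightarrow> real)" where
  "cube_point D f t =
     (\<lambda>v. \<Sum>S | S \<subseteq> D \<and> f S = v. \<Prod>i\<in>D. if i \<in> S then t i else 1 - t i)"

definition vertex_point :: "'v \<Rightarrow> ('v \<Rightarrow> real)" where
  "vertex_point v = (\<lambda>w. if w = v then 1 else 0)"

definition cell :: "nat set \<Rightarrow> (nat set \<Rightarrow> 'v) \<Rightarrow> ('v \<Rightarrow> real) set" where
  "cell D f = cube_point D f ` unit_cube D"

definition realisation :: "'v cubes \<Rightarrow> ('v \<Rightarrow> real) set" where
  "realisation C = (\<Union>(D, f)\<in>C. cell D f)"

text \<open>The weak topology.\<close>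

definition realisation_topology :: "'v cubes \<Rightarrow> ('v \<Rightarrow> real) topology" where
  "realisation_topology C = topology (\<lambda>U. U \<subseteq> realisation C \<and>
     (\<forall>(D, f)\<in>C. openin (product_topology (\<lambda>_. top_of_set {0..1}) D)
        {t \<in> unit_cube D. cube_point D f t \<in> U}))"

lemma openin_realisation_topology:
  "openin (realisation_topology C) U \<longleftrightarrow> U \<subseteq> realisation C \<and>
     (\<forall>(D, f)\<in>C. openin (product_topology (\<lambda>_. top_of_set {0..1}) D)
        {t \<in> unit_cube D. cube_point D f t \<in> U})"
proof -
  let ?T = "\<lambda>D :: nat set. product_topology (\<lambda>_. top_of_set {0..1 :: real}) D"
  let ?P = "\<lambda>U. U \<subseteq> realisation C \<and>
     (\<forall>(D, f)\<in>C. openin (?T D) {t \<in> unit_cube D. cube_point D f t \<in> U})"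
  have "istopology ?P"
    unfolding istopology_def
  proof (intro conjI allI impI)
    fix S T assume S: "?P S" and T: "?P T"
    show "S \<inter> T \<subseteq> realisation C" using S by blast
    show "\<forall>(D, f)\<in>C. openin (?T D) {t \<in> unit_cube D. cube_point D f t \<in> S \<inter> T}"
    proof clarify
      fix D f assume Df: "(D, f) \<in> C"
      have "openin (?T D) ({t \<in> unit_cube D. cube_point D f t \<in> S} \<inter>
                           {t \<in> unit_cube D. cube_point D f t \<in> T})"
        using S T Df by (intro openin_Int) auto
      moreover have "{t \<in> unit_cube D. cube_point D f t \<in> S} \<inter>
          {t \<in> unit_cube D. cube_point D f t \<in> T} =
          {t \<in> unit_cube D. cube_point D f t \<in> S \<inter> T}" by blast
      ultimately show "openin (?T D) {t \<in> unit_cube D. cube_point D f t \<in> S \<inter> T}" by simp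
    qed
  next
    fix \<K> assume K: "\<forall>U\<in>\<K>. ?P U"
    show "\<Union>\<K> \<subseteq> realisation C" using K by blast
    show "\<forall>(D, f)\<in>C. openin (?T D) {t \<in> unit_cube D. cube_point D f t \<in> \<Union>\<K>}"
    proof clarify
      fix D f assume Df: "(D, f) \<in> C"
      have "openin (?T D) (\<Union>U\<in>\<K>. {t \<in> unit_cube D. cube_point D f t \<in> U})"
        using K Df by (intro openin_Union) auto
      moreover have "(\<Union>U\<in>\<K>. {t \<in> unit_cube D. cube_point D f t \<in> U}) =
          {t \<in> unit_cube D. cube_point D f t \<in> \<Union>\<K>}" by blast
      ultimately show "openin (?T D) {t \<in> unit_cube D. cube_point D f t \<in> \<Union>\<K>}" by simp
    qed
  qed
  then show ?thesis
    unfolding realisation_topology_def by (simp add: topology_inverse')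
qed

text \<open>The map of realisations induced by a map of vertices; it sends \<open>cube_point D f t\<close> to
  \<open>cube_point D (\<phi> \<circ> f) t\<close>.\<close>

definition realise_map :: "('v \<Rightarrow> 'w) \<Rightarrow> ('v \<Rightarrow> real) \<Rightarrow> ('w \<Rightarrow> real)" where
  "realise_map \<phi> p = (\<lambda>w. \<Sum>v | p v \<noteq> 0 \<and> \<phi> v = w. p v)"

definition isometric_cells ::
    "(('v \<Rightarrow> real) \<Rightarrow> ('w \<Rightarrow> real)) \<Rightarrow> nat set \<Rightarrow> (nat set \<Rightarrow> 'v) \<Rightarrow>
      nat set \<Rightarrow> (nat set \<Rightarrow> 'w) \<Rightarrow> bool" where
  "isometric_cells h D f D' f' \<longleftrightarrow>
     (\<exists>\<sigma>. bij_betw \<sigma> (unit_cube D) (unit_cube D') \<and>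
        (\<forall>s\<in>unit_cube D. \<forall>t\<in>unit_cube D.
           L2_set (\<lambda>i. \<sigma> s i - \<sigma> t i) D' = L2_set (\<lambda>i. s i - t i) D) \<and>
        (\<forall>t\<in>unit_cube D. h (cube_point D f t) = cube_point D' f' (\<sigma> t)))"

definition cubing_isomorphism ::
    "'v cubes \<Rightarrow> 'w cubes \<Rightarrow> (('v \<Rightarrow> real) \<Rightarrow> ('w \<Rightarrow> real)) \<Rightarrow> bool" where
  "cubing_isomorphism C C' h \<longleftrightarrow>
     homeomorphic_map (realisation_topology C) (realisation_topology C') h \<and>
     (\<forall>(D, f)\<in>C. \<exists>(D', f')\<in>C'. isometric_cells h D f D' f')"

section \<open>The cubing of ultrafilters\<close>

definition ultrafilters :: "('g, 'm) monoid_scheme \<Rightarrow> 'g set set \<Rightarrow> 'g set set set" where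
  "ultrafilters G E = {V. V \<subseteq> E \<and>
     (\<forall>A\<in>E. (A \<in> V) \<noteq> (complem G A \<in> V)) \<and>
     (\<forall>A\<in>V. \<forall>B\<in>E. ai_le G A B \<longrightarrow> B \<in> V)}"

definition uf_adjacent ::
    "('g, 'm) monoid_scheme \<Rightarrow> 'g set set \<Rightarrow> 'g set set \<Rightarrow> bool" where
  "uf_adjacent G V V' \<longleftrightarrow> (\<exists>A\<in>V. V' = (V - {A}) \<union> {complem G A})"

definition Lambda_cubes :: "('g, 'm) monoid_scheme \<Rightarrow> 'g set set \<Rightarrow> 'g set set cubes" where
  "Lambda_cubes G E = {(D, f). cube (ultrafilters G E) (uf_adjacent G) D f}"

definition translate_uf :: "('g, 'm) monoid_scheme \<Rightarrow> 'g \<Rightarrow> 'g set set \<Rightarrow> 'g set set" where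
  "translate_uf G g V = (\<lambda>A. g <#\<^bsub>G\<^esub> A) ` V"

definition cayley_edges :: "('g, 'm) monoid_scheme \<Rightarrow> 'g set \<Rightarrow> 'g set set" where
  "cayley_edges G S = {{g, g \<otimes>\<^bsub>G\<^esub> s} | g s. g \<in> carrier G \<and> s \<in> S}"

text \<open>Vertices of \<open>N\<^sub>R(g)\<close>.\<close>

definition cayley_ball ::
    "('g, 'm) monoid_scheme \<Rightarrow> 'g set \<Rightarrow> real \<Rightarrow> 'g \<Rightarrow> 'g set" where
  "cayley_ball G S R g =
     {x. \<exists>k. real k \<le> R \<and> (g, x) \<in> {(a, b). {a, b} \<in> cayley_edges G S} ^^ k}"

definition coboundary :: "('g, 'm) monoid_scheme \<Rightarrow> 'g set \<Rightarrow> 'g set \<Rightarrow> 'g set set" where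
  "coboundary G S A = {e \<in> cayley_edges G S. e \<inter> A \<noteq> {} \<and> e - A \<noteq> {}}"

definition admissible_radius ::
    "('g, 'm) monoid_scheme \<Rightarrow> 'g set \<Rightarrow> 'g set set \<Rightarrow> real \<Rightarrow> bool" where
  "admissible_radius G S E R \<longleftrightarrow> R > 0 \<and>
     (\<forall>A\<in>E. \<forall>B\<in>E. \<forall>g. ai_le G A B \<and> g \<in> A \<and> cayley_ball G S R g \<subseteq> A \<longrightarrow> g \<in> B)"

text \<open>An edge lies in \<open>N\<^sub>R(g)\<close> if both of its endpoints do.\<close>

definition near_sets ::
    "('g, 'm) monoid_scheme \<Rightarrow> 'g set \<Rightarrow> 'g set set \<Rightarrow> real \<Rightarrow> 'g \<Rightarrow> 'g set set" where
  "near_sets G S E R g = {A \<in> E. \<exists>e \<in> coboundary G S A. e \<subseteq> cayley_ball G S R g}"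

definition undecided :: "('g, 'm) monoid_scheme \<Rightarrow> 'g set set \<Rightarrow> 'g set set \<Rightarrow> 'g set set" where
  "undecided G E U = E - (U \<union> complem G ` U)"

text \<open>The sets \<open>U\<^sub>1, U\<^sub>2, \<dots>\<close> arising from some sequence of choices of minimal elements.\<close>

inductive basic_stage ::
    "('g, 'm) monoid_scheme \<Rightarrow> 'g set \<Rightarrow> 'g set set \<Rightarrow> real \<Rightarrow> 'g \<Rightarrow> 'g set set \<Rightarrow> bool"
  for G :: "('g, 'm) monoid_scheme" and S :: "'g set" and E :: "'g set set"
    and R :: real and g :: 'g
where
  start: "Ug = {A \<in> E - near_sets G S E R g. g \<in> A} \<Longrightarrow>
    basic_stage G S E R g (Ug \<union> {B \<in> near_sets G S E R g. \<exists>A\<in>Ug. ai_le G A B})"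
| step: "\<lbrakk>basic_stage G S E R g U; A \<in> undecided G E U;
     \<And>B. \<lbrakk>B \<in> undecided G E U; ai_le G B A\<rbrakk> \<Longrightarrow> B = A\<rbrakk> \<Longrightarrow>
    basic_stage G S E R g (U \<union> {B \<in> undecided G E U. ai_le G A B})"

definition basic_vertex ::
    "('g, 'm) monoid_scheme \<Rightarrow> 'g set \<Rightarrow> 'g set set \<Rightarrow> real \<Rightarrow> 'g set set \<Rightarrow> bool" where
  "basic_vertex G S E R W \<longleftrightarrow>
     (\<exists>g\<in>carrier G. basic_stage G S E R g W \<and> undecided G E W = {})"

text \<open>The cubes of \<open>L\<close>: those contained in the component of the basic vertices.\<close>

definition cubing ::
    "('g, 'm) monoid_scheme \<Rightarrow> 'g set \<Rightarrow> 'g set set \<Rightarrow> real \<Rightarrow> 'g set set cubes" where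
  "cubing G S E R = {(D, f) \<in> Lambda_cubes G E. \<exists>W. basic_vertex G S E R W \<and>
     cell D f \<subseteq> connected_component_of_set (realisation_topology (Lambda_cubes G E))
       (vertex_point W)}"

end

theory Submission
  imports Defs
begin

text \<open>
  Since \<open>\<le>\<close> compares inequivalent sets by the smallness of one corner, and smallness depends only
  on equivalence classes, it is only inside an equivalence class that passing from the \<open>Y i\<close> to the
  \<open>Z i\<close> could change the order.  Good position makes the members of one family in such a class a chain
  for inclusion.  The obvious correspondence \<open>Y i \<mapsto> Z i\<close> need not preserve this chain: when
  \<open>Y i\<close> and \<open>Y j\<close> are equivalent, their translates may interleave differently from those of
  \<open>Z i\<close> and \<open>Z j\<close>.  So the bijection has to be found class by class.

  Fix \<open>U\<close> and let \<open>\<Gamma>\<close> be the group of those elements of \<open>G \<times> {1, *}\<close>, acting by translation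
  and complementation, that preserve the class of \<open>U\<close>.  All members of the class, in either family,
  have the same stabiliser \<open>N\<close> (\<open>stabiliser_eq_if_eqv\<close>).  Counting the cosets of \<open>N\<close> in
  \<open>V - U\<close> and in \<open>U - V\<close> gives each \<open>V\<close> in the class an integer \<open>height\<close>, which embeds each of
  the two chains in \<open>\<int>\<close>; moreover each element of \<open>\<Gamma>\<close> changes heights by a translation or
  a reflection of \<open>\<int>\<close> which is the same for both families (\<open>height_signed\<close>).  This turns the
  two chains into subsets \<open>A\<close>, \<open>B\<close> of \<open>\<int>\<close> which are invariant under one group of isometries.
  Equal redundancy says that the orbits in \<open>A\<close> and in \<open>B\<close> correspond; since no set is
  invertible, no reflection fixes a point of \<open>A\<close> or \<open>B\<close>.  Such \<open>A\<close> and \<open>B\<close> are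
  equivariantly order isomorphic, because an interval that is a fundamental domain contains equally many
  points of each (\<open>equivariant_order_iso\<close>).  Doing this for one class in each orbit of classes and
  transporting the result gives a bijection \<open>\<phi>\<close> from \<open>E\<^sub>Y\<close> to \<open>E\<^sub>Z\<close> that respects translation,
  complements, \<open>\<le>\<close> and equivalence (\<open>ex_signed_iso\<close>, \<open>ai_le_transfer\<close>).

  The map \<open>\<phi>\<close> sends ultrafilters to ultrafilters and edges to edges, hence cubes to cubes, and the
  induced map of realisations is a homeomorphism that is isometric on cubes.  It remains to see that it
  respects the component of the basic vertices.  A basic vertex at \<open>g\<close> contains a set \<open>A\<close> exactly
  if \<open>g \<in> A\<close>, with finitely many exceptions.  As \<open>A\<close> and \<open>\<phi> A\<close> differ by finitely many
  cosets, \<open>g\<close> lies in their symmetric difference for only finitely many \<open>A\<close>.  So the image of a basic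
  vertex at \<open>g\<close> has finite difference from a basic vertex at \<open>g\<close>
  (\<open>family_iso_basic_vertex\<close>), and ultrafilters with finite difference are joined by a path
  (\<open>connected_component_ultrafilters\<close>).
\<close>

section \<open>Equivariant order isomorphisms between sets of integers\<close>

lemma card_image_cong_fibres:
  assumes "\<And>x y. x \<in> X \<Longrightarrow> y \<in> X \<Longrightarrow> f x = f y \<longleftrightarrow> g x = g y"
  shows "card (f ` X) = card (g ` X)"
proof -
  define h where "h z = g (SOME x. x \<in> X \<and> f x = z)" for z
  have h: "h (f x) = g x" if "x \<in> X" for x
  proof -
    have "(SOME y. y \<in> X \<and> f y = f x) \<in> X \<and> f (SOME y. y \<in> X \<and> f y = f x) = f x"
      by (rule someI[of "\<lambda>y. y \<in> X \<and> f y = f x" x]) (use that in simp)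
    then show ?thesis unfolding h_def using assms that by metis
  qed
  have "bij_betw h (f ` X) (g ` X)"
    unfolding bij_betw_def
  proof
    show "inj_on h (f ` X)" by (rule inj_onI) (use h assms in auto)
    show "h ` f ` X = g ` X" using h by (force simp: image_iff)
  qed
  then show ?thesis by (rule bij_betw_same_card)
qed

lemma increasing_enumeration:
  fixes M :: "'a :: linorder set"
  assumes "finite M"
  obtains e where "bij_betw e {..<card M} M" "strict_mono_on {..<card M} e"
proof
  let ?l = "sorted_list_of_set M"
  show "bij_betw ((!) ?l) {..<card M} M"
    by (rule bij_betw_nth) (use assms in auto)
  show "strict_mono_on {..<card M} ((!) ?l)"
    by (rule strict_mono_onI)
      (use assms strict_sorted_list_of_set[of M] in \<open>auto intro: sorted_wrt_nth_less\<close>)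
qed

text \<open>The translations by elements of \<open>P\<close> and the reflections \<open>x \<mapsto> c - x\<close> for \<open>c\<close> in \<open>Q\<close> form a
group of isometries of \<open>\<int>\<close>; \<open>Q\<close> is empty or a coset of \<open>P\<close>.\<close>

locale line_motions =
  fixes P Q :: "int set"
  assumes zero_shift: "0 \<in> P"
    and diff_shift: "p \<in> P \<Longrightarrow> p' \<in> P \<Longrightarrow> p - p' \<in> P"
    and flip_shift: "c \<in> Q \<Longrightarrow> p \<in> P \<Longrightarrow> c + p \<in> Q"
    and diff_flip: "c \<in> Q \<Longrightarrow> c' \<in> Q \<Longrightarrow> c - c' \<in> P"
begin

definition motions :: "(int \<Rightarrow> int) set" where
  "motions = (\<lambda>p x. x + p) ` P \<union> (\<lambda>c x. c - x) ` Q"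

lemma motions_cases [consumes 1, case_names shift flip]:
  assumes "\<delta> \<in> motions"
  obtains p where "p \<in> P" "\<delta> = (\<lambda>x. x + p)" | c where "c \<in> Q" "\<delta> = (\<lambda>x. c - x)"
  using assms unfolding motions_def by auto

lemma shift_motion: "p \<in> P \<Longrightarrow> (\<lambda>x. x + p) \<in> motions"
  and flip_motion: "c \<in> Q \<Longrightarrow> (\<lambda>x. c - x) \<in> motions"
  unfolding motions_def by auto

lemma minus_shift: "p \<in> P \<Longrightarrow> - p \<in> P"
  using diff_shift[OF zero_shift] by simp

lemma add_shift: "p \<in> P \<Longrightarrow> p' \<in> P \<Longrightarrow> p + p' \<in> P"
  using diff_shift[of p "- p'"] minus_shift by simp

lemma mult_shift:
  assumes "p \<in> P"
  shows "k * p \<in> P"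
proof -
  have "int n * p \<in> P" for n
    by (induction n) (auto simp: zero_shift algebra_simps intro: add_shift assms)
  from this[of "nat k"] minus_shift[OF this[of "nat (- k)"]]
  show ?thesis by (cases "0 \<le> k") (simp_all add: nonneg_int_cases)
qed

lemma id_motion: "(\<lambda>x. x) \<in> motions"
  using shift_motion[OF zero_shift] by simp

lemma comp_motion:
  assumes "\<delta> \<in> motions" "\<epsilon> \<in> motions"
  shows "(\<lambda>x. \<delta> (\<epsilon> x)) \<in> motions"
  using assms(1)
proof (cases rule: motions_cases)
  case (shift p)
  from assms(2) show ?thesis
  proof (cases rule: motions_cases)
    case (shift q)
    then show ?thesis
      using shift_motion[OF add_shift[OF \<open>q \<in> P\<close> \<open>p \<in> P\<close>]] \<open>\<delta> = _\<close> by (simp add: add.assoc)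
  next
    case (flip c)
    then show ?thesis
      using flip_motion[OF flip_shift[OF \<open>c \<in> Q\<close> \<open>p \<in> P\<close>]] \<open>\<delta> = _\<close> by (simp add: algebra_simps)
  qed
next
  case (flip c)
  from assms(2) show ?thesis
  proof (cases rule: motions_cases)
    case (shift q)
    then show ?thesis
      using flip_motion[OF flip_shift[OF \<open>c \<in> Q\<close> minus_shift[OF \<open>q \<in> P\<close>]]] \<open>\<delta> = _\<close>
      by (simp add: algebra_simps)
  next
    case (flip d)
    then show ?thesis
      using shift_motion[OF diff_flip[OF \<open>c \<in> Q\<close> \<open>d \<in> Q\<close>]] \<open>\<delta> = _\<close> by (simp add: algebra_simps)
  qed
qed

lemma inverse_motion:
  assumes "\<delta> \<in> motions"
  obtains \<epsilon> where "\<epsilon> \<in> motions" "\<And>x. \<epsilon> (\<delta> x) = x" "\<And>x. \<delta> (\<epsilon> x) = x"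
  using assms
proof (cases rule: motions_cases)
  case (shift p)
  then show ?thesis using that[OF shift_motion[OF minus_shift]] by auto
next
  case (flip c)
  then show ?thesis using that[OF flip_motion] by auto
qed

text \<open>The point \<open>x\<close> is fixed by a reflection if and only if \<open>2 * x \<in> Q\<close>.  Excluding these points makes it
possible for an interval to meet every remaining orbit exactly once.\<close>

definition fundamental :: "int set \<Rightarrow> bool" where
  "fundamental F \<longleftrightarrow>
     (\<forall>x y z. x \<in> F \<longrightarrow> z \<in> F \<longrightarrow> x \<le> y \<longrightarrow> y \<le> z \<longrightarrow> y \<in> F) \<and>
     (\<forall>x. 2 * x \<notin> Q \<longrightarrow> (\<exists>\<delta>\<in>motions. \<delta> x \<in> F)) \<and>
     (\<forall>x. \<forall>\<delta>\<in>motions. x \<in> F \<longrightarrow> \<delta> x \<in> F \<longrightarrow> \<delta> = (\<lambda>x. x))"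

text \<open>If \<open>p\<close> is the least positive translation length and \<open>c\<close> a reflection, take the open interval
between the centres \<open>c / 2\<close> and \<open>(c + p) / 2\<close> of two neighbouring reflections; its ends are fixed
points.  If \<open>p\<close> or \<open>c\<close> is missing, a period or a half-line serves, and \<open>\<int>\<close> itself if both are.\<close>

lemma ex_fundamental: "\<exists>F. fundamental F"
proof (cases "P = {0}")
  case True
  show ?thesis
  proof (cases "Q = {}")
    case Qe: True
    have "fundamental UNIV"
      unfolding fundamental_def motions_def using True Qe by auto
    then show ?thesis by blast
  next
    case False
    then obtain c where c: "c \<in> Q" by blast
    have "d = c" if "d \<in> Q" for d
      using diff_flip[OF that c] unfolding True by simp
    then have Q: "Q = {c}" using c by blast
    have "fundamental {x. c < 2 * x}"
      unfolding fundamental_def motions_def using Q True by (auto simp: neq_iff)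
    then show ?thesis by blast
  qed
next
  case False
  then obtain q where q: "q \<in> P" "q \<noteq> 0" using zero_shift by blast
  then have "nat \<bar>q\<bar> \<in> {n. 0 < n \<and> int n \<in> P}"
    using minus_shift[of q] by (cases "q < 0") auto
  define m where "m = (LEAST n. 0 < n \<and> int n \<in> P)"
  have m: "0 < m" "int m \<in> P"
    using LeastI[of "\<lambda>n. 0 < n \<and> int n \<in> P" "nat \<bar>q\<bar>"] \<open>nat \<bar>q\<bar> \<in> _\<close> by (auto simp: m_def)
  define p where "p = int m"
  have p: "0 < p" "p \<in> P" using m by (auto simp: p_def)
  have least: "p \<le> \<bar>r\<bar>" if "r \<in> P" "r \<noteq> 0" for r
  proof -
    have "\<bar>r\<bar> \<in> P" using that minus_shift[of r] by (cases "r < 0") auto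
    then have "m \<le> nat \<bar>r\<bar>"
      unfolding m_def by (intro Least_le) (use that in auto)
    then show ?thesis using that by (simp add: p_def)
  qed
  show ?thesis
  proof (cases "Q = {}")
    case True
    have ex: "\<exists>\<delta>\<in>motions. \<delta> x \<in> {0..<p}" for x
    proof
      show "(\<lambda>y. y + (- (x div p)) * p) \<in> motions"
        by (rule shift_motion[OF mult_shift[OF p(2)]])
      have "x + (- (x div p)) * p = x mod p"
        using minus_div_mult_eq_mod[of x p] by simp
      then show "x + (- (x div p)) * p \<in> {0..<p}" using p(1) by simp
    qed
    have un: "\<delta> = (\<lambda>x. x)" if "\<delta> \<in> motions" "x \<in> {0..<p}" "\<delta> x \<in> {0..<p}" for \<delta> x
      using that(1)
    proof (cases rule: motions_cases)
      case (shift r)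
      then have "r = 0" using least[OF shift(1)] that by (cases "r = 0") auto
      then show ?thesis using shift by simp
    next
      case (flip c) then show ?thesis using True by simp
    qed
    have "fundamental {0..<p}"
      unfolding fundamental_def using ex un by auto
    then show ?thesis by blast
  next
    case False
    then obtain c where c: "c \<in> Q" by blast
    define F where "F = {x. c < 2 * x \<and> 2 * x < c + p}"
    have ex: "\<exists>\<delta>\<in>motions. \<delta> x \<in> F" if x: "2 * x \<notin> Q" for x
    proof -
      define k where "k = - ((2 * x - c) div (2 * p))"
      define y where "y = x + k * p"
      have "2 * y - c = (2 * x - c) mod (2 * p)"
        using minus_div_mult_eq_mod[of "2 * x - c" "2 * p"] by (simp add: y_def k_def algebra_simps)
      then have y: "0 \<le> 2 * y - c" "2 * y - c < 2 * p" using p(1) by auto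
      have sh: "(\<lambda>x. x + k * p) \<in> motions" by (rule shift_motion[OF mult_shift[OF p(2)]])
      have n0: "2 * y \<noteq> c + l * p" for l
      proof
        assume "2 * y = c + l * p"
        then have "2 * x = c + (l - 2 * k) * p" by (simp add: y_def algebra_simps)
        then show False using flip_shift[OF c mult_shift[OF p(2), of "l - 2 * k"]] x by simp
      qed
      show ?thesis
      proof (cases "2 * y < c + p")
        case True
        then have "y \<in> F" using y n0[of 0] by (auto simp: F_def)
        then show ?thesis using sh by (intro bexI[of _ "\<lambda>x. x + k * p"]) (auto simp: y_def)
      next
        case False
        then have "(c + p) - y \<in> F" using y n0[of 1] by (auto simp: F_def)
        moreover have "(\<lambda>x. (c + p) - (x + k * p)) \<in> motions"
          using comp_motion[OF flip_motion[OF flip_shift[OF c p(2)]] sh] .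
        ultimately show ?thesis
          by (intro bexI[of _ "\<lambda>x. (c + p) - (x + k * p)"]) (auto simp: y_def)
      qed
    qed
    have un: "\<delta> = (\<lambda>x. x)" if "\<delta> \<in> motions" "x \<in> F" "\<delta> x \<in> F" for \<delta> x
      using that(1)
    proof (cases rule: motions_cases)
      case (shift r)
      then have "r = 0" using least[OF shift(1)] that by (cases "r = 0") (auto simp: F_def)
      then show ?thesis using shift by simp
    next
      case (flip d)
      then have "d - c \<in> P" using diff_flip c by blast
      then have "d - c = 0 \<or> p \<le> \<bar>d - c\<bar>" using least by blast
      then show ?thesis using that flip p(1) by (auto simp: F_def)
    qed
    have "fundamental F"
      unfolding fundamental_def using ex un by (auto simp: F_def)
    then show ?thesis by blast
  qed
qed

text \<open>Each orbit in \<open>A\<close> or \<open>B\<close> meets the fundamental interval \<open>F\<close> once, so \<open>A \<inter> F\<close> and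
\<open>B \<inter> F\<close> are finite with equally many points.  Match them in increasing order and extend by
equivariance.  The images of \<open>F\<close> are pairwise disjoint intervals, so two points in different images
are compared by comparing the images, and this comparison is the same for \<open>A\<close> and \<open>B\<close>.\<close>

lemma equivariant_order_iso:
  assumes A: "\<And>x. x \<in> A \<Longrightarrow> 2 * x \<notin> Q" "\<And>\<delta> x. \<delta> \<in> motions \<Longrightarrow> x \<in> A \<Longrightarrow> \<delta> x \<in> A"
    and B: "\<And>x. x \<in> B \<Longrightarrow> 2 * x \<notin> Q" "\<And>\<delta> x. \<delta> \<in> motions \<Longrightarrow> x \<in> B \<Longrightarrow> \<delta> x \<in> B"
    and J: "finite J"
    and a: "\<And>j. j \<in> J \<Longrightarrow> a j \<in> A" "\<And>x. x \<in> A \<Longrightarrow> \<exists>j\<in>J. \<exists>\<delta>\<in>motions. x = \<delta> (a j)"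
    and b: "\<And>j. j \<in> J \<Longrightarrow> b j \<in> B" "\<And>x. x \<in> B \<Longrightarrow> \<exists>j\<in>J. \<exists>\<delta>\<in>motions. x = \<delta> (b j)"
    and match: "\<And>i j. i \<in> J \<Longrightarrow> j \<in> J \<Longrightarrow>
      (\<exists>\<delta>\<in>motions. a i = \<delta> (a j)) \<longleftrightarrow> (\<exists>\<delta>\<in>motions. b i = \<delta> (b j))"
  shows "\<exists>\<Phi>. bij_betw \<Phi> A B \<and> (\<forall>x\<in>A. \<forall>y\<in>A. x < y \<longleftrightarrow> \<Phi> x < \<Phi> y) \<and>
    (\<forall>\<delta>\<in>motions. \<forall>x\<in>A. \<Phi> (\<delta> x) = \<delta> (\<Phi> x))"
proof -
  obtain F where F: "fundamental F" using ex_fundamental by blast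
  have conv: "y \<in> F" if "x \<in> F" "z \<in> F" "x \<le> y" "y \<le> z" for x y z
    using F that unfolding fundamental_def by blast
  have ex: "\<exists>\<delta>\<in>motions. \<delta> x \<in> F" if "2 * x \<notin> Q" for x
    using F that unfolding fundamental_def by blast
  have un: "\<delta> = (\<lambda>x. x)" if "\<delta> \<in> motions" "x \<in> F" "\<delta> x \<in> F" for \<delta> x
    using F that unfolding fundamental_def by blast
  define \<tau> where "\<tau> x = (SOME \<delta>. \<delta> \<in> motions \<and> \<delta> x \<in> F)" for x
  have \<tau>: "\<tau> x \<in> motions" "\<tau> x x \<in> F" if "2 * x \<notin> Q" for x
    using someI_ex[of "\<lambda>\<delta>. \<delta> \<in> motions \<and> \<delta> x \<in> F"] ex[OF that] by (auto simp: \<tau>_def)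
  have \<tau>_eq: "\<tau> x x = \<delta> x" if x: "2 * x \<notin> Q" and \<delta>: "\<delta> \<in> motions" "\<delta> x \<in> F" for x \<delta>
  proof -
    obtain \<epsilon> where \<epsilon>: "\<epsilon> \<in> motions" "\<And>x. \<epsilon> (\<delta> x) = x" using inverse_motion[OF \<delta>(1)] by metis
    have "(\<lambda>y. \<tau> x (\<epsilon> y)) = (\<lambda>y. y)"
      by (rule un[of _ "\<delta> x"]) (use \<epsilon> \<delta> \<tau>[OF x] comp_motion in auto)
    then show ?thesis using \<epsilon>(2) by metis
  qed
  have orbit: "\<tau> x x = \<tau> y y \<longleftrightarrow> (\<exists>\<delta>\<in>motions. x = \<delta> y)"
    if x: "2 * x \<notin> Q" and y: "2 * y \<notin> Q" for x y
  proof
    obtain \<epsilon> where \<epsilon>: "\<epsilon> \<in> motions" "\<And>z. \<epsilon> (\<tau> x z) = z"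
      using inverse_motion[OF \<tau>(1)[OF x]] by metis
    assume "\<tau> x x = \<tau> y y"
    then have "x = \<epsilon> (\<tau> y y)" using \<epsilon> by metis
    then show "\<exists>\<delta>\<in>motions. x = \<delta> y"
      using comp_motion[OF \<epsilon>(1) \<tau>(1)[OF y]]
      by (intro bexI[of _ "\<lambda>z. \<epsilon> (\<tau> y z)"])
  next
    assume "\<exists>\<delta>\<in>motions. x = \<delta> y"
    then obtain \<delta> where \<delta>: "\<delta> \<in> motions" "x = \<delta> y" by blast
    show "\<tau> x x = \<tau> y y"
      using \<tau>_eq[OF y comp_motion[OF \<tau>(1)[OF x] \<delta>(1)]] \<tau>(2)[OF x] \<delta>(2) by metis
  qed
  have inF: "\<tau> x x = x" if "2 * x \<notin> Q" "x \<in> F" for x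
    using \<tau>_eq[OF that(1) id_motion] that by simp
  have AF: "A \<inter> F = (\<lambda>j. \<tau> (a j) (a j)) ` J"
  proof (intro Set.set_eqI iffI)
    fix x assume x: "x \<in> A \<inter> F"
    then obtain j where "j \<in> J" "\<exists>\<delta>\<in>motions. x = \<delta> (a j)" using a(2) by blast
    then show "x \<in> (\<lambda>j. \<tau> (a j) (a j)) ` J"
      using orbit[of x "a j"] inF[of x] x A(1) a(1) by (intro image_eqI[of _ _ j]) auto
  qed (use A a \<tau> in auto)
  have BF: "B \<inter> F = (\<lambda>j. \<tau> (b j) (b j)) ` J"
  proof (intro Set.set_eqI iffI)
    fix x assume x: "x \<in> B \<inter> F"
    then obtain j where "j \<in> J" "\<exists>\<delta>\<in>motions. x = \<delta> (b j)" using b(2) by blast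
    then show "x \<in> (\<lambda>j. \<tau> (b j) (b j)) ` J"
      using orbit[of x "b j"] inF[of x] x B(1) b(1) by (intro image_eqI[of _ _ j]) auto
  qed (use B b \<tau> in auto)
  have card_eq: "card (A \<inter> F) = card (B \<inter> F)"
    unfolding AF BF
    by (rule card_image_cong_fibres) (use orbit match A(1) B(1) a(1) b(1) in auto)
  have fin: "finite (A \<inter> F)" "finite (B \<inter> F)" unfolding AF BF using J by auto
  define N where "N = card (A \<inter> F)"
  obtain e where e: "bij_betw e {..<N} (A \<inter> F)"
      "strict_mono_on {..<N} e"
    using increasing_enumeration[OF fin(1), folded N_def] by blast
  obtain e' where e': "bij_betw e' {..<N} (B \<inter> F)"
      "strict_mono_on {..<N} e'"
    using increasing_enumeration[OF fin(2), folded card_eq, folded N_def] by blast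
  define r where "r = e' \<circ> the_inv_into {..<N} e"
  have r: "bij_betw r (A \<inter> F) (B \<inter> F)"
    unfolding r_def by (rule bij_betw_trans[OF bij_betw_the_inv_into[OF e(1)] e'(1)])
  have r_mono: "r x < r y" if xy: "x \<in> A \<inter> F" "y \<in> A \<inter> F" "x < y" for x y
  proof -
    obtain i j where ij: "i < N" "x = e i" "j < N" "y = e j"
      using xy(1,2)[folded bij_betw_imp_surj_on[OF e(1)]] by (elim imageE) simp
    have "\<not> j \<le> i"
      using strict_mono_onD[OF e(2), of j i] ij xy(3) by (cases "j = i") auto
    then have "e' i < e' j"
      using strict_mono_onD[OF e'(2), of i j] ij by simp
    moreover have "r x = e' i" "r y = e' j"
      using ij e(1) by (simp_all add: r_def bij_betw_def the_inv_into_f_f)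
    ultimately show ?thesis by simp
  qed
  \<comment> \<open>The point of the orbit of \<open>r (\<delta> x)\<close> that lies in the same tile as \<open>x\<close>.\<close>
  define \<Phi> where "\<Phi> x = (SOME z. \<exists>\<delta>\<in>motions. \<delta> x \<in> F \<and> r (\<delta> x) = \<delta> z)" for x
  have \<Phi>: "\<delta> (\<Phi> x) = r (\<delta> x)" if x: "x \<in> A" and \<delta>: "\<delta> \<in> motions" "\<delta> x \<in> F" for x \<delta>
  proof -
    obtain \<epsilon> where \<epsilon>: "\<epsilon> \<in> motions" "\<And>x. \<epsilon> (\<delta> x) = x" "\<And>x. \<delta> (\<epsilon> x) = x"
      using inverse_motion[OF \<delta>(1)] by metis
    have "\<exists>\<delta>'\<in>motions. \<delta>' x \<in> F \<and> r (\<delta>' x) = \<delta>' (\<Phi> x)"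
      unfolding \<Phi>_def by (rule someI[of _ "\<epsilon> (r (\<delta> x))"]) (use \<epsilon> \<delta> in auto)
    then obtain \<delta>' where \<delta>': "\<delta>' \<in> motions" "\<delta>' x \<in> F" "r (\<delta>' x) = \<delta>' (\<Phi> x)" by blast
    have "(\<lambda>y. \<delta>' (\<epsilon> y)) = (\<lambda>y. y)"
      by (rule un[of _ "\<delta> x"]) (use \<epsilon> \<delta> \<delta>' comp_motion in auto)
    then have "\<delta>' y = \<delta> y" for y using \<epsilon>(2) by metis
    then show ?thesis using \<delta>'(3) by simp
  qed
  have \<Phi>_eq: "\<Phi> (\<delta> x) = \<delta> (\<Phi> x)" if x: "x \<in> A" and \<delta>: "\<delta> \<in> motions" for x \<delta>
  proof -
    define \<theta> where "\<theta> = \<tau> (\<delta> x)"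
    have dx: "\<delta> x \<in> A" using A(2) that by blast
    have \<theta>: "\<theta> \<in> motions" "\<theta> (\<delta> x) \<in> F" using \<tau> A(1)[OF dx] by (auto simp: \<theta>_def)
    have "\<theta> (\<Phi> (\<delta> x)) = \<theta> (\<delta> (\<Phi> x))"
      using \<Phi>[OF dx \<theta>] \<Phi>[OF x comp_motion[OF \<theta>(1) \<delta>]] \<theta>(2) by simp
    then show ?thesis using inverse_motion[OF \<theta>(1)] by metis
  qed
  have \<Phi>_B: "\<Phi> x \<in> B" if x: "x \<in> A" for x
  proof -
    have t: "\<tau> x \<in> motions" "\<tau> x x \<in> A \<inter> F" using \<tau> A x by auto
    obtain \<epsilon> where \<epsilon>: "\<epsilon> \<in> motions" "\<And>z. \<epsilon> (\<tau> x z) = z" using inverse_motion[OF t(1)] by metis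
    have "\<tau> x (\<Phi> x) = r (\<tau> x x)" using \<Phi>[OF x t(1)] t(2) by simp
    then have "\<tau> x (\<Phi> x) \<in> B" using r t(2) by (auto simp: bij_betw_def)
    then show ?thesis using B(2)[OF \<epsilon>(1)] \<epsilon>(2) by metis
  qed
  have mono: "\<Phi> x < \<Phi> y" if xy: "x \<in> A" "y \<in> A" "x < y" for x y
  proof -
    have t: "\<tau> x \<in> motions" "\<tau> x x \<in> F" using \<tau> A xy by auto
    have s: "\<tau> y \<in> motions" "\<tau> y y \<in> F" using \<tau> A xy by auto
    obtain \<epsilon> where \<epsilon>: "\<epsilon> \<in> motions" "\<And>z. \<epsilon> (\<tau> x z) = z" "\<And>z. \<tau> x (\<epsilon> z) = z"
      using inverse_motion[OF t(1)] by metis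
    obtain \<epsilon>' where \<epsilon>': "\<epsilon>' \<in> motions" "\<And>z. \<epsilon>' (\<tau> y z) = z" "\<And>z. \<tau> y (\<epsilon>' z) = z"
      using inverse_motion[OF s(1)] by metis
    have rx: "\<tau> x (\<Phi> x) = r (\<tau> x x)" "\<tau> x (\<Phi> x) \<in> F"
      using \<Phi>[OF xy(1) t] r t A(2)[OF t(1) xy(1)] by (auto simp: bij_betw_def)
    have ry: "\<tau> y (\<Phi> y) = r (\<tau> y y)" "\<tau> y (\<Phi> y) \<in> F"
      using \<Phi>[OF xy(2) s] r s A(2)[OF s(1) xy(2)] by (auto simp: bij_betw_def)
    have tile_convex: "\<tau> w v \<in> F" if "w \<in> A" "\<tau> w u \<in> F" "\<tau> w z \<in> F" "u \<le> v" "v \<le> z" for w u v z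
      using \<tau>(1)[OF A(1)[OF that(1)]]
    proof (cases rule: motions_cases)
      case (shift p)
      then show ?thesis using that conv[of "\<tau> w u" "\<tau> w z" "\<tau> w v"] by simp
    next
      case (flip p)
      then show ?thesis using that conv[of "\<tau> w z" "\<tau> w u" "\<tau> w v"] by simp
    qed
    show ?thesis
    proof (cases "\<tau> x = \<tau> y")
      case True
      have AF': "\<tau> x x \<in> A \<inter> F" "\<tau> x y \<in> A \<inter> F" using A(2)[OF t(1)] xy t s True by auto
      from t(1) show ?thesis
      proof (cases rule: motions_cases)
        case (shift p)
        then have "r (\<tau> x x) < r (\<tau> x y)" by (intro r_mono AF') (use xy in simp)
        then have "\<tau> x (\<Phi> x) < \<tau> x (\<Phi> y)" using rx ry True by simp
        then show ?thesis unfolding shift by simp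
      next
        case (flip p)
        then have "r (\<tau> x y) < r (\<tau> x x)" by (intro r_mono AF') (use xy in simp)
        then have "\<tau> x (\<Phi> y) < \<tau> x (\<Phi> x)" using rx ry True by simp
        then show ?thesis unfolding flip by simp
      qed
    next
      case False
      \<comment> \<open>At a common point of two tiles, uniqueness would identify the motions to \<open>F\<close>.\<close>
      have disj: "\<not> (\<tau> x z \<in> F \<and> \<tau> y z \<in> F)" for z
      proof
        assume "\<tau> x z \<in> F \<and> \<tau> y z \<in> F"
        then have "(\<lambda>w. \<tau> y (\<epsilon> w)) = (\<lambda>w. w)"
          by (intro un[of _ "\<tau> x z"]) (use \<epsilon> s comp_motion in auto)
        then have "\<tau> y w = \<tau> x w" for w using \<epsilon>(2) by metis
        then show False using False by auto
      qed
      have ne: "\<Phi> x \<noteq> \<Phi> y" "\<Phi> x \<noteq> y" "\<Phi> y \<noteq> x" using disj rx ry t s by metis+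
      show ?thesis
      proof (rule ccontr)
        assume "\<not> \<Phi> x < \<Phi> y"
        then have *: "\<Phi> y < \<Phi> x" using ne by simp
        show False
        proof (cases "\<Phi> x < y")
          case True
          \<comment> \<open>Whichever of \<open>x\<close> and \<open>\<Phi> y\<close> is larger lies in both tiles.\<close>
          show False
          proof (cases "x \<le> \<Phi> y")
            case le: True
            have "\<tau> x (\<Phi> y) \<in> F"
              by (rule tile_convex[OF xy(1) t(2) rx(2)]) (use le * in auto)
            then show False using disj ry by blast
          next
            case gt: False
            have "\<tau> y x \<in> F"
              by (rule tile_convex[OF xy(2) ry(2) s(2)]) (use gt xy in auto)
            then show False using disj t by blast
          qed
        next
          case False
          have "\<tau> x y \<in> F"
            by (rule tile_convex[OF xy(1) t(2) rx(2)]) (use False xy in auto)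
          then show False using disj s by blast
        qed
      qed
    qed
  qed
  have surj: "\<exists>x\<in>A. \<Phi> x = z" if z: "z \<in> B" for z
  proof -
    have t: "\<tau> z \<in> motions" "\<tau> z z \<in> B \<inter> F" using \<tau> B z by auto
    obtain \<epsilon> where \<epsilon>: "\<epsilon> \<in> motions" "\<And>z'. \<epsilon> (\<tau> z z') = z'" "\<And>z'. \<tau> z (\<epsilon> z') = z'"
      using inverse_motion[OF t(1)] by metis
    obtain y where y: "y \<in> A \<inter> F" "r y = \<tau> z z"
      using t(2)[folded bij_betw_imp_surj_on[OF r]] by (elim imageE) simp
    have "\<Phi> y = \<tau> z z" using \<Phi>[OF _ id_motion, of y] y by simp
    then have "\<Phi> (\<epsilon> y) = z" using \<Phi>_eq[OF _ \<epsilon>(1), of y] y \<epsilon> by simp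
    then show ?thesis using A(2)[OF \<epsilon>(1)] y by blast
  qed
  have iff: "x < y \<longleftrightarrow> \<Phi> x < \<Phi> y" if "x \<in> A" "y \<in> A" for x y
    using mono[of x y] mono[of y x] that by (cases x y rule: linorder_cases) auto
  have "bij_betw \<Phi> A B"
    unfolding bij_betw_def inj_on_def
  proof (intro conjI ballI impI)
    fix x y assume "x \<in> A" "y \<in> A" "\<Phi> x = \<Phi> y"
    then show "x = y" using iff[of x y] iff[of y x] by (cases x y rule: linorder_cases) auto
  qed (use \<Phi>_B surj in force)
  then show ?thesis using iff \<Phi>_eq by blast
qed

end

section \<open>Translates and small sets\<close>

context group
begin

abbreviation translate :: "'a \<Rightarrow> 'a set \<Rightarrow> 'a set" (infixl "\<cdot>" 60) where
  "g \<cdot> X \<equiv> g <#\<^bsub>G\<^esub> X"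

lemma mem_translate:
  assumes "X \<subseteq> carrier G" "g \<in> carrier G" "y \<in> carrier G"
  shows "y \<in> g \<cdot> X \<longleftrightarrow> inv g \<otimes> y \<in> X"
proof
  assume "y \<in> g \<cdot> X"
  then show "inv g \<otimes> y \<in> X" using assms by (auto simp: l_coset_def m_assoc[symmetric])
next
  assume "inv g \<otimes> y \<in> X"
  then show "y \<in> g \<cdot> X"
    using assms by (auto simp: l_coset_def m_assoc[symmetric] intro!: bexI[of _ "inv g \<otimes> y"])
qed

lemma translate_subset: "X \<subseteq> carrier G \<Longrightarrow> g \<in> carrier G \<Longrightarrow> g \<cdot> X \<subseteq> carrier G"
  by (rule l_coset_subset_G)

lemma translate_image: "g \<cdot> X = (\<lambda>x. g \<otimes> x) ` X"
  by (auto simp: l_coset_def)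

lemma complem_subset: "complem G X \<subseteq> carrier G"
  by (auto simp: complem_def)

lemma complem_complem: "X \<subseteq> carrier G \<Longrightarrow> complem G (complem G X) = X"
  by (auto simp: complem_def)

lemma translate_complem:
  assumes "X \<subseteq> carrier G" "g \<in> carrier G"
  shows "g \<cdot> complem G X = complem G (g \<cdot> X)"
proof (rule Set.set_eqI)
  fix y
  show "y \<in> g \<cdot> complem G X \<longleftrightarrow> y \<in> complem G (g \<cdot> X)"
  proof (cases "y \<in> carrier G")
    case True
    then show ?thesis
      using assms by (simp add: mem_translate complem_subset) (simp add: complem_def mem_translate)
  next
    case False
    then show ?thesis using translate_subset[OF complem_subset assms(2), of X] complem_subset by blast
  qed
qed

lemma translate_inv:
  "X \<subseteq> carrier G \<Longrightarrow> g \<in> carrier G \<Longrightarrow> inv g \<cdot> (g \<cdot> X) = X"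
  "X \<subseteq> carrier G \<Longrightarrow> g \<in> carrier G \<Longrightarrow> g \<cdot> (inv g \<cdot> X) = X"
  by (simp_all add: lcos_m_assoc lcos_mult_one)

lemma translate_Diff:
  assumes "X \<subseteq> carrier G" "Y \<subseteq> carrier G" "g \<in> carrier G"
  shows "g \<cdot> (X - Y) = (g \<cdot> X) - (g \<cdot> Y)"
proof -
  have "inj_on (\<lambda>x. g \<otimes> x) (carrier G)" using assms(3) by (auto intro: inj_onI)
  then show ?thesis
    unfolding translate_image by (rule inj_on_image_set_diff) (use assms in auto)
qed

lemma translate_Un: "g \<cdot> (X \<union> Y) = (g \<cdot> X) \<union> (g \<cdot> Y)"
  by (auto simp: translate_image)

text \<open>The action of \<open>G \<times> {1, *}\<close> on subsets of \<open>G\<close>, where \<open>False\<close> stands for complementation; the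
product of the signs \<open>s\<close> and \<open>t\<close> is \<open>s = t\<close>.\<close>

definition signed :: "'a \<Rightarrow> bool \<Rightarrow> 'a set \<Rightarrow> 'a set" where
  "signed g s U = (if s then g \<cdot> U else complem G (g \<cdot> U))"

lemma signed_subset: "U \<subseteq> carrier G \<Longrightarrow> g \<in> carrier G \<Longrightarrow> signed g s U \<subseteq> carrier G"
  by (auto simp: signed_def complem_def dest: l_coset_subset_G)

lemma signed_one: "U \<subseteq> carrier G \<Longrightarrow> signed \<one> True U = U"
  by (simp add: signed_def lcos_mult_one)

lemma signed_signed:
  assumes "U \<subseteq> carrier G" "g \<in> carrier G" "h \<in> carrier G"
  shows "signed g s (signed h t U) = signed (g \<otimes> h) (s = t) U"
  using assms
  by (auto simp: signed_def translate_complem complem_complem lcos_m_assoc translate_subset)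

lemma signed_inv:
  assumes "U \<subseteq> carrier G" "g \<in> carrier G"
  shows "signed (inv g) s (signed g s U) = U" "signed g s (signed (inv g) s U) = U"
  using assms by (simp_all add: signed_signed signed_one)

text \<open>When \<open>U\<close> is a nontrivial almost invariant set over \<open>H\<close>, this says that \<open>C\<close> is \<open>H\<close>-finite
(\<open>H_finite_iff_small\<close>).  It has the advantage of not mentioning \<open>H\<close>, so that it can be transported
by translations without conjugating subgroups.\<close>

definition small :: "'a set \<Rightarrow> 'a set \<Rightarrow> bool" where
  "small U C \<longleftrightarrow> finite ((\<lambda>c. inv c \<cdot> U) ` C)"

lemma small_subset: "small U C \<Longrightarrow> D \<subseteq> C \<Longrightarrow> small U D"
  unfolding small_def by (meson finite_subset image_mono)

lemma small_Un: "small U (C \<union> D) \<longleftrightarrow> small U C \<and> small U D"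
  by (simp add: small_def image_Un)

lemma small_empty: "small U {}"
  by (simp add: small_def)

lemma small_UN: "finite I \<Longrightarrow> (\<And>i. i \<in> I \<Longrightarrow> small U (C i)) \<Longrightarrow> small U (\<Union>i\<in>I. C i)"
  by (simp add: small_def image_UN)

lemma small_right_translate:
  assumes "U \<subseteq> carrier G" "C \<subseteq> carrier G" "g \<in> carrier G" "small U C"
  shows "small U ((\<lambda>c. c \<otimes> g) ` C)"
proof -
  have "(\<lambda>c. inv c \<cdot> U) ` (\<lambda>c. c \<otimes> g) ` C = (\<lambda>V. inv g \<cdot> V) ` (\<lambda>c. inv c \<cdot> U) ` C"
    unfolding image_image
    by (rule image_cong) (use assms in \<open>auto simp: inv_mult_group lcos_m_assoc subset_eq\<close>)
  then show ?thesis using assms(4) by (simp add: small_def)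
qed

lemma small_translate:
  assumes "U \<subseteq> carrier G" "C \<subseteq> carrier G" "g \<in> carrier G"
  shows "small (g \<cdot> U) (g \<cdot> C) \<longleftrightarrow> small U C"
proof -
  have "(\<lambda>c. inv c \<cdot> (g \<cdot> U)) ` (g \<cdot> C) = (\<lambda>c. inv c \<cdot> U) ` C"
    unfolding translate_image[of g C] image_image
  proof (rule image_cong)
    fix c assume "c \<in> C"
    then have "c \<in> carrier G" using assms by auto
    then show "inv (g \<otimes> c) \<cdot> (g \<cdot> U) = inv c \<cdot> U"
      using assms by (simp add: inv_mult_group lcos_m_assoc m_assoc)
  qed simp
  then show ?thesis by (simp add: small_def)
qed

lemma small_complem:
  assumes "U \<subseteq> carrier G" "C \<subseteq> carrier G"
  shows "small (complem G U) C \<longleftrightarrow> small U C"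
proof -
  have *: "small (complem G U) C" if "small U C" "U \<subseteq> carrier G" for U
  proof -
    have "(\<lambda>c. inv c \<cdot> complem G U) ` C = complem G ` (\<lambda>c. inv c \<cdot> U) ` C"
      unfolding image_image by (rule image_cong) (use that assms in \<open>auto simp: translate_complem subset_eq\<close>)
    then show ?thesis using that by (simp add: small_def)
  qed
  show ?thesis
    using *[of U] *[of "complem G U"] assms complem_subset complem_complem by metis
qed

lemma small_signed:
  assumes "U \<subseteq> carrier G" "C \<subseteq> carrier G" "g \<in> carrier G"
  shows "small (signed g s U) (g \<cdot> C) \<longleftrightarrow> small U C"
  using assms by (simp add: signed_def small_complem translate_subset small_translate)

text \<open>If \<open>x = k c\<close> then \<open>k U\<close> is the translate by \<open>x\<close> of one of the finitely many sets
\<open>c\<^sup>-\<^sup>1 U\<close>.\<close>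

lemma finite_translates_through_point:
  assumes "U \<subseteq> carrier G" "C \<subseteq> carrier G" "x \<in> carrier G" "small U C"
  shows "finite {k \<cdot> U | k. k \<in> carrier G \<and> x \<in> k \<cdot> C}"
proof (rule finite_subset)
  show "{k \<cdot> U | k. k \<in> carrier G \<and> x \<in> k \<cdot> C} \<subseteq> (\<lambda>V. x \<cdot> V) ` (\<lambda>c. inv c \<cdot> U) ` C"
  proof
    fix V assume "V \<in> {k \<cdot> U | k. k \<in> carrier G \<and> x \<in> k \<cdot> C}"
    then obtain k c where k: "k \<in> carrier G" "V = k \<cdot> U" and c: "c \<in> C" "x = k \<otimes> c"
      by (auto simp: translate_image)
    have "c \<in> carrier G" using c assms by auto
    then have "x \<cdot> (inv c \<cdot> U) = V"
      using k c assms by (simp add: lcos_m_assoc m_assoc)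
    then show "V \<in> (\<lambda>V. x \<cdot> V) ` (\<lambda>c. inv c \<cdot> U) ` C" using c by blast
  qed
  show "finite ((\<lambda>V. x \<cdot> V) ` (\<lambda>c. inv c \<cdot> U) ` C)" using assms(4) by (simp add: small_def)
qed

text \<open>The nontrivial almost invariant sets, over an unspecified subgroup; see \<open>proper_ai_of_nontrivial\<close> and
\<open>nontrivial_ai_stabiliser\<close>.\<close>

definition proper_ai :: "'a set \<Rightarrow> bool" where
  "proper_ai U \<longleftrightarrow> U \<subseteq> carrier G \<and> (\<forall>g\<in>carrier G. small U {x \<in> U. x \<otimes> g \<notin> U}) \<and>
     \<not> small U U \<and> \<not> small U (complem G U)"

lemma proper_aiD:
  assumes "proper_ai U"
  shows "U \<subseteq> carrier G" "\<And>g. g \<in> carrier G \<Longrightarrow> small U {x \<in> U. x \<otimes> g \<notin> U}"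
    "\<not> small U U" "\<not> small U (complem G U)"
  using assms by (auto simp: proper_ai_def)

lemma proper_ai_complem:
  assumes "proper_ai U"
  shows "proper_ai (complem G U)"
proof -
  note U = proper_aiD[OF assms]
  have "small (complem G U) {x \<in> complem G U. x \<otimes> g \<notin> complem G U}" if g: "g \<in> carrier G" for g
  proof -
    have "{x \<in> complem G U. x \<otimes> g \<notin> complem G U} \<subseteq>
        (\<lambda>x. x \<otimes> inv g) ` {x \<in> U. x \<otimes> inv g \<notin> U}"
    proof
      fix x assume "x \<in> {x \<in> complem G U. x \<otimes> g \<notin> complem G U}"
      then have x: "x \<in> carrier G" "x \<notin> U" "x \<otimes> g \<in> U" using g by (auto simp: complem_def)
      then have "x = (x \<otimes> g) \<otimes> inv g" using g by (simp add: m_assoc)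
      then show "x \<in> (\<lambda>x. x \<otimes> inv g) ` {x \<in> U. x \<otimes> inv g \<notin> U}"
        using x by (intro image_eqI[of _ _ "x \<otimes> g"]) auto
    qed
    moreover have "small U ((\<lambda>x. x \<otimes> inv g) ` {x \<in> U. x \<otimes> inv g \<notin> U})"
      by (rule small_right_translate) (use U g in auto)
    ultimately have "small U {x \<in> complem G U. x \<otimes> g \<notin> complem G U}" using small_subset by blast
    then show ?thesis
      by (subst small_complem[OF U(1)]) (auto simp: complem_def)
  qed
  then show ?thesis
    using U unfolding proper_ai_def
    by (simp add: complem_subset complem_complem small_complem del: Collect_conj_eq)
qed

lemma proper_ai_translate:
  assumes "proper_ai U" "k \<in> carrier G"
  shows "proper_ai (k \<cdot> U)"
proof -
  note U = proper_aiD[OF assms(1)]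
  have "small (k \<cdot> U) {x \<in> k \<cdot> U. x \<otimes> g \<notin> k \<cdot> U}" if g: "g \<in> carrier G" for g
  proof -
    have "{x \<in> k \<cdot> U. x \<otimes> g \<notin> k \<cdot> U} \<subseteq> k \<cdot> {x \<in> U. x \<otimes> g \<notin> U}"
    proof
      fix y assume "y \<in> {x \<in> k \<cdot> U. x \<otimes> g \<notin> k \<cdot> U}"
      then obtain x where x: "x \<in> U" "y = k \<otimes> x" "y \<otimes> g \<notin> k \<cdot> U" by (auto simp: translate_image)
      then have "x \<otimes> g \<notin> U" using assms(2) g U(1) by (auto simp: translate_image m_assoc subset_eq)
      then show "y \<in> k \<cdot> {x \<in> U. x \<otimes> g \<notin> U}" using x by (auto simp: translate_image)
    qed
    moreover have "small (k \<cdot> U) (k \<cdot> {x \<in> U. x \<otimes> g \<notin> U})"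
      by (subst small_translate) (use U assms g in auto)
    ultimately show ?thesis using small_subset by blast
  qed
  then show ?thesis
    using U assms unfolding proper_ai_def
    by (simp add: translate_subset small_translate translate_complem[symmetric] complem_subset)
qed

lemma proper_ai_signed: "proper_ai U \<Longrightarrow> k \<in> carrier G \<Longrightarrow> proper_ai (signed k s U)"
  by (simp add: signed_def proper_ai_translate proper_ai_complem)

text \<open>This contains the symmetry of crossing (take \<open>C = U \<inter> V\<close>).  As \<open>V\<close> is not small but
\<open>U \<inter> V\<close> is, some \<open>x\<close> in \<open>V\<close> has \<open>x\<^sup>-\<^sup>1 V\<close> different from all \<open>c\<^sup>-\<^sup>1 V\<close> with
\<open>c\<close> in \<open>U \<inter> V\<close>.  Up to the stabiliser of \<open>V\<close> there are finitely many elements of \<open>C\<close>: each is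
\<open>c = k f\<close> with \<open>k V = V\<close> and \<open>f\<close> in a finite set.  Then \<open>k x = c (f\<^sup>-\<^sup>1 x)\<close> is in \<open>V\<close> but not
in \<open>U\<close>, so \<open>C\<close> is covered by finitely many boundaries of \<open>U\<close>.\<close>

lemma small_transfer:
  assumes U: "proper_ai U" and V: "proper_ai V"
    and UV: "small V (U \<inter> V)" and C: "C \<subseteq> U" "small V C"
  shows "small U C"
proof -
  note U = proper_aiD[OF U] and V = proper_aiD[OF V]
  have "\<not> (\<lambda>c. inv c \<cdot> V) ` V \<subseteq> (\<lambda>c. inv c \<cdot> V) ` (U \<inter> V)"
    using V(3) UV finite_subset by (auto simp: small_def)
  then obtain x where x: "x \<in> V" "\<And>c. c \<in> U \<inter> V \<Longrightarrow> inv x \<cdot> V \<noteq> inv c \<cdot> V" by blast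
  obtain F where F: "F \<subseteq> C" "finite F" "(\<lambda>c. inv c \<cdot> V) ` C = (\<lambda>c. inv c \<cdot> V) ` F"
    using finite_subset_image[of "(\<lambda>c. inv c \<cdot> V) ` C" "\<lambda>c. inv c \<cdot> V" C] C(2)
    unfolding small_def by blast
  have "C \<subseteq> (\<Union>f\<in>F. {c \<in> U. c \<otimes> (inv f \<otimes> x) \<notin> U})"
  proof
    fix c assume c: "c \<in> C"
    then obtain f where f: "f \<in> F" "inv c \<cdot> V = inv f \<cdot> V" using F(3) by blast
    have cl: "c \<in> carrier G" "f \<in> carrier G" "x \<in> carrier G" using c f F C U V x by auto
    define k where "k = c \<otimes> inv f"
    have k: "k \<in> carrier G" "k \<cdot> V = V"
      using cl f(2) V(1) translate_inv(2)[OF V(1), of c]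
      by (auto simp: k_def lcos_m_assoc[symmetric] translate_subset)
    have "k \<otimes> x \<in> V" using k(2) x(1) by (auto simp: translate_image)
    moreover have "inv k \<cdot> V = V" using k V(1) translate_inv(1)[OF V(1) k(1)] by simp
    then have "inv (k \<otimes> x) \<cdot> V = inv x \<cdot> V"
      using cl k V(1) by (simp add: inv_mult_group lcos_m_assoc[symmetric])
    ultimately have "k \<otimes> x \<notin> U" using x(2) by force
    moreover have "k \<otimes> x = c \<otimes> (inv f \<otimes> x)" using cl by (simp add: k_def m_assoc)
    ultimately show "c \<in> (\<Union>f\<in>F. {c \<in> U. c \<otimes> (inv f \<otimes> x) \<notin> U})" using c f C by auto
  qed
  moreover have "small U (\<Union>f\<in>F. {c \<in> U. c \<otimes> (inv f \<otimes> x) \<notin> U})"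
    by (rule small_UN) (use F C U V x in \<open>auto simp: subset_eq\<close>)
  ultimately show ?thesis using small_subset by blast
qed

definition eqv :: "'a set \<Rightarrow> 'a set \<Rightarrow> bool" where
  "eqv U V \<longleftrightarrow> small U (sym_diff U V)"

text \<open>The two halves of \<open>C\<close>, inside and outside \<open>U\<close>, are small by \<open>small_transfer\<close> for the pairs
\<open>(U, V*)\<close> and \<open>(U*, V)\<close>, whose intersections are the two parts of the symmetric difference.\<close>

lemma small_of_eqv:
  assumes U: "proper_ai U" and V: "proper_ai V" and C: "C \<subseteq> carrier G" "small V C"
    and UV: "small V (sym_diff U V)"
  shows "small U C"
proof -
  note U' = proper_aiD(1)[OF U] and V' = proper_aiD(1)[OF V]
  have "small U (C \<inter> U)"
  proof (rule small_transfer[OF U proper_ai_complem[OF V]])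
    show "small (complem G V) (U \<inter> complem G V)"
      by (subst small_complem) (use U' V' UV in \<open>auto simp: complem_def intro: small_subset\<close>)
    show "small (complem G V) (C \<inter> U)"
      by (subst small_complem) (use U' V' C in \<open>auto intro: small_subset\<close>)
  qed auto
  moreover have "small (complem G U) (C \<inter> complem G U)"
  proof (rule small_transfer[OF proper_ai_complem[OF U] V])
    show "small V (complem G U \<inter> V)" "small V (C \<inter> complem G U)"
      using UV C(2) by (auto simp: complem_def intro: small_subset)
  qed auto
  then have "small U (C \<inter> complem G U)" 
    by (subst (asm) small_complem) (use U' C in auto)
  ultimately have "small U (C \<inter> U \<union> C \<inter> complem G U)" by (simp add: small_Un)
  moreover have "C \<inter> U \<union> C \<inter> complem G U = C" using C by (auto simp: complem_def)
  ultimately show ?thesis by simp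
qed

lemma eqv_sym:
  assumes "proper_ai U" "proper_ai V" "eqv U V"
  shows "eqv V U"
proof -
  have "small V (sym_diff U V)"
    by (rule small_of_eqv[OF assms(2,1)])
      (use assms proper_aiD(1) in \<open>auto simp: eqv_def Un_commute\<close>)
  then show ?thesis by (simp add: eqv_def Un_commute)
qed

lemma small_eqv:
  assumes "proper_ai U" "proper_ai V" "eqv U V" "C \<subseteq> carrier G"
  shows "small U C \<longleftrightarrow> small V C"
  using small_of_eqv[OF assms(1,2,4)] small_of_eqv[OF assms(2,1,4)] assms(3) eqv_sym[OF assms(1-3)]
  by (auto simp: eqv_def Un_commute)

lemma eqv_refl: "eqv U U"
  by (simp add: eqv_def small_empty)

lemma eqv_trans:
  assumes "proper_ai U" "proper_ai V" "proper_ai W" "eqv U V" "eqv V W"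
  shows "eqv U W"
proof -
  have "small V (sym_diff U V \<union> sym_diff V W)"
    using eqv_sym[OF assms(1,2,4)] assms(5) by (simp add: eqv_def small_Un)
  then have "small U (sym_diff U V \<union> sym_diff V W)"
    by (subst small_eqv[OF assms(1,2,4)]) (use assms(1-3) proper_aiD(1) in auto)
  then show ?thesis unfolding eqv_def by (rule small_subset) auto
qed

lemma sym_diff_signed:
  assumes "U \<subseteq> carrier G" "V \<subseteq> carrier G" "g \<in> carrier G"
  shows "sym_diff (signed g s U) (signed g s V) = g \<cdot> sym_diff U V"
proof -
  have "g \<cdot> sym_diff U V = sym_diff (g \<cdot> U) (g \<cdot> V)"
    using assms by (simp add: translate_Diff translate_Un)
  moreover have "sym_diff (complem G (g \<cdot> U)) (complem G (g \<cdot> V)) = sym_diff (g \<cdot> U) (g \<cdot> V)"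
    using translate_subset[OF assms(1,3)] translate_subset[OF assms(2,3)] by (auto simp: complem_def)
  ultimately show ?thesis by (simp add: signed_def)
qed

lemma eqv_signed:
  assumes "U \<subseteq> carrier G" "V \<subseteq> carrier G" "g \<in> carrier G"
  shows "eqv (signed g s U) (signed g s V) \<longleftrightarrow> eqv U V"
  unfolding eqv_def sym_diff_signed[OF assms] by (rule small_signed) (use assms in auto)

end

section \<open>Nontrivial almost invariant sets over a subgroup\<close>

context group
begin

definition stabiliser :: "'a set \<Rightarrow> 'a set" where
  "stabiliser U = {g \<in> carrier G. g \<cdot> U = U}"

lemma subgroup_stabiliser:
  assumes "U \<subseteq> carrier G"
  shows "subgroup (stabiliser U) G"
proof (rule subgroupI)
  show "stabiliser U \<noteq> {}" using lcos_mult_one[OF assms] by (auto simp: stabiliser_def)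
  fix g assume g: "g \<in> stabiliser U"
  then show "inv g \<in> stabiliser U"
    using translate_inv(1)[OF assms, of g] by (auto simp: stabiliser_def)
  fix h assume "h \<in> stabiliser U"
  then show "g \<otimes> h \<in> stabiliser U"
    using g by (auto simp: stabiliser_def lcos_m_assoc[OF assms, symmetric])
qed (auto simp: stabiliser_def)

lemma translate_eq_iff:
  assumes "U \<subseteq> carrier G" "c \<in> carrier G" "d \<in> carrier G"
  shows "inv c \<cdot> U = inv d \<cdot> U \<longleftrightarrow> c \<otimes> inv d \<in> stabiliser U"
proof
  assume "inv c \<cdot> U = inv d \<cdot> U"
  then have "c \<cdot> (inv d \<cdot> U) = U" using translate_inv(2)[OF assms(1,2)] by simp
  then show "c \<otimes> inv d \<in> stabiliser U" using assms by (simp add: stabiliser_def lcos_m_assoc)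
next
  assume "c \<otimes> inv d \<in> stabiliser U"
  then have "c \<cdot> (inv d \<cdot> U) = U" using assms by (simp add: stabiliser_def lcos_m_assoc)
  then have "inv c \<cdot> (c \<cdot> (inv d \<cdot> U)) = inv c \<cdot> U" by simp
  then show "inv c \<cdot> U = inv d \<cdot> U"
    using translate_inv(1)[OF translate_subset[OF assms(1), of "inv d"] assms(2)] assms by simp
qed

lemma mem_coset:
  assumes "subgroup H G" "x \<in> carrier G" "f \<in> carrier G"
  shows "x \<in> H #> f \<longleftrightarrow> x \<otimes> inv f \<in> H"
proof
  assume "x \<in> H #> f"
  then obtain h where "h \<in> H" "x = h \<otimes> f" by (auto simp: r_coset_def)
  moreover have "h \<in> carrier G" using \<open>h \<in> H\<close> assms(1) subgroup.subset by blast
  ultimately show "x \<otimes> inv f \<in> H" using assms by (simp add: m_assoc)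
next
  assume "x \<otimes> inv f \<in> H"
  moreover have "x = (x \<otimes> inv f) \<otimes> f" using assms by (simp add: m_assoc)
  ultimately show "x \<in> H #> f" by (auto simp: r_coset_def)
qed

lemma finite_coset_image_iff:
  assumes H: "subgroup H G" and X: "X \<subseteq> carrier G"
  shows "finite (coset_image G H X) \<longleftrightarrow> H_finite G H X"
proof
  assume "finite (coset_image G H X)"
  then obtain F where F: "F \<subseteq> X" "finite F" "coset_image G H X = (\<lambda>x. H #> x) ` F"
    using finite_subset_image[of "coset_image G H X" "\<lambda>x. H #> x" X] unfolding coset_image_def by blast
  have cov: "X \<subseteq> (\<Union>g\<in>F. H #> g)"
  proof
    fix x assume x: "x \<in> X"
    then have "H #> x \<in> (\<lambda>x. H #> x) ` F" using F(3) by (auto simp: coset_image_def)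
    then obtain g where "g \<in> F" "H #> x = H #> g" by blast
    moreover have "x \<in> H #> x" using rcos_self[OF _ H, of x] x X by blast
    ultimately show "x \<in> (\<Union>g\<in>F. H #> g)" by blast
  qed
  show "H_finite G H X"
    unfolding H_finite_def using F(1,2) X cov by (intro exI[of _ F]) simp
next
  assume "H_finite G H X"
  then obtain F where F: "finite F" "F \<subseteq> carrier G" "X \<subseteq> (\<Union>g\<in>F. H #> g)"
    unfolding H_finite_def by blast
  have "coset_image G H X \<subseteq> (\<lambda>g. H #> g) ` F"
  proof
    fix C assume "C \<in> coset_image G H X"
    then obtain x where x: "x \<in> X" "C = H #> x" by (auto simp: coset_image_def)
    then obtain g where g: "g \<in> F" "x \<in> H #> g" using F by blast
    then have "H #> g = H #> x" using repr_independence[OF g(2)] F H by blast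
    then show "C \<in> (\<lambda>g. H #> g) ` F" using x g by blast
  qed
  then show "finite (coset_image G H X)" using F(1) finite_surj by blast
qed

lemma coset_image_Diff:
  assumes H: "subgroup H G" and X: "X \<subseteq> carrier G" "Y \<subseteq> carrier G"
    and inv: "\<And>h y. h \<in> H \<Longrightarrow> y \<in> Y \<Longrightarrow> h \<otimes> y \<in> Y"
  shows "coset_image G H X - coset_image G H Y = coset_image G H (X - Y)"
proof -
  have "x \<in> Y" if "x \<in> X" "y \<in> Y" "H #> x = H #> y" for x y
  proof -
    have "x \<in> H #> y" using rcos_self[OF _ H, of x] that X by auto
    then show ?thesis using inv that(2) by (auto simp: r_coset_def)
  qed
  then show ?thesis unfolding coset_image_def by blast
qed

lemma invariant_iff:
  assumes H: "subgroup H G" and X: "X \<subseteq> carrier G"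
  shows "(\<forall>h\<in>H. h \<cdot> X = X) \<longleftrightarrow> (\<forall>h\<in>H. \<forall>x\<in>X. h \<otimes> x \<in> X)"
proof
  assume *: "\<forall>h\<in>H. \<forall>x\<in>X. h \<otimes> x \<in> X"
  show "\<forall>h\<in>H. h \<cdot> X = X"
  proof
    fix h assume h: "h \<in> H"
    then have c: "h \<in> carrier G" "inv h \<in> H" using H by (auto simp: subgroup.m_inv_closed subgroup.mem_carrier)
    show "h \<cdot> X = X"
    proof (rule Set.set_eqI)
      fix y show "y \<in> h \<cdot> X \<longleftrightarrow> y \<in> X"
      proof
        assume "y \<in> h \<cdot> X" then show "y \<in> X" using * h by (auto simp: translate_image)
      next
        assume y: "y \<in> X"
        then show "y \<in> h \<cdot> X" using mem_translate[OF X c(1), of y] * c X by blast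
      qed
    qed
  qed
qed (auto simp: translate_image)

lemma almost_invariant_iff:
  "almost_invariant G H X \<longleftrightarrow> subgroup H G \<and> X \<subseteq> carrier G \<and> (\<forall>h\<in>H. h \<cdot> X = X) \<and>
     (\<forall>g\<in>carrier G. H_finite G H (sym_diff ((\<lambda>x. x \<otimes> g) ` X) X))"
proof (cases "subgroup H G \<and> X \<subseteq> carrier G \<and> (\<forall>h\<in>H. h \<cdot> X = X)")
  case True
  then have H: "subgroup H G" and X: "X \<subseteq> carrier G" by auto
  then have inv: "h \<in> H \<Longrightarrow> x \<in> X \<Longrightarrow> h \<otimes> x \<in> X" for h x
    using True invariant_iff[OF H X] by blast
  have "almost_equal ((\<lambda>C. C #> g) ` coset_image G H X) (coset_image G H X) \<longleftrightarrow>
      H_finite G H (sym_diff ((\<lambda>x. x \<otimes> g) ` X) X)" if g: "g \<in> carrier G" for g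
  proof -
    let ?Y = "(\<lambda>x. x \<otimes> g) ` X"
    have Y: "?Y \<subseteq> carrier G" using X g by auto
    have Yinv: "h \<otimes> y \<in> ?Y" if "h \<in> H" "y \<in> ?Y" for h y
    proof -
      obtain x where x: "x \<in> X" "y = x \<otimes> g" using \<open>y \<in> ?Y\<close> by blast
      then have "h \<otimes> y = (h \<otimes> x) \<otimes> g" using that(1) H X g by (auto simp: m_assoc subgroup.mem_carrier)
      then show ?thesis using inv[OF that(1) x(1)] by blast
    qed
    have "(\<lambda>C. C #> g) ` coset_image G H X = coset_image G H ?Y"
      unfolding coset_image_def image_image
      by (rule image_cong) (use X g H in \<open>auto simp: coset_mult_assoc subgroup.subset\<close>)
    then have "sym_diff ((\<lambda>C. C #> g) ` coset_image G H X) (coset_image G H X) =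
        coset_image G H (sym_diff ?Y X)"
      using coset_image_Diff[OF H Y X inv] coset_image_Diff[OF H X Y Yinv]
      by (simp add: coset_image_def image_Un)
    moreover have "sym_diff ?Y X \<subseteq> carrier G" using X Y by auto
    ultimately show ?thesis unfolding almost_equal_def using finite_coset_image_iff[OF H] by simp
  qed
  then show ?thesis using True by (simp add: almost_invariant_def almost_invariant_subset_def)
qed (auto simp: almost_invariant_def)

lemma nontrivial_ai_iff:
  "nontrivial_ai G H X \<longleftrightarrow> almost_invariant G H X \<and> \<not> H_finite G H X \<and> \<not> H_finite G H (complem G X)"
proof (cases "almost_invariant G H X")
  case True
  then show ?thesis
    using finite_coset_image_iff complem_subset by (auto simp: nontrivial_ai_def almost_invariant_def)
qed (simp add: nontrivial_ai_def)

lemma small_if_H_finite: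
  assumes H: "subgroup H G" and X: "X \<subseteq> carrier G" "\<forall>h\<in>H. h \<cdot> X = X"
    and C: "H_finite G H C"
  shows "small X C"
proof -
  obtain F where F: "finite F" "F \<subseteq> carrier G" "C \<subseteq> (\<Union>g\<in>F. H #> g)"
    using C unfolding H_finite_def by blast
  have "(\<lambda>c. inv c \<cdot> X) ` C \<subseteq> (\<lambda>c. inv c \<cdot> X) ` F"
  proof
    fix V assume "V \<in> (\<lambda>c. inv c \<cdot> X) ` C"
    then obtain c where c: "c \<in> C" "V = inv c \<cdot> X" by blast
    then obtain f where f: "f \<in> F" "c \<in> H #> f" using F by blast
    then have cf: "c \<in> carrier G" "f \<in> carrier G" using F H r_coset_subset_G subgroup.subset by blast+
    have "c \<otimes> inv f \<in> stabiliser X"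
      using f mem_coset[OF H cf] X cf by (auto simp: stabiliser_def)
    then show "V \<in> (\<lambda>c. inv c \<cdot> X) ` F"
      using translate_eq_iff[OF X(1) cf] c f by blast
  qed
  then show ?thesis unfolding small_def using F(1) finite_subset by blast
qed

lemma H_finite_stabiliser:
  assumes X: "X \<subseteq> carrier G" and C: "C \<subseteq> carrier G"
  shows "H_finite G (stabiliser X) C \<longleftrightarrow> small X C"
proof
  assume "H_finite G (stabiliser X) C"
  then show "small X C"
    by (rule small_if_H_finite[OF subgroup_stabiliser[OF X] X, rotated]) (auto simp: stabiliser_def)
next
  assume "small X C"
  then obtain F where F: "F \<subseteq> C" "finite F" "(\<lambda>c. inv c \<cdot> X) ` C = (\<lambda>c. inv c \<cdot> X) ` F"
    using finite_subset_image[of "(\<lambda>c. inv c \<cdot> X) ` C" "\<lambda>c. inv c \<cdot> X" C]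
    unfolding small_def by blast
  have "C \<subseteq> (\<Union>g\<in>F. stabiliser X #> g)"
  proof
    fix c assume c: "c \<in> C"
    then obtain f where f: "f \<in> F" "inv c \<cdot> X = inv f \<cdot> X" using F(3) by blast
    have cf: "c \<in> carrier G" "f \<in> carrier G" using c f(1) F(1) C by auto
    have "c \<in> stabiliser X #> f"
      using f(2) translate_eq_iff[OF X cf] mem_coset[OF subgroup_stabiliser[OF X] cf] by blast
    then show "c \<in> (\<Union>g\<in>F. stabiliser X #> g)" using f(1) by blast
  qed
  then show "H_finite G (stabiliser X) C"
    unfolding H_finite_def using F(1,2) C by (intro exI[of _ F]) simp
qed

lemma boundary_eq:
  assumes "X \<subseteq> carrier G" "g \<in> carrier G"
  shows "{x \<in> X. x \<otimes> g \<notin> X} = X - (\<lambda>x. x \<otimes> inv g) ` X"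
proof -
  have "x \<otimes> g \<in> X \<longleftrightarrow> x \<in> (\<lambda>x. x \<otimes> inv g) ` X" if "x \<in> X" for x
  proof
    assume "x \<otimes> g \<in> X"
    moreover have "x = (x \<otimes> g) \<otimes> inv g" using assms that by (auto simp: m_assoc)
    ultimately show "x \<in> (\<lambda>x. x \<otimes> inv g) ` X" by blast
  qed (use assms in \<open>auto simp: m_assoc subset_eq\<close>)
  then show ?thesis by blast
qed

text \<open>To see that small sets are \<open>H\<close>-finite, fix a point \<open>u\<close> of \<open>X\<close> with \<open>u g\<close> outside \<open>X\<close>.  If
\<open>c\<^sup>-\<^sup>1 X = f\<^sup>-\<^sup>1 X\<close> then \<open>c f\<^sup>-\<^sup>1\<close> stabilises \<open>X\<close>, so \<open>c f\<^sup>-\<^sup>1 u\<close> has the same property as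
\<open>u\<close> and lies in an \<open>H\<close>-finite set.\<close>

lemma nontrivial_ai_imp:
  assumes "nontrivial_ai G H X"
  shows proper_ai_of_nontrivial: "proper_ai X"
    and H_finite_iff_small: "C \<subseteq> carrier G \<Longrightarrow> H_finite G H C \<longleftrightarrow> small X C"
proof -
  have H: "subgroup H G" and X: "X \<subseteq> carrier G" "\<forall>h\<in>H. h \<cdot> X = X"
    and ai: "\<And>g. g \<in> carrier G \<Longrightarrow> H_finite G H (sym_diff ((\<lambda>x. x \<otimes> g) ` X) X)"
    and nt: "\<not> H_finite G H X" "\<not> H_finite G H (complem G X)"
    using assms by (auto simp: nontrivial_ai_iff almost_invariant_iff)
  have hsub: "H_finite G H D \<Longrightarrow> C \<subseteq> D \<Longrightarrow> H_finite G H C" for C D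
    unfolding H_finite_def by blast
  have bdry: "H_finite G H {x \<in> X. x \<otimes> g \<notin> X}" if "g \<in> carrier G" for g
    by (rule hsub[OF ai[of "inv g"]]) (use that boundary_eq[OF X(1)] in auto)
  have "H_finite G H {}" by (auto simp: H_finite_def)
  then obtain u w where uw: "u \<in> X" "w \<in> carrier G" "w \<notin> X"
    using nt by (metis complem_def Diff_iff ex_in_conv)
  define g where "g = inv u \<otimes> w"
  have ug: "u \<in> carrier G" "g \<in> carrier G" "u \<otimes> g \<notin> X"
    using uw X by (auto simp: g_def m_assoc[symmetric])
  have small_imp: "H_finite G H C" if C: "C \<subseteq> carrier G" "small X C" for C
  proof -
    obtain F where F: "F \<subseteq> C" "finite F" "(\<lambda>c. inv c \<cdot> X) ` C = (\<lambda>c. inv c \<cdot> X) ` F"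
      using finite_subset_image[of "(\<lambda>c. inv c \<cdot> X) ` C" "\<lambda>c. inv c \<cdot> X" C] C(2)
      unfolding small_def by blast
    obtain E where E: "finite E" "E \<subseteq> carrier G" "{x \<in> X. x \<otimes> g \<notin> X} \<subseteq> (\<Union>e\<in>E. H #> e)"
      using bdry[OF ug(2)] unfolding H_finite_def by blast
    let ?D = "(\<lambda>(e, f). e \<otimes> (inv u \<otimes> f)) ` (E \<times> F)"
    have "C \<subseteq> (\<Union>d\<in>?D. H #> d)"
    proof
      fix c assume c: "c \<in> C"
      then obtain f where f: "f \<in> F" "inv c \<cdot> X = inv f \<cdot> X" using F(3) by blast
      have cf: "c \<in> carrier G" "f \<in> carrier G" using c f F C by auto
      define k where "k = c \<otimes> inv f"
      have k: "k \<in> carrier G" "k \<cdot> X = X"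
        using f(2) translate_eq_iff[OF X(1) cf] by (auto simp: k_def stabiliser_def)
      have "k \<otimes> u \<in> X" using k(2) uw(1) by (auto simp: translate_image)
      moreover have "k \<otimes> u \<otimes> g \<notin> X"
      proof
        assume "k \<otimes> u \<otimes> g \<in> X"
        then have "k \<otimes> (u \<otimes> g) \<in> k \<cdot> X" using k ug by (simp add: m_assoc)
        then show False
          using mem_translate[OF X(1) k(1), of "k \<otimes> (u \<otimes> g)"] k(1) ug by (simp add: m_assoc[symmetric])
      qed
      ultimately obtain e h where e: "e \<in> E" "h \<in> H" "k \<otimes> u = h \<otimes> e"
        using E(3) by (fastforce simp: r_coset_def)
      have he: "h \<in> carrier G" "e \<in> carrier G" using e H E by (auto simp: subgroup.mem_carrier)
      have "c = (k \<otimes> u) \<otimes> (inv u \<otimes> f)"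
        using cf ug by (simp add: k_def m_assoc inv_solve_left) (simp add: m_assoc[symmetric])
      also have "\<dots> = h \<otimes> (e \<otimes> (inv u \<otimes> f))" using e(3) he ug cf by (simp add: m_assoc)
      finally have "c \<in> H #> (e \<otimes> (inv u \<otimes> f))" using e(2) by (auto simp: r_coset_def)
      then show "c \<in> (\<Union>d\<in>?D. H #> d)" using e f by blast
    qed
    moreover have "F \<subseteq> carrier G" using F(1) C(1) by blast
    then have "finite ?D" "?D \<subseteq> carrier G"
      using E(1,2) F(2) ug(1) by (auto simp: subset_eq)
    ultimately show ?thesis unfolding H_finite_def by (intro exI[of _ ?D]) simp
  qed
  show "C \<subseteq> carrier G \<Longrightarrow> H_finite G H C \<longleftrightarrow> small X C"
    using small_imp small_if_H_finite[OF H X] by blast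
  show "proper_ai X"
    unfolding proper_ai_def
    using X nt bdry small_if_H_finite[OF H X] small_imp complem_subset by blast
qed

lemma nontrivial_ai_stabiliser:
  assumes "proper_ai X"
  shows "nontrivial_ai G (stabiliser X) X"
proof -
  note X = proper_aiD[OF assms]
  have "small X (sym_diff ((\<lambda>x. x \<otimes> g) ` X) X)" if g: "g \<in> carrier G" for g
  proof -
    have "(\<lambda>x. x \<otimes> g) ` X - X \<subseteq> (\<lambda>x. x \<otimes> g) ` {x \<in> X. x \<otimes> g \<notin> X}" by blast
    moreover have "small X ((\<lambda>x. x \<otimes> g) ` {x \<in> X. x \<otimes> g \<notin> X})"
      by (rule small_right_translate) (use X g in auto)
    moreover have "small X (X - (\<lambda>x. x \<otimes> g) ` X)"
      using boundary_eq[OF X(1), of "inv g"] X(2)[of "inv g"] g by simp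
    ultimately show ?thesis using small_subset small_Un by blast
  qed
  moreover have "sym_diff ((\<lambda>x. x \<otimes> g) ` X) X \<subseteq> carrier G" if "g \<in> carrier G" for g
    using X(1) that by auto
  ultimately show ?thesis
    unfolding nontrivial_ai_iff almost_invariant_iff
    using X H_finite_stabiliser[OF X(1)] subgroup_stabiliser[OF X(1)] complem_subset
    by (auto simp: stabiliser_def)
qed

lemma small_corner_iff:
  assumes "proper_ai U" "V \<subseteq> carrier G"
  shows "small_corner G U V c \<longleftrightarrow> small U (corner G U V c)"
proof -
  have "corner G U V c \<subseteq> carrier G"
    using proper_aiD(1)[OF assms(1)] assms(2) by (cases c) (auto simp: corner_def complem_def)
  then show ?thesis
    unfolding small_corner_def
    using nontrivial_ai_stabiliser[OF assms(1)] H_finite_iff_small by blast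
qed

lemma equivalent_ai_iff:
  assumes "nontrivial_ai G H X" "nontrivial_ai G K Y"
  shows "equivalent_ai G H X K Y \<longleftrightarrow> eqv X Y"
proof -
  have "sym_diff X Y \<subseteq> carrier G"
    using assms[THEN proper_ai_of_nontrivial, THEN proper_aiD(1)] by auto
  then show ?thesis
    using assms H_finite_iff_small[OF assms(1)]
    by (simp add: equivalent_ai_def nontrivial_ai_def eqv_def)
qed

section \<open>The order on a family in good position\<close>

lemma corner_simps:
  assumes "U \<subseteq> carrier G" "V \<subseteq> carrier G"
  shows "corner G U V (True, True) = U \<inter> V" "corner G U V (True, False) = U - V"
    "corner G U V (False, True) = V - U" "corner G U V (False, False) = complem G U \<inter> complem G V"
  using assms by (auto simp: corner_def complem_def)

lemma small_Int_sym:
  assumes "proper_ai U" "proper_ai V" "small U (U \<inter> V)"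
  shows "small V (U \<inter> V)"
  by (rule small_transfer[OF assms(2,1)]) (use assms(3) in \<open>auto simp: Int_commute\<close>)

lemma small_Diff_sym:
  assumes "proper_ai U" "proper_ai V"
  shows "small U (U - V) \<longleftrightarrow> small V (U - V)"
proof -
  have UV: "U \<subseteq> carrier G" "V \<subseteq> carrier G" using assms proper_aiD(1) by auto
  have eq: "U \<inter> complem G V = U - V" "complem G V \<inter> U = U - V" using UV by (auto simp: complem_def)
  have sub: "U - V \<subseteq> carrier G" using UV by auto
  show ?thesis
    using small_Int_sym[OF assms(1) proper_ai_complem[OF assms(2)]]
      small_Int_sym[OF proper_ai_complem[OF assms(2)] assms(1)]
      small_complem[OF UV(2) sub] by (auto simp: eq)
qed

lemma small_Diff_trans:
  assumes "proper_ai U" "proper_ai V" "proper_ai W" "small U (U - V)" "small V (V - W)"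
  shows "small U (U - W)"
proof -
  have sub: "U \<subseteq> carrier G" "V \<subseteq> carrier G" using assms proper_aiD(1) by auto
  have UV: "small V (U - V)" using small_Diff_sym[OF assms(1,2)] assms(4) by blast
  then have "small V ((U - V) \<union> (V - W))" using assms(5) by (simp add: small_Un)
  then have UW: "small V (U - W)" by (rule small_subset) auto
  show ?thesis
  proof (rule small_transfer[OF assms(1) proper_ai_complem[OF assms(2)]])
    show "small (complem G V) (U \<inter> complem G V)"
      by (subst small_complem) (use sub UV in \<open>auto simp: complem_def intro: small_subset\<close>)
    show "small (complem G V) (U - W)"
      by (subst small_complem) (use sub UW in auto)
  qed auto
qed

lemma eqv_iff_small_Diff:
  assumes "proper_ai U" "proper_ai V"
  shows "eqv U V \<longleftrightarrow> small U (U - V) \<and> small V (V - U)"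
  unfolding eqv_def small_Un small_Diff_sym[OF assms(2,1)] by blast

text \<open>Two adjacent small corners would make \<open>U\<close>, or the complement of \<open>V\<close>, small.\<close>

lemma opposite_corner_not_small:
  assumes "proper_ai U" "proper_ai V" "small U (U - V)"
  shows "\<not> small U (U \<inter> V)" "\<not> small U (complem G U \<inter> complem G V)"
proof -
  have sub: "U \<subseteq> carrier G" "V \<subseteq> carrier G" using assms proper_aiD(1) by auto
  show "\<not> small U (U \<inter> V)"
  proof
    assume "small U (U \<inter> V)"
    then have "small U ((U - V) \<union> (U \<inter> V))" using assms(3) by (simp add: small_Un)
    moreover have "(U - V) \<union> (U \<inter> V) = U" by auto
    ultimately show False using proper_aiD(3)[OF assms(1)] by simp
  qed
  show "\<not> small U (complem G U \<inter> complem G V)"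
  proof
    assume "small U (complem G U \<inter> complem G V)"
    then have "small (complem G U) (complem G U \<inter> complem G V)"
      by (subst small_complem) (use sub in \<open>auto simp: complem_def\<close>)
    then have "small (complem G V) (complem G U \<inter> complem G V)"
      by (rule small_Int_sym[OF assms(1,2)[THEN proper_ai_complem]])
    then have "small V (complem G U \<inter> complem G V)"
      by (subst (asm) small_complem) (use sub in \<open>auto simp: complem_def\<close>)
    moreover have "small V (U - V)" using small_Diff_sym[OF assms(1,2)] assms(3) by blast
    ultimately have "small V ((U - V) \<union> (complem G U \<inter> complem G V))" by (simp add: small_Un)
    moreover have "(U - V) \<union> (complem G U \<inter> complem G V) = complem G V"
      using sub by (auto simp: complem_def)
    ultimately show False using proper_aiD(4)[OF assms(2)] by simp
  qed
qed

text \<open>By \<open>opposite_corner_not_small\<close> the corner \<open>V - U\<close> is the only one that can be small together with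
\<open>U - V\<close>, and then \<open>U\<close> and \<open>V\<close> are equivalent.\<close>

lemma ai_le_iff:
  assumes "proper_ai U" "proper_ai V"
  shows "ai_le G U V \<longleftrightarrow> U \<subseteq> V \<or> (small U (U - V) \<and> \<not> eqv U V)"
proof -
  have sub: "U \<subseteq> carrier G" "V \<subseteq> carrier G" using assms proper_aiD(1) by auto
  note sm = small_corner_iff[OF assms(1) sub(2)] corner_simps[OF sub]
  have "(\<forall>c. small_corner G U V c \<longleftrightarrow> c = (True, False)) \<longleftrightarrow> small U (U - V) \<and> \<not> eqv U V"
  proof
    assume *: "\<forall>c. small_corner G U V c \<longleftrightarrow> c = (True, False)"
    then have "small_corner G U V (True, False)" "\<not> small_corner G U V (False, True)" by simp_all
    then show "small U (U - V) \<and> \<not> eqv U V" by (simp add: sm eqv_def small_Un)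
  next
    assume *: "small U (U - V) \<and> \<not> eqv U V"
    then have "\<not> small U (V - U)" by (simp add: eqv_def small_Un)
    then show "\<forall>c. small_corner G U V c \<longleftrightarrow> c = (True, False)"
      using * opposite_corner_not_small[OF assms] by (auto simp: sm split_paired_All all_bool_eq)
  qed
  then show ?thesis unfolding ai_le_def by (auto simp: sm)
qed

definition good_family :: "'a set set \<Rightarrow> bool" where
  "good_family E \<longleftrightarrow> (\<forall>U\<in>E. proper_ai U) \<and> good_position G E \<and>
     (\<forall>U\<in>E. \<forall>g\<in>carrier G. \<forall>s. signed g s U \<in> E)"

lemma good_familyD:
  assumes "good_family E" "U \<in> E"
  shows "proper_ai U" "U \<subseteq> carrier G" "g \<in> carrier G \<Longrightarrow> signed g s U \<in> E"
  using assms proper_aiD(1) by (auto simp: good_family_def)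

lemma good_family_complem:
  assumes "good_family E" "U \<in> E"
  shows "complem G U \<in> E"
  using good_familyD(3)[OF assms one_closed, of False] lcos_mult_one good_familyD(2)[OF assms]
  by (simp add: signed_def)

lemma nested_if_eqv:
  assumes E: "good_family E" "U \<in> E" "V \<in> E" and eqv: "eqv U V"
  shows "U \<subseteq> V \<or> V \<subseteq> U"
proof -
  note U = good_familyD[OF E(1,2)] and V = good_familyD[OF E(1,3)]
  note sm = small_corner_iff[OF U(1) V(2)] corner_simps[OF U(2) V(2)]
  have s: "small U (U - V)" "small U (V - U)" using eqv by (auto simp: eqv_def small_Un)
  then have "small_corner G U V (True, False)" "small_corner G U V (False, True)" by (simp_all add: sm)
  then have "\<exists>c. corner G U V c = {}" using E unfolding good_family_def good_position_def by blast
  moreover have "corner G U V (True, True) \<noteq> {}" "corner G U V (False, False) \<noteq> {}"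
    using opposite_corner_not_small[OF U(1) V(1) s(1)] small_empty by (auto simp: sm)
  ultimately show ?thesis by (auto simp: sm split_paired_Ex ex_bool_eq)
qed

lemma ai_le_eqv:
  assumes "proper_ai U" "proper_ai V" "eqv U V"
  shows "ai_le G U V \<longleftrightarrow> U \<subseteq> V"
  using ai_le_iff[OF assms(1,2)] assms(3) by blast

lemma ai_le_imp_small: "proper_ai U \<Longrightarrow> proper_ai V \<Longrightarrow> ai_le G U V \<Longrightarrow> small U (U - V)"
  using ai_le_iff small_empty by (metis Diff_eq_empty_iff)

lemma ai_le_not_eqv:
  assumes "proper_ai U" "proper_ai V" "\<not> eqv U V"
  shows "ai_le G U V \<longleftrightarrow> small U (U - V)"
  using ai_le_iff[OF assms(1,2)] ai_le_imp_small[OF assms(1,2)] assms(3) by blast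

lemma ai_le_refl: "proper_ai U \<Longrightarrow> ai_le G U U"
  by (simp add: ai_le_iff)

text \<open>Smallness of differences is transitive, which settles the case that \<open>U\<close> and \<open>W\<close> are inequivalent.
If they are equivalent, both are equivalent to \<open>V\<close>, and \<open>\<le>\<close> is inclusion.\<close>

lemma ai_le_trans:
  assumes E: "good_family E" "U \<in> E" "V \<in> E" "W \<in> E" and le: "ai_le G U V" "ai_le G V W"
  shows "ai_le G U W"
proof -
  note p = good_familyD(1)[OF E(1)]
  note U = p[OF E(2)] and V = p[OF E(3)] and W = p[OF E(4)]
  have s: "small U (U - V)" "small V (V - W)" using le ai_le_imp_small U V W by auto
  have UW: "small U (U - W)" by (rule small_Diff_trans[OF U V W s])
  show ?thesis
  proof (cases "eqv U W")
    case True
    then have WU: "small W (W - U)" using eqv_iff_small_Diff[OF U W] by blast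
    have "small V (V - U)" by (rule small_Diff_trans[OF V W U s(2) WU])
    moreover have "small W (W - V)" by (rule small_Diff_trans[OF W U V WU s(1)])
    ultimately have "eqv U V" "eqv V W" using s eqv_iff_small_Diff U V W by auto
    then have "U \<subseteq> V" "V \<subseteq> W" using le ai_le_eqv U V W by auto
    then show ?thesis using ai_le_eqv[OF U W True] by blast
  next
    case False
    then show ?thesis using UW ai_le_not_eqv[OF U W] by blast
  qed
qed

lemma ai_le_antisym:
  assumes U: "proper_ai U" and V: "proper_ai V" and le: "ai_le G U V" "ai_le G V U"
  shows "U = V"
proof -
  have "eqv U V" using le ai_le_imp_small eqv_iff_small_Diff U V by auto
  then show ?thesis using le ai_le_eqv U V eqv_sym by blast
qed

lemma eqv_complem:
  assumes "U \<subseteq> carrier G" "V \<subseteq> carrier G"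
  shows "eqv (complem G U) (complem G V) \<longleftrightarrow> eqv U V"
  using eqv_signed[OF assms one_closed, of False] assms by (simp add: signed_def lcos_mult_one)

lemma ai_le_complem:
  assumes U: "proper_ai U" and V: "proper_ai V"
  shows "ai_le G (complem G V) (complem G U) \<longleftrightarrow> ai_le G U V"
proof -
  have sub: "U \<subseteq> carrier G" "V \<subseteq> carrier G" using assms proper_aiD(1) by auto
  have eq: "complem G V - complem G U = U - V" using sub by (auto simp: complem_def)
  have "complem G V \<subseteq> complem G U \<longleftrightarrow> U \<subseteq> V" using sub by (auto simp: complem_def)
  moreover have "small (complem G V) (U - V) \<longleftrightarrow> small U (U - V)"
    using small_Diff_sym[OF U V] small_complem[OF sub(2), of "U - V"] sub by blast
  moreover have "eqv V U \<longleftrightarrow> eqv U V" using eqv_sym U V by blast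
  ultimately show ?thesis
    unfolding ai_le_iff[OF U V] ai_le_iff[OF V[THEN proper_ai_complem] U[THEN proper_ai_complem]]
      eq eqv_complem[OF sub(2,1)] by simp
qed

lemma not_ai_le_complem:
  assumes "proper_ai U"
  shows "\<not> ai_le G U (complem G U)"
proof -
  have "U - complem G U = U" using proper_aiD(1)[OF assms] by (auto simp: complem_def)
  then show ?thesis
    using ai_le_imp_small[OF assms proper_ai_complem[OF assms]] proper_aiD(3)[OF assms] by auto
qed

end

section \<open>Heights in an equivalence class\<close>

text \<open>A substitute for \<open>card B - card A\<close> that makes sense when \<open>A\<close> and \<open>B\<close> are infinite but almost
equal.\<close>

definition excess :: "'p set \<Rightarrow> 'p set \<Rightarrow> int" where
  "excess A B = int (card (B - A)) - int (card (A - B))"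

lemma excess_additive:
  assumes "finite (sym_diff A B)" "finite (sym_diff B C)"
  shows "excess A B + excess B C = excess A C"
proof -
  have fin: "finite (B - A)" "finite (A - B)" "finite (C - B)" "finite (B - C)"
    using assms by auto
  have "A - C \<subseteq> (A - B) \<union> (B - C)" "C - A \<subseteq> (C - B) \<union> (B - A)" by auto
  then have fin': "finite (A - C)" "finite (C - A)" using fin finite_subset by blast+
  have split: "card X = card (X \<inter> D) + card (X - D)" if "finite X" for X D :: "'a set"
    using card_Int_Diff[OF that] .
  show ?thesis
    unfolding excess_def
    using split[OF fin(1), of C] split[OF fin(2), of C] split[OF fin(3), of A] split[OF fin(4), of A]
      split[OF fin'(1), of B] split[OF fin'(2), of B]
    by (simp add: Int_Diff Diff_Int_distrib Int_commute Int_assoc set_diff_eq conj_commute conj_left_commute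
        Int_def)
qed

context group
begin

lemma translate_mono: "A \<subseteq> B \<Longrightarrow> g \<cdot> A \<subseteq> g \<cdot> B"
  by (auto simp: translate_image)

text \<open>Let \<open>h\<close> stabilise \<open>V\<close>.  The powers of \<open>h\<close> form a small set for \<open>V\<close>, hence for \<open>W\<close>, so
some positive power fixes \<open>W\<close>.  By good position \<open>W\<close> and \<open>h W\<close> are nested, and iterating
the inclusion up to that power turns it into an equality.\<close>

lemma stabiliser_subset_if_eqv:
  assumes E: "good_family E" "W \<in> E" and V: "proper_ai V" and eqv: "eqv V W"
  shows "stabiliser V \<subseteq> stabiliser W"
proof
  fix h assume "h \<in> stabiliser V"
  then have h: "h \<in> carrier G" "h \<cdot> V = V" by (auto simp: stabiliser_def)
  note W = good_familyD[OF E] and V' = proper_aiD(1)[OF V]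
  have pow: "h [^] (n::nat) \<cdot> V = V" for n
  proof (induction n)
    case (Suc n)
    then show ?case using h lcos_m_assoc[OF V', of "h [^] n" h] by simp
  qed (simp add: lcos_mult_one[OF V'])
  have ipow: "inv (h [^] n) \<cdot> V = V" for n :: nat
    using translate_inv(1)[OF V', of "h [^] n"] pow h by simp
  define C where "C = range (\<lambda>n::nat. h [^] n)"
  have C: "C \<subseteq> carrier G" using h by (auto simp: C_def)
  have "(\<lambda>c. inv c \<cdot> V) ` C \<subseteq> {V}" using ipow by (auto simp: C_def)
  then have "small V C" unfolding small_def using finite_subset by blast
  then have "finite (range (\<lambda>n::nat. inv (h [^] n) \<cdot> W))"
    using small_eqv[OF V W(1) eqv C] by (simp add: small_def C_def image_image)
  then have "\<not> inj (\<lambda>n::nat. inv (h [^] n) \<cdot> W)"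
    using finite_imageD infinite_UNIV_nat by blast
  then obtain i j :: nat where ij: "i < j" "inv (h [^] j) \<cdot> W = inv (h [^] i) \<cdot> W"
    by (metis (mono_tags, lifting) injI linorder_neqE_nat)
  have "h [^] j \<otimes> inv (h [^] i) \<in> stabiliser W"
    using translate_eq_iff[OF W(2), of "h [^] j" "h [^] i"] ij(2) h by simp
  moreover have "h [^] j = h [^] (j - i) \<otimes> h [^] i"
    using nat_pow_mult[OF h(1), of "j - i" i] ij(1) by simp
  ultimately have "h [^] (j - i) \<in> stabiliser W" using h by (simp add: m_assoc)
  then obtain m :: nat where m: "h [^] Suc m \<cdot> W = W"
    using ij(1) by (auto simp: stabiliser_def dest!: less_imp_Suc_add)
  have m': "h \<cdot> (h [^] n \<cdot> W) = h [^] Suc n \<cdot> W" for n :: nat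
    using lcos_m_assoc[OF W(2) h(1), of "h [^] n"] nat_pow_Suc2[OF h(1), of n] h(1) by simp
  have hW: "h \<cdot> W \<in> E" using W(3)[OF h(1), of True] by (simp add: signed_def)
  have "eqv (h \<cdot> W) (h \<cdot> V)"
    using eqv_signed[OF W(2) V' h(1), of True] eqv_sym[OF V W(1) eqv] by (simp add: signed_def)
  then have "eqv (h \<cdot> W) W"
    using eqv_trans[OF good_familyD(1)[OF E(1) hW] V W(1) _ eqv] h(2) by simp
  from nested_if_eqv[OF E(1) hW E(2) this] have "h \<cdot> W = W"
  proof
    assume *: "h \<cdot> W \<subseteq> W"
    have "h [^] n \<cdot> W \<subseteq> W" for n :: nat
    proof (induction n)
      case (Suc n)
      then show ?case using translate_mono[OF Suc, of h] * m'[of n] by simp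
    qed (simp add: lcos_mult_one[OF W(2)])
    then have "W \<subseteq> h \<cdot> W" using translate_mono[of _ W h] m m' by metis
    then show ?thesis using * by blast
  next
    assume *: "W \<subseteq> h \<cdot> W"
    have "W \<subseteq> h [^] n \<cdot> W" for n :: nat
    proof (induction n)
      case (Suc n)
      then show ?case using translate_mono[OF Suc, of h] * m'[of n] by simp
    qed (simp add: lcos_mult_one[OF W(2)])
    then have "h \<cdot> W \<subseteq> W" using translate_mono[of W _ h] m m' by metis
    then show ?thesis using * by blast
  qed
  then show "h \<in> stabiliser W" using h by (simp add: stabiliser_def)
qed

lemma stabiliser_eq_if_eqv:
  assumes "good_family E" "good_family E'" "V \<in> E" "W \<in> E'" "eqv V W"
  shows "stabiliser V = stabiliser W"
proof -
  have p: "proper_ai V" "proper_ai W" using assms good_familyD by auto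
  show ?thesis
    using stabiliser_subset_if_eqv[OF assms(2,4) p(1) assms(5)]
      stabiliser_subset_if_eqv[OF assms(1,3) p(2) eqv_sym[OF p assms(5)]] by blast
qed

lemma stabiliser_complem: 
  assumes "U \<subseteq> carrier G"
  shows "stabiliser (complem G U) = stabiliser U"
proof -
  have "g \<cdot> complem G U = complem G U \<longleftrightarrow> g \<cdot> U = U" if "g \<in> carrier G" for g
    using translate_complem[OF assms that] complem_complem[OF translate_subset[OF assms that]]
      complem_complem[OF assms] by metis
  then show ?thesis by (auto simp: stabiliser_def)
qed

text \<open>A model of the set of cosets \<open>N x\<close> with \<open>x\<close> in \<open>X\<close>, where \<open>N\<close> is the stabiliser of \<open>U\<close>:
two elements have the same coset if and only if they give the same translate of \<open>U\<close>.\<close>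

definition cosets :: "'a set \<Rightarrow> 'a set \<Rightarrow> 'a set set" where
  "cosets U X = (\<lambda>x. inv x \<cdot> U) ` X"

lemma finite_cosets: "finite (cosets U X) \<longleftrightarrow> small U X"
  by (simp add: cosets_def small_def)

lemma card_cosets_stabiliser:
  assumes "U \<subseteq> carrier G" "V \<subseteq> carrier G" "stabiliser U = stabiliser V" "X \<subseteq> carrier G"
  shows "card (cosets U X) = card (cosets V X)"
  unfolding cosets_def
  by (rule card_image_cong_fibres)
    (use assms translate_eq_iff[OF assms(1)] translate_eq_iff[OF assms(2)] in \<open>simp add: subset_eq\<close>)

lemma cosets_translate:
  assumes "U \<subseteq> carrier G" "X \<subseteq> carrier G" "k \<in> carrier G"
  shows "cosets U (k \<cdot> X) = cosets (inv k \<cdot> U) X"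
  unfolding cosets_def translate_image[of k X] image_image
  by (rule image_cong) (use assms in \<open>auto simp: inv_mult_group lcos_m_assoc subset_eq\<close>)

lemma cosets_Diff:
  assumes U: "U \<subseteq> carrier G" and XY: "X \<subseteq> carrier G" "Y \<subseteq> carrier G"
    and st: "stabiliser U \<subseteq> stabiliser Y"
  shows "cosets U X - cosets U Y = cosets U (X - Y)"
proof -
  have "x \<in> Y" if x: "x \<in> X" and y: "y \<in> Y" and eq: "inv x \<cdot> U = inv y \<cdot> U" for x y
  proof -
    have c: "x \<in> carrier G" "y \<in> carrier G" using x y XY by auto
    then have "x \<otimes> inv y \<in> stabiliser Y" using translate_eq_iff[OF U c] eq st by blast
    then have "(x \<otimes> inv y) \<otimes> y \<in> Y" using y by (auto simp: stabiliser_def translate_image)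
    then show ?thesis using c by (simp add: m_assoc)
  qed
  then show ?thesis unfolding cosets_def by blast
qed

definition height :: "'a set \<Rightarrow> 'a set \<Rightarrow> int" where
  "height U V = excess (cosets U U) (cosets U V)"

definition eqv_class :: "'a set set \<Rightarrow> 'a set \<Rightarrow> 'a set set" where
  "eqv_class E U = {V \<in> E. eqv V U}"

context
  fixes E0 :: "'a set set" and U :: "'a set"
  assumes E0: "good_family E0" and U: "U \<in> E0"
begin

lemma base_proper: "proper_ai U" and base_subset: "U \<subseteq> carrier G"
  using good_familyD[OF E0 U] by auto

lemma eqv_classD:
  assumes "good_family E" "V \<in> eqv_class E U"
  shows "V \<in> E" "proper_ai V" "V \<subseteq> carrier G" "eqv V U" "eqv U V" "stabiliser V = stabiliser U"
  using assms good_familyD[OF assms(1)] stabiliser_eq_if_eqv[OF assms(1) E0 _ U]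
    eqv_sym[OF _ base_proper] by (auto simp: eqv_class_def)

lemma small_class_Diff:
  assumes "good_family E" "V \<in> eqv_class E U" "good_family E'" "W \<in> eqv_class E' U"
  shows "small U (V - W)"
proof -
  note V = eqv_classD[OF assms(1,2)] and W = eqv_classD[OF assms(3,4)]
  have "small U (sym_diff U V \<union> sym_diff U W)" using V(5) W(5) unfolding eqv_def small_Un by blast
  then show ?thesis by (rule small_subset) auto
qed

lemma excess_class:
  assumes "good_family E" "V \<in> eqv_class E U" "good_family E'" "W \<in> eqv_class E' U"
  shows "excess (cosets U V) (cosets U W) = height U W - height U V"
proof -
  have fin: "finite (sym_diff (cosets U V') (cosets U W'))"
    if "good_family F" "V' \<in> eqv_class F U" "good_family F'" "W' \<in> eqv_class F' U" for V' W' F F'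
    using cosets_Diff[OF base_subset eqv_classD(3)[OF that(1,2)] eqv_classD(3)[OF that(3,4)]]
      cosets_Diff[OF base_subset eqv_classD(3)[OF that(3,4)] eqv_classD(3)[OF that(1,2)]]
      eqv_classD(6)[OF that(1,2)] eqv_classD(6)[OF that(3,4)]
      small_class_Diff[OF that] small_class_Diff[OF that(3,4,1,2)] by (simp add: finite_cosets)
  have "U \<in> eqv_class E0 U" using U eqv_refl by (simp add: eqv_class_def)
  from excess_additive[OF fin[OF E0 this assms(1,2)] fin[OF assms]]
  show ?thesis by (simp add: height_def)
qed

lemma height_le_iff:
  assumes E: "good_family E" "V \<in> eqv_class E U" "W \<in> eqv_class E U"
  shows "height U V \<le> height U W \<longleftrightarrow> V \<subseteq> W"
proof -
  have *: "height U V < height U W" if VW: "V \<in> eqv_class E U" "W \<in> eqv_class E U" "V \<subset> W" for V W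
  proof -
    note V = eqv_classD[OF E(1) VW(1)] and W = eqv_classD[OF E(1) VW(2)]
    have e: "cosets U V - cosets U W = {}"
      using cosets_Diff[OF base_subset V(3) W(3)] W(6) VW(3) by (auto simp: cosets_def)
    moreover have "cosets U W - cosets U V = cosets U (W - V)"
      using cosets_Diff[OF base_subset W(3) V(3)] V(6) by simp
    moreover have "finite (cosets U (W - V))"
      using small_class_Diff[OF E(1) VW(2) E(1) VW(1)] by (simp add: finite_cosets)
    moreover have "cosets U (W - V) \<noteq> {}" using VW(3) by (auto simp: cosets_def)
    ultimately have "0 < excess (cosets U V) (cosets U W)" unfolding excess_def e by (simp add: card_gt_0_iff)
    then show ?thesis using excess_class[OF E(1) VW(1) E(1) VW(2)] by simp
  qed
  have VW: "eqv V W" using eqv_classD[OF E(1)] E(2,3) base_proper eqv_trans by metis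
  have "V \<subseteq> W \<or> W \<subseteq> V"
    by (rule nested_if_eqv[OF E(1) _ _ VW]) (use E eqv_classD(1) in auto)
  then show ?thesis using *[OF E(2,3)] *[OF E(3,2)] by force
qed

lemma inj_on_height: "good_family E \<Longrightarrow> inj_on (height U) (eqv_class E U)"
  using height_le_iff by (intro inj_onI) (metis order_refl subset_antisym)

lemma signed_class:
  assumes E: "good_family E" "V \<in> eqv_class E U" and k: "k \<in> carrier G" "eqv (signed k s U) U"
  shows "signed k s V \<in> eqv_class E U"
proof -
  note V = eqv_classD[OF E]
  have "eqv (signed k s V) (signed k s U)" using eqv_signed[OF V(3) base_subset k(1)] V(4) by simp
  then have "eqv (signed k s V) U"
    using eqv_trans[OF proper_ai_signed proper_ai_signed base_proper _ k(2)] V(2) base_proper k(1) by blast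
  then show ?thesis using good_familyD(3)[OF E(1) V(1) k(1)] by (simp add: eqv_class_def)
qed

lemma eqv_signed_inv:
  assumes k: "k \<in> carrier G" "eqv (signed k s U) U"
  shows "eqv (signed (inv k) s U) U"
proof -
  have "eqv (signed (inv k) s (signed k s U)) (signed (inv k) s U)"
    using eqv_signed[OF signed_subset[OF base_subset k(1)] base_subset, of "inv k"] k by simp
  then have "eqv U (signed (inv k) s U)" using signed_inv(1)[OF base_subset k(1)] by simp
  then show ?thesis using eqv_sym[OF base_proper] proper_ai_signed[OF base_proper] k(1) by blast
qed

lemma stabiliser_translate_class:
  assumes k: "k \<in> carrier G" "eqv (signed k s U) U"
  shows "stabiliser (inv k \<cdot> U) = stabiliser U"
proof -
  have "signed (inv k) s U \<in> eqv_class E0 U"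
    using good_familyD(3)[OF E0 U] k eqv_signed_inv by (simp add: eqv_class_def)
  then have "stabiliser (signed (inv k) s U) = stabiliser U" using eqv_classD(6)[OF E0] by blast
  then show ?thesis
    using stabiliser_complem translate_subset[OF base_subset] k(1) by (cases s) (auto simp: signed_def)
qed

lemma card_cosets_translate:
  assumes k: "k \<in> carrier G" "eqv (signed k s U) U" and X: "X \<subseteq> carrier G"
  shows "card (cosets U (k \<cdot> X)) = card (cosets U X)"
  using cosets_translate[OF base_subset X k(1)]
    card_cosets_stabiliser[OF translate_subset[OF base_subset] base_subset stabiliser_translate_class[OF k] X] k(1)
  by simp

lemma excess_signed:
  assumes E: "good_family E" "V \<in> eqv_class E U" and E': "good_family E'" "W \<in> eqv_class E' U"
    and k: "k \<in> carrier G" "eqv (signed k s U) U"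
  shows "excess (cosets U (signed k s V)) (cosets U (signed k s W)) =
    (if s then 1 else - 1) * excess (cosets U V) (cosets U W)"
proof -
  note V = eqv_classD[OF E] and W = eqv_classD[OF E']
  note kV = eqv_classD[OF E(1) signed_class[OF E k]] and kW = eqv_classD[OF E'(1) signed_class[OF E' k]]
  have "signed k s W - signed k s V = k \<cdot> (if s then W - V else V - W)"
    "signed k s V - signed k s W = k \<cdot> (if s then V - W else W - V)"
    using translate_Diff[OF V(3) W(3) k(1)] translate_Diff[OF W(3) V(3) k(1)]
      translate_subset[OF V(3) k(1)] translate_subset[OF W(3) k(1)]
    by (auto simp: signed_def complem_def)
  then show ?thesis
    unfolding excess_def
    using cosets_Diff[OF base_subset V(3) W(3)] cosets_Diff[OF base_subset W(3) V(3)] V(6) W(6)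
      cosets_Diff[OF base_subset kV(3) kW(3)] cosets_Diff[OF base_subset kW(3) kV(3)] kV(6) kW(6)
      card_cosets_translate[OF k, of "V - W"] card_cosets_translate[OF k, of "W - V"] V(3) W(3)
    by (simp add: subset_eq)
qed

text \<open>An element of the group that preserves the class of \<open>U\<close> permutes the cosets of the common stabiliser, so it
preserves excesses, or reverses them if it involves a complement; the height of the image of \<open>U\<close> fixes
the remaining constant, which therefore depends neither on \<open>V\<close> nor on the family.\<close>

lemma height_signed:
  assumes E: "good_family E" "V \<in> eqv_class E U" and k: "k \<in> carrier G" "eqv (signed k s U) U"
  shows "height U (signed k s V) =
    height U (signed k s U) + (if s then 1 else - 1) * height U V"
proof -
  have U': "U \<in> eqv_class E0 U" using U eqv_refl by (simp add: eqv_class_def)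
  show ?thesis
    using excess_signed[OF E0 U' E k] excess_class[OF E0 signed_class[OF E0 U' k] E(1) signed_class[OF E k]]
      excess_class[OF E0 U' E] excess_class[OF E0 U' E0 U'] by (simp add: height_def excess_def)
qed

definition shifts :: "int set" where
  "shifts = {height U (signed k True U) | k. k \<in> carrier G \<and> eqv (signed k True U) U}"

definition flips :: "int set" where
  "flips = {height U (signed k False U) | k. k \<in> carrier G \<and> eqv (signed k False U) U}"

lemma eqv_signed_mult:
  assumes "k \<in> carrier G" "eqv (signed k s U) U" "l \<in> carrier G" "eqv (signed l t U) U"
  shows "eqv (signed (k \<otimes> l) (s = t) U) U"
    "height U (signed (k \<otimes> l) (s = t) U) =
      height U (signed k s U) + (if s then 1 else - 1) * height U (signed l t U)"
proof -
  have U': "U \<in> eqv_class E0 U" using U eqv_refl by (simp add: eqv_class_def)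
  have l: "signed l t U \<in> eqv_class E0 U" by (rule signed_class[OF E0 U' assms(3,4)])
  show "eqv (signed (k \<otimes> l) (s = t) U) U"
    using signed_class[OF E0 l assms(1,2)] signed_signed[OF base_subset assms(1,3)]
    by (simp add: eqv_class_def)
  show "height U (signed (k \<otimes> l) (s = t) U) =
      height U (signed k s U) + (if s then 1 else - 1) * height U (signed l t U)"
    using height_signed[OF E0 l assms(1,2)] signed_signed[OF base_subset assms(1,3)] by simp
qed

lemma height_self: "height U U = 0"
  by (simp add: height_def excess_def)

lemma height_signed_inv:
  assumes k: "k \<in> carrier G" "eqv (signed k s U) U"
  shows "height U (signed (inv k) s U) = (if s then - 1 else 1) * height U (signed k s U)"
  using eqv_signed_mult(2)[OF k _ eqv_signed_inv[OF k]] k(1) signed_one[OF base_subset] height_self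
  by (auto split: if_splits)

lemma line_motions: "line_motions shifts flips"
proof
  have "eqv (signed \<one> True U) U" using signed_one[OF base_subset] eqv_refl by simp
  then show "0 \<in> shifts"
    using signed_one[OF base_subset] height_self unfolding shifts_def
    by (intro CollectI exI[of _ \<one>]) simp
next
  fix p p' assume "p \<in> shifts" "p' \<in> shifts"
  then obtain k k' where k: "k \<in> carrier G" "eqv (signed k True U) U" "p = height U (signed k True U)"
    and k': "k' \<in> carrier G" "eqv (signed k' True U) U" "p' = height U (signed k' True U)"
    unfolding shifts_def by blast
  have i: "inv k' \<in> carrier G" using k' by simp
  show "p - p' \<in> shifts"
    using eqv_signed_mult[OF k(1,2) i eqv_signed_inv[OF k'(1,2)]] height_signed_inv[OF k'(1,2)] k k' i
    unfolding shifts_def by (intro CollectI exI[of _ "k \<otimes> inv k'"]) simp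
next
  fix c p assume "c \<in> flips" "p \<in> shifts"
  then obtain k k' where k: "k \<in> carrier G" "eqv (signed k False U) U" "c = height U (signed k False U)"
    and k': "k' \<in> carrier G" "eqv (signed k' True U) U" "p = height U (signed k' True U)"
    unfolding shifts_def flips_def by blast
  show "c + p \<in> flips"
    using eqv_signed_mult[OF k'(1,2) k(1,2)] k k'
    unfolding flips_def by (intro CollectI exI[of _ "k' \<otimes> k"]) simp
next
  fix c c' assume "c \<in> flips" "c' \<in> flips"
  then obtain k k' where k: "k \<in> carrier G" "eqv (signed k False U) U" "c = height U (signed k False U)"
    and k': "k' \<in> carrier G" "eqv (signed k' False U) U" "c' = height U (signed k' False U)"
    unfolding flips_def by blast
  have i: "inv k' \<in> carrier G" using k' by simp
  show "c - c' \<in> shifts"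
    using eqv_signed_mult[OF k(1,2) i eqv_signed_inv[OF k'(1,2)]] height_signed_inv[OF k'(1,2)] k k' i
    unfolding shifts_def by (intro CollectI exI[of _ "k \<otimes> inv k'"]) simp
qed

lemma motion_of_signed:
  assumes "k \<in> carrier G" "eqv (signed k s U) U"
  obtains \<delta> where "\<delta> \<in> line_motions.motions shifts flips"
    "\<And>E V. good_family E \<Longrightarrow> V \<in> eqv_class E U \<Longrightarrow> height U (signed k s V) = \<delta> (height U V)"
proof (cases s)
  case True
  have "height U (signed k s U) \<in> shifts" using assms True by (auto simp: shifts_def)
  from that[OF line_motions.shift_motion[OF line_motions this]] show thesis
    using height_signed[OF _ _ assms] True by simp
next
  case False
  have "height U (signed k s U) \<in> flips" using assms False by (auto simp: flips_def)
  from that[OF line_motions.flip_motion[OF line_motions this]] show thesis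
    using height_signed[OF _ _ assms] False by simp
qed

lemma signed_of_motion:
  assumes "\<delta> \<in> line_motions.motions shifts flips"
  obtains k s where "k \<in> carrier G" "eqv (signed k s U) U"
    "\<And>E V. good_family E \<Longrightarrow> V \<in> eqv_class E U \<Longrightarrow> height U (signed k s V) = \<delta> (height U V)"
proof (cases rule: line_motions.motions_cases[OF line_motions assms, case_names shift flip])
  case (shift p)
  then obtain k where k: "k \<in> carrier G" "eqv (signed k True U) U" "p = height U (signed k True U)"
    unfolding shifts_def by blast
  show thesis using that[OF k(1,2)] height_signed[OF _ _ k(1,2)] k(3) shift by simp
next
  case (flip c)
  then obtain k where k: "k \<in> carrier G" "eqv (signed k False U) U" "c = height U (signed k False U)"
    unfolding flips_def by blast
  show thesis using that[OF k(1,2)] height_signed[OF _ _ k(1,2)] k(3) flip by simp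
qed

text \<open>As heights are injective, a reflection that fixes the height of \<open>V\<close> comes from a \<open>k\<close> that
takes \<open>V\<close> to its complement.\<close>

lemma height_not_fixed:
  assumes E: "good_family E" "V \<in> eqv_class E U"
    and no_inv: "\<And>k. k \<in> carrier G \<Longrightarrow> k \<cdot> V \<noteq> complem G V"
  shows "2 * height U V \<notin> flips"
proof
  note V = eqv_classD[OF E]
  assume "2 * height U V \<in> flips"
  then obtain k where k: "k \<in> carrier G" "eqv (signed k False U) U" "2 * height U V = height U (signed k False U)"
    unfolding flips_def by blast
  have "height U (signed k False V) = height U V" using height_signed[OF E k(1,2)] k(3) by simp
  then have "signed k False V = V"
    using inj_onD[OF inj_on_height[OF E(1)] _ signed_class[OF E k(1,2)] E(2)] by simp
  then have "k \<cdot> V = complem G V"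
    using complem_complem[OF translate_subset[OF V(3) k(1)]] by (simp add: signed_def)
  then show False using no_inv[OF k(1)] by blast
qed

end

end

section \<open>Matching equivalent families\<close>

context group
begin

lemma mem_translates_iff:
  assumes "\<And>i. i \<in> I \<Longrightarrow> X i \<subseteq> carrier G"
  shows "V \<in> translates G X I \<longleftrightarrow> (\<exists>g\<in>carrier G. \<exists>i\<in>I. \<exists>s. V = signed g s (X i))"
  using assms unfolding translates_def signed_def by (auto simp: translate_complem ex_bool_eq)

lemma good_family_translates:
  assumes X: "\<And>i. i \<in> I \<Longrightarrow> proper_ai (X i)" and gp: "good_position G (translates G X I)"
  shows "good_family (translates G X I)"
proof -
  have sub: "X i \<subseteq> carrier G" if "i \<in> I" for i using X[OF that] proper_aiD(1) by blast
  have mem: "V \<in> translates G X I \<longleftrightarrow> (\<exists>g\<in>carrier G. \<exists>i\<in>I. \<exists>s. V = signed g s (X i))" for V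
    by (rule mem_translates_iff[OF sub])
  show ?thesis
    unfolding good_family_def
  proof (intro conjI gp ballI allI)
    fix U assume U: "U \<in> translates G X I"
    then obtain g i s where g: "g \<in> carrier G" "i \<in> I" "U = signed g s (X i)"
      unfolding mem by blast
    then show "proper_ai U" using X proper_ai_signed by blast
    fix h t assume "h \<in> carrier G"
    then have "signed h t U = signed (h \<otimes> g) (t = s) (X i)" "h \<otimes> g \<in> carrier G"
      using signed_signed[OF sub[OF g(2)]] g by auto
    then show "signed h t U \<in> translates G X I" unfolding mem using g(2) by blast
  qed
qed

text \<open>The equivalence of two sets and the smallness of their difference are unchanged when they are replaced by
equivalent sets, and they determine the order except within a class.\<close>

lemma ai_le_transfer:
  assumes A: "proper_ai A" "proper_ai A'" "eqv A A'" and B: "proper_ai B" "proper_ai B'" "eqv B B'"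
    and sub: "eqv A B \<Longrightarrow> A \<subseteq> B \<longleftrightarrow> A' \<subseteq> B'"
  shows "ai_le G A B \<longleftrightarrow> ai_le G A' B'"
proof -
  note As = eqv_iff_small_Diff[OF A(1,2)] and Bs = eqv_iff_small_Diff[OF B(1,2)]
  have small: "small A (A - B) \<longleftrightarrow> small A' (A' - B')"
    using small_Diff_trans A B As Bs by metis
  have eqv: "eqv A B \<longleftrightarrow> eqv A' B'"
    using eqv_trans eqv_sym A B by metis
  show ?thesis
  proof (cases "eqv A B")
    case True
    then show ?thesis using ai_le_eqv[OF A(1) B(1)] ai_le_eqv[OF A(2) B(2)] sub eqv by blast
  next
    case False
    then show ?thesis using ai_le_not_eqv[OF A(1) B(1)] ai_le_not_eqv[OF A(2) B(2)] small eqv by blast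
  qed
qed

lemma eqv_preserves_class:
  assumes "proper_ai U" "proper_ai A" "eqv A U" "k \<in> carrier G" "eqv (signed k r A) U"
  shows "eqv (signed k r U) U"
proof -
  have "eqv (signed k r U) (signed k r A)"
    using eqv_signed eqv_sym[OF assms(2,1,3)] assms(1,2,4) proper_aiD(1) by blast
  then show ?thesis
    using eqv_trans[OF proper_ai_signed[OF assms(1,4)] proper_ai_signed[OF assms(2,4)] assms(1) _ assms(5)]
    by blast
qed

end

locale matched_families = group G for G (structure) +
  fixes I :: "'i set" and Y Z :: "'i \<Rightarrow> 'a set"
  assumes finite_index: "finite I"
    and proper_Y: "i \<in> I \<Longrightarrow> proper_ai (Y i)" and proper_Z: "i \<in> I \<Longrightarrow> proper_ai (Z i)"
    and good_position_Y: "good_position G (translates G Y I)"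
    and good_position_Z: "good_position G (translates G Z I)"
    and eqv_YZ: "i \<in> I \<Longrightarrow> eqv (Y i) (Z i)"
    and not_invertible_Y: "i \<in> I \<Longrightarrow> \<not> invertible_ai G (Y i)"
    and not_invertible_Z: "i \<in> I \<Longrightarrow> \<not> invertible_ai G (Z i)"
    and redundant: "equally_redundant G Y Z I"
begin

abbreviation "E\<^sub>Y \<equiv> translates G Y I"
abbreviation "E\<^sub>Z \<equiv> translates G Z I"

lemma good_Y: "good_family E\<^sub>Y" and good_Z: "good_family E\<^sub>Z"
  using good_family_translates proper_Y proper_Z good_position_Y good_position_Z by blast+

lemma subset_Y: "i \<in> I \<Longrightarrow> Y i \<subseteq> carrier G" and subset_Z: "i \<in> I \<Longrightarrow> Z i \<subseteq> carrier G"
  using proper_Y proper_Z proper_aiD(1) by blast+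

lemma mem_Y: "V \<in> E\<^sub>Y \<longleftrightarrow> (\<exists>g\<in>carrier G. \<exists>i\<in>I. \<exists>s. V = signed g s (Y i))"
  by (rule mem_translates_iff[OF subset_Y])

lemma mem_Z: "V \<in> E\<^sub>Z \<longleftrightarrow> (\<exists>g\<in>carrier G. \<exists>i\<in>I. \<exists>s. V = signed g s (Z i))"
  by (rule mem_translates_iff[OF subset_Z])

lemma signed_not_complem:
  assumes "X \<subseteq> carrier G" "\<not> invertible_ai G X" "g \<in> carrier G" "V = signed g s X" "k \<in> carrier G"
  shows "k \<cdot> V \<noteq> complem G V"
proof
  assume "k \<cdot> V = complem G V"
  then have "signed k True (signed g s X) = signed \<one> False (signed g s X)"
    using assms lcos_mult_one[OF signed_subset[OF assms(1,3)], of s] by (simp add: signed_def)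
  then have "signed (inv g) s (signed k True (signed g s X)) = signed (inv g) s (signed \<one> False (signed g s X))"
    by simp
  then have "signed (inv g \<otimes> (k \<otimes> g)) True X = signed \<one> False X"
    using assms(1,3,5) by (simp add: signed_signed signed_subset)
  then have "(inv g \<otimes> (k \<otimes> g)) \<cdot> X = complem G X"
    using lcos_mult_one[OF assms(1)] by (simp add: signed_def)
  then show False using assms(2,3,5) unfolding invertible_ai_def by auto
qed

lemma not_complem_Y:
  assumes "V \<in> E\<^sub>Y" "k \<in> carrier G"
  shows "k \<cdot> V \<noteq> complem G V"
proof -
  obtain g i s where "g \<in> carrier G" "i \<in> I" "V = signed g s (Y i)"
    using assms(1) unfolding mem_Y by blast
  then show ?thesis using signed_not_complem subset_Y not_invertible_Y assms(2) by metis
qed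

lemma not_complem_Z:
  assumes "V \<in> E\<^sub>Z" "k \<in> carrier G"
  shows "k \<cdot> V \<noteq> complem G V"
proof -
  obtain g i s where "g \<in> carrier G" "i \<in> I" "V = signed g s (Z i)"
    using assms(1) unfolding mem_Z by blast
  then show ?thesis using signed_not_complem subset_Z not_invertible_Z assms(2) by metis
qed

lemma same_redundancy:
  assumes "i \<in> I" "j \<in> I"
  shows "(\<exists>g\<in>carrier G. \<exists>s. Y i = signed g s (Y j)) \<longleftrightarrow> (\<exists>g\<in>carrier G. \<exists>s. Z i = signed g s (Z j))"
proof -
  have "V \<in> translates G X {j} \<longleftrightarrow> (\<exists>g\<in>carrier G. \<exists>s. V = signed g s (X j))"
    if "X j \<subseteq> carrier G" for V X
    using mem_translates_iff[of "{j}" X V] that by simp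
  moreover have "Y i \<in> translates G Y {j} \<longleftrightarrow> Z i \<in> translates G Z {j}"
    using redundant assms unfolding equally_redundant_def by blast
  ultimately show ?thesis using subset_Y[OF assms(2)] subset_Z[OF assms(2)] by simp
qed

text \<open>As heights are injective on each chain, motions of heights detect orbits under the elements of the group
that preserve the class of \<open>U\<close>; these orbits are the intersections of the class with the full ones.\<close>

lemma orbit_in_class:
  assumes X: "\<And>i. i \<in> I \<Longrightarrow> proper_ai (X i)" and good: "good_family (translates G X I)"
    and U: "U \<in> E\<^sub>Y" and J: "J \<subseteq> I"
    and c: "\<And>j. j \<in> J \<Longrightarrow> c j \<in> carrier G \<and> eqv (signed (c j) (t j) (X j)) U"
    and ij: "i \<in> J" "j \<in> J"
  shows "(\<exists>\<delta>\<in>line_motions.motions (shifts U) (flips U).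
            height U (signed (c i) (t i) (X i)) = \<delta> (height U (signed (c j) (t j) (X j)))) \<longleftrightarrow>
         (\<exists>g\<in>carrier G. \<exists>s. X i = signed g s (X j))"
proof -
  have sub: "X i \<subseteq> carrier G" if "i \<in> I" for i using X[OF that] proper_aiD(1) by blast
  have mem: "V \<in> translates G X I \<longleftrightarrow> (\<exists>g\<in>carrier G. \<exists>i\<in>I. \<exists>s. V = signed g s (X i))" for V
    by (rule mem_translates_iff[OF sub])
  have cl: "signed (c j) (t j) (X j) \<in> eqv_class (translates G X I) U" if "j \<in> J" for j
    unfolding eqv_class_def mem mem_Collect_eq using c[OF that] that J by blast
  note cj = cl[OF ij(2)] and ci = cl[OF ij(1)]
  have cc: "c i \<in> carrier G" "c j \<in> carrier G" and sX: "X i \<subseteq> carrier G" "X j \<subseteq> carrier G"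
    using c ij sub J by auto
  show ?thesis
  proof
    assume "\<exists>\<delta>\<in>line_motions.motions (shifts U) (flips U).
            height U (signed (c i) (t i) (X i)) = \<delta> (height U (signed (c j) (t j) (X j)))"
    then obtain \<delta> where \<delta>: "\<delta> \<in> line_motions.motions (shifts U) (flips U)"
      "height U (signed (c i) (t i) (X i)) = \<delta> (height U (signed (c j) (t j) (X j)))" by blast
    obtain k s where k: "k \<in> carrier G" "eqv (signed k s U) U"
      "\<And>E V. good_family E \<Longrightarrow> V \<in> eqv_class E U \<Longrightarrow> height U (signed k s V) = \<delta> (height U V)"
      using signed_of_motion[OF good_Y U \<delta>(1)] by blast
    have "height U (signed k s (signed (c j) (t j) (X j))) = height U (signed (c i) (t i) (X i))"
      using k(3)[OF good cj] \<delta>(2) by simp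
    then have "signed k s (signed (c j) (t j) (X j)) = signed (c i) (t i) (X i)"
      using inj_onD[OF inj_on_height[OF good_Y U good] _ signed_class[OF good_Y U good cj k(1,2)] ci] by simp
    then have "X i = signed (inv (c i)) (t i) (signed k s (signed (c j) (t j) (X j)))"
      using signed_inv(1)[OF sX(1) cc(1), of "t i"] by simp
    also have "\<dots> = signed (inv (c i) \<otimes> (k \<otimes> c j)) (t i = (s = t j)) (X j)"
      using cc k(1) sX by (simp add: signed_signed)
    finally show "\<exists>g\<in>carrier G. \<exists>s. X i = signed g s (X j)" using cc k(1) by blast
  next
    assume "\<exists>g\<in>carrier G. \<exists>s. X i = signed g s (X j)"
    then obtain g s where g: "g \<in> carrier G" "X i = signed g s (X j)" by blast
    define k where "k = c i \<otimes> (g \<otimes> inv (c j))"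
    define r where "r = (t i = (s = t j))"
    have k: "k \<in> carrier G" using cc g by (simp add: k_def)
    have eq: "signed k r (signed (c j) (t j) (X j)) = signed (c i) (t i) (X i)"
      unfolding g(2) using cc g(1) sX k 
      by (simp add: signed_signed k_def r_def m_assoc) (cases "t i"; cases "t j"; cases s; simp)
    have pj: "proper_ai (signed (c j) (t j) (X j))" and U': "proper_ai U"
      using eqv_classD(2)[OF good_Y U good cj] base_proper[OF good_Y U] by auto
    have "eqv (signed k r U) U"
      using eqv_preserves_class[OF U' pj _ k, of r] eq c[OF ij(1)] c[OF ij(2)] by simp
    from motion_of_signed[OF good_Y U k this] obtain \<delta> where
      "\<delta> \<in> line_motions.motions (shifts U) (flips U)"
      "\<And>E V. good_family E \<Longrightarrow> V \<in> eqv_class E U \<Longrightarrow> height U (signed k r V) = \<delta> (height U V)" by blast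
    then show "\<exists>\<delta>\<in>line_motions.motions (shifts U) (flips U).
            height U (signed (c i) (t i) (X i)) = \<delta> (height U (signed (c j) (t j) (X j)))"
      using good cj eq by metis
  qed
qed

text \<open>Every index whose orbit meets the class of \<open>U\<close> is represented by one chosen member
\<open>signed (c j) (t j) (X j)\<close>, and any other member of the class in the same orbit differs from it by an element
that preserves the class.\<close>

lemma motion_orbits_cover:
  assumes X: "\<And>i. i \<in> I \<Longrightarrow> proper_ai (X i)" and good: "good_family (translates G X I)"
    and U: "U \<in> E\<^sub>Y" 
    and J: "J = {i\<in>I. \<exists>g\<in>carrier G. \<exists>s. eqv (signed g s (X i)) U}"
    and c: "\<And>j. j \<in> J \<Longrightarrow> c j \<in> carrier G \<and> eqv (signed (c j) (t j) (X j)) U"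
    and V: "V \<in> eqv_class (translates G X I) U"
  shows "\<exists>j\<in>J. \<exists>\<delta>\<in>line_motions.motions (shifts U) (flips U).
           height U V = \<delta> (height U (signed (c j) (t j) (X j)))"
proof -
  have sub: "X i \<subseteq> carrier G" if "i \<in> I" for i using X[OF that] proper_aiD(1) by blast
  have mem: "V \<in> translates G X I \<longleftrightarrow> (\<exists>g\<in>carrier G. \<exists>i\<in>I. \<exists>s. V = signed g s (X i))" for V
    by (rule mem_translates_iff[OF sub])
  note V' = eqv_classD[OF good_Y U good V]
  obtain g j s where g: "g \<in> carrier G" "j \<in> I" "V = signed g s (X j)" using V'(1) unfolding mem by blast
  then have j: "j \<in> J" using V'(4) J by blast
  have cj: "signed (c j) (t j) (X j) \<in> eqv_class (translates G X I) U"
    unfolding eqv_class_def mem mem_Collect_eq using c[OF j] g(2) by blast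
  note W = eqv_classD[OF good_Y U good cj]
  have cc: "c j \<in> carrier G" and U': "proper_ai U" using c[OF j] base_proper[OF good_Y U] by auto
  define k where "k = g \<otimes> inv (c j)"
  define r where "r = (s = t j)"
  have k: "k \<in> carrier G" using cc g by (simp add: k_def)
  have eq: "signed k r (signed (c j) (t j) (X j)) = V"
    using cc g(1,3) sub[OF g(2)] k 
    by (simp add: signed_signed k_def r_def m_assoc) (cases "t j"; cases s; simp)
  have "eqv (signed k r U) U"
    using eqv_preserves_class[OF U' W(2,4) k, of r] eq V'(4) by simp
  from motion_of_signed[OF good_Y U k this] obtain \<delta> where
    "\<delta> \<in> line_motions.motions (shifts U) (flips U)"
    "\<And>E V. good_family E \<Longrightarrow> V \<in> eqv_class E U \<Longrightarrow> height U (signed k r V) = \<delta> (height U V)" by blast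
  then show ?thesis using good cj eq j by metis
qed

definition class_iso :: "'a set \<Rightarrow> ('a set \<Rightarrow> 'a set) \<Rightarrow> bool" where
  "class_iso U \<psi> \<longleftrightarrow> bij_betw \<psi> (eqv_class E\<^sub>Y U) (eqv_class E\<^sub>Z U) \<and>
    (\<forall>V\<in>eqv_class E\<^sub>Y U. \<forall>W\<in>eqv_class E\<^sub>Y U. V \<subseteq> W \<longleftrightarrow> \<psi> V \<subseteq> \<psi> W) \<and>
    (\<forall>k\<in>carrier G. \<forall>s. eqv (signed k s U) U \<longrightarrow>
       (\<forall>V\<in>eqv_class E\<^sub>Y U. \<psi> (signed k s V) = signed k s (\<psi> V)))"

lemma class_isoD:
  assumes "class_iso U \<psi>"
  shows "bij_betw \<psi> (eqv_class E\<^sub>Y U) (eqv_class E\<^sub>Z U)"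
    "V \<in> eqv_class E\<^sub>Y U \<Longrightarrow> W \<in> eqv_class E\<^sub>Y U \<Longrightarrow> V \<subseteq> W \<longleftrightarrow> \<psi> V \<subseteq> \<psi> W"
    "k \<in> carrier G \<Longrightarrow> eqv (signed k s U) U \<Longrightarrow> V \<in> eqv_class E\<^sub>Y U \<Longrightarrow>
       \<psi> (signed k s V) = signed k s (\<psi> V)"
  using assms unfolding class_iso_def by simp_all

text \<open>The heights of the two chains satisfy the hypotheses of \<open>equivariant_order_iso\<close>.  The same elements of the
group take \<open>Y j\<close> and \<open>Z j\<close> into the class, as these are equivalent, so the orbits in the two
chains are indexed by the same set \<open>J\<close>, with the same coincidences by equal redundancy.\<close>

lemma ex_class_iso:
  assumes U: "U \<in> E\<^sub>Y"
  shows "\<exists>\<psi>. class_iso U \<psi>"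
proof -
  let ?M = "line_motions.motions (shifts U) (flips U)"
  let ?h = "height U"
  define J where "J = {i\<in>I. \<exists>g\<in>carrier G. \<exists>s. eqv (signed g s (Y i)) U}"
  have U': "proper_ai U" by (rule base_proper[OF good_Y U])
  have YZ: "eqv (signed g s (Y i)) U \<longleftrightarrow> eqv (signed g s (Z i)) U" if "i \<in> I" "g \<in> carrier G" for i g s
  proof -
    have "eqv (signed g s (Y i)) (signed g s (Z i))" "eqv (signed g s (Z i)) (signed g s (Y i))"
      using eqv_signed that subset_Y subset_Z eqv_YZ eqv_sym proper_Y proper_Z by metis+
    then show ?thesis using eqv_trans proper_ai_signed proper_Y proper_Z that U' by metis
  qed
  have JZ: "J = {i\<in>I. \<exists>g\<in>carrier G. \<exists>s. eqv (signed g s (Z i)) U}"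
    unfolding J_def using YZ by blast
  have JI: "J \<subseteq> I" by (auto simp: J_def)
  have "\<forall>j\<in>J. \<exists>g s. g \<in> carrier G \<and> eqv (signed g s (Y j)) U" by (auto simp: J_def)
  then obtain c t where cY: "\<And>j. j \<in> J \<Longrightarrow> c j \<in> carrier G \<and> eqv (signed (c j) (t j) (Y j)) U"
    by metis
  have cZ: "c j \<in> carrier G \<and> eqv (signed (c j) (t j) (Z j)) U" if "j \<in> J" for j
    using cY[OF that] YZ that JI by blast
  have inv: "\<delta> (?h V) \<in> ?h ` eqv_class E U" if E: "good_family E" "V \<in> eqv_class E U" and "\<delta> \<in> ?M" for E V \<delta>
  proof -
    obtain k s where k: "k \<in> carrier G" "eqv (signed k s U) U"
      "\<And>E V. good_family E \<Longrightarrow> V \<in> eqv_class E U \<Longrightarrow> ?h (signed k s V) = \<delta> (?h V)"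
      using signed_of_motion[OF good_Y U \<open>\<delta> \<in> ?M\<close>] by blast
    show ?thesis
      using k(3)[OF E] signed_class[OF good_Y U E k(1,2)] by (intro image_eqI[of _ _ "signed k s V"]) auto
  qed
  have "\<exists>\<Phi>. bij_betw \<Phi> (?h ` eqv_class E\<^sub>Y U) (?h ` eqv_class E\<^sub>Z U) \<and>
      (\<forall>x\<in>?h ` eqv_class E\<^sub>Y U. \<forall>y\<in>?h ` eqv_class E\<^sub>Y U. x < y \<longleftrightarrow> \<Phi> x < \<Phi> y) \<and>
      (\<forall>\<delta>\<in>?M. \<forall>x\<in>?h ` eqv_class E\<^sub>Y U. \<Phi> (\<delta> x) = \<delta> (\<Phi> x))"
  proof (rule line_motions.equivariant_order_iso[OF line_motions[OF good_Y U]])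
    show "2 * x \<notin> flips U" if x: "x \<in> ?h ` eqv_class E\<^sub>Y U" for x
    proof -
      obtain V where V: "V \<in> eqv_class E\<^sub>Y U" "x = ?h V" using x by blast
      show ?thesis
        unfolding V(2)
        by (rule height_not_fixed[OF good_Y U good_Y V(1) not_complem_Y[OF eqv_classD(1)[OF good_Y U good_Y V(1)]]])
    qed
    show "2 * x \<notin> flips U" if x: "x \<in> ?h ` eqv_class E\<^sub>Z U" for x
    proof -
      obtain V where V: "V \<in> eqv_class E\<^sub>Z U" "x = ?h V" using x by blast
      show ?thesis
        unfolding V(2)
        by (rule height_not_fixed[OF good_Y U good_Z V(1) not_complem_Z[OF eqv_classD(1)[OF good_Y U good_Z V(1)]]])
    qed
    show "\<delta> x \<in> ?h ` eqv_class E\<^sub>Y U" if "\<delta> \<in> ?M" "x \<in> ?h ` eqv_class E\<^sub>Y U" for \<delta> x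
      using inv[OF good_Y] that by blast
    show "\<delta> x \<in> ?h ` eqv_class E\<^sub>Z U" if "\<delta> \<in> ?M" "x \<in> ?h ` eqv_class E\<^sub>Z U" for \<delta> x
      using inv[OF good_Z] that by blast
    show "finite J" using finite_index JI finite_subset by blast
    show "?h (signed (c j) (t j) (Y j)) \<in> ?h ` eqv_class E\<^sub>Y U" if "j \<in> J" for j
    proof (rule imageI)
      show "signed (c j) (t j) (Y j) \<in> eqv_class E\<^sub>Y U"
        unfolding eqv_class_def mem_Y mem_Collect_eq using cY[OF that] that JI by blast
    qed
    show "?h (signed (c j) (t j) (Z j)) \<in> ?h ` eqv_class E\<^sub>Z U" if "j \<in> J" for j
    proof (rule imageI)
      show "signed (c j) (t j) (Z j) \<in> eqv_class E\<^sub>Z U"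
        unfolding eqv_class_def mem_Z mem_Collect_eq using cZ[OF that] that JI by blast
    qed
    show "\<exists>j\<in>J. \<exists>\<delta>\<in>?M. x = \<delta> (?h (signed (c j) (t j) (Y j)))" if "x \<in> ?h ` eqv_class E\<^sub>Y U" for x
      using motion_orbits_cover[OF proper_Y good_Y U J_def cY] that by blast
    show "\<exists>j\<in>J. \<exists>\<delta>\<in>?M. x = \<delta> (?h (signed (c j) (t j) (Z j)))" if "x \<in> ?h ` eqv_class E\<^sub>Z U" for x
      using motion_orbits_cover[OF proper_Z good_Z U JZ cZ] that by blast
    show "(\<exists>\<delta>\<in>?M. ?h (signed (c i) (t i) (Y i)) = \<delta> (?h (signed (c j) (t j) (Y j)))) \<longleftrightarrow>
        (\<exists>\<delta>\<in>?M. ?h (signed (c i) (t i) (Z i)) = \<delta> (?h (signed (c j) (t j) (Z j))))"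
      if "i \<in> J" "j \<in> J" for i j
      using orbit_in_class[OF proper_Y good_Y U JI cY that] orbit_in_class[OF proper_Z good_Z U JI cZ that]
        same_redundancy[of i j] that JI by blast
  qed
  then obtain \<Phi> where \<Phi>: "bij_betw \<Phi> (?h ` eqv_class E\<^sub>Y U) (?h ` eqv_class E\<^sub>Z U)"
      and \<Phi>_mono: "\<forall>x\<in>?h ` eqv_class E\<^sub>Y U. \<forall>y\<in>?h ` eqv_class E\<^sub>Y U. x < y \<longleftrightarrow> \<Phi> x < \<Phi> y"
      and \<Phi>_motion: "\<forall>\<delta>\<in>?M. \<forall>x\<in>?h ` eqv_class E\<^sub>Y U. \<Phi> (\<delta> x) = \<delta> (\<Phi> x)"
    by (elim exE conjE) (rule that)
  note inj_Y = inj_on_height[OF good_Y U good_Y] and inj_Z = inj_on_height[OF good_Y U good_Z]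
  define \<psi> where "\<psi> = the_inv_into (eqv_class E\<^sub>Z U) ?h \<circ> (\<Phi> \<circ> ?h)"
  have bij: "bij_betw \<psi> (eqv_class E\<^sub>Y U) (eqv_class E\<^sub>Z U)"
    unfolding \<psi>_def
    by (rule bij_betw_trans[OF bij_betw_trans[OF inj_on_imp_bij_betw[OF inj_Y] \<Phi>]
          bij_betw_the_inv_into[OF inj_on_imp_bij_betw[OF inj_Z]]])
  have \<psi>_mem: "\<psi> V \<in> eqv_class E\<^sub>Z U" if "V \<in> eqv_class E\<^sub>Y U" for V
    by (rule bij_betw_apply[OF bij that])
  have h\<psi>: "?h (\<psi> V) = \<Phi> (?h V)" if "V \<in> eqv_class E\<^sub>Y U" for V
  proof -
    have "\<Phi> (?h V) \<in> ?h ` eqv_class E\<^sub>Z U"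
      using bij_betw_apply[OF \<Phi> imageI[OF that]] .
    then show ?thesis unfolding \<psi>_def using f_the_inv_into_f[OF inj_Z] by simp
  qed
  have "V \<subseteq> W \<longleftrightarrow> \<psi> V \<subseteq> \<psi> W" if VW: "V \<in> eqv_class E\<^sub>Y U" "W \<in> eqv_class E\<^sub>Y U" for V W
  proof -
    have "V \<subseteq> W \<longleftrightarrow> \<not> ?h W < ?h V" using height_le_iff[OF good_Y U good_Y VW] by auto
    also have "\<dots> \<longleftrightarrow> \<not> \<Phi> (?h W) < \<Phi> (?h V)" using \<Phi>_mono VW by simp
    also have "\<dots> \<longleftrightarrow> \<psi> V \<subseteq> \<psi> W"
      using height_le_iff[OF good_Y U good_Z \<psi>_mem[OF VW(1)] \<psi>_mem[OF VW(2)]] h\<psi> VW by auto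
    finally show ?thesis .
  qed
  moreover have "\<psi> (signed k s V) = signed k s (\<psi> V)"
    if k: "k \<in> carrier G" "eqv (signed k s U) U" and V: "V \<in> eqv_class E\<^sub>Y U" for k s V
  proof -
    obtain \<delta> where \<delta>: "\<delta> \<in> ?M"
      "\<And>E V. good_family E \<Longrightarrow> V \<in> eqv_class E U \<Longrightarrow> ?h (signed k s V) = \<delta> (?h V)"
      using motion_of_signed[OF good_Y U k] by blast
    have kV: "signed k s V \<in> eqv_class E\<^sub>Y U" and k\<psi>V: "signed k s (\<psi> V) \<in> eqv_class E\<^sub>Z U"
      using signed_class[OF good_Y U good_Y V k] signed_class[OF good_Y U good_Z \<psi>_mem[OF V] k] by auto
    have "?h (\<psi> (signed k s V)) = ?h (signed k s (\<psi> V))"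
      using h\<psi>[OF kV] h\<psi>[OF V] \<delta>(2)[OF good_Y V] \<delta>(2)[OF good_Z \<psi>_mem[OF V]] bspec[OF bspec[OF \<Phi>_motion \<delta>(1)] imageI[OF V]]
      by simp
    then show ?thesis using inj_onD[OF inj_Z _ \<psi>_mem[OF kV] k\<psi>V] by blast
  qed
  ultimately have "class_iso U \<psi>" using bij unfolding class_iso_def by blast
  then show ?thesis by (intro exI[of _ \<psi>])
qed

text \<open>Choose one \<open>U\<close> for each orbit of equivalence classes, and a map for the class of \<open>U\<close> as in
\<open>ex_class_iso\<close>.  To define \<open>\<phi> A\<close>, move \<open>A\<close> into the class of its representative, apply the map
there and move back; by equivariance of that map the result does not depend on the element used.\<close>

lemma ex_signed_iso:
  "\<exists>\<phi>. bij_betw \<phi> E\<^sub>Y E\<^sub>Z \<and> (\<forall>A\<in>E\<^sub>Y. eqv A (\<phi> A)) \<and>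
    (\<forall>g\<in>carrier G. \<forall>s. \<forall>A\<in>E\<^sub>Y. \<phi> (signed g s A) = signed g s (\<phi> A)) \<and>
    (\<forall>A\<in>E\<^sub>Y. \<forall>B\<in>E\<^sub>Y. eqv A B \<longrightarrow> (A \<subseteq> B \<longleftrightarrow> \<phi> A \<subseteq> \<phi> B))"
proof -
  define \<psi> where "\<psi> U = (SOME \<psi>. class_iso U \<psi>)" for U
  have \<psi>: "class_iso U (\<psi> U)" if "U \<in> E\<^sub>Y" for U
    unfolding \<psi>_def by (rule someI_ex[OF ex_class_iso[OF that]])
  note \<psi>_bij = class_isoD(1)[OF \<psi>] and \<psi>_mono = class_isoD(2)[OF \<psi>] and \<psi>_signed = class_isoD(3)[OF \<psi>]
  define reach where "reach A U \<longleftrightarrow> (\<exists>g\<in>carrier G. \<exists>s. eqv (signed g s A) U)" for A U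
  note sub = good_familyD(2)[OF good_Y] and pai = good_familyD(1)[OF good_Y]
    and closed = good_familyD(3)[OF good_Y]
  note subZ = good_familyD(2)[OF good_Z] and propZ = good_familyD(1)[OF good_Z]
    and closedZ = good_familyD(3)[OF good_Z]
  have reach_signed: "reach (signed g s A) U \<longleftrightarrow> reach A U" if A: "A \<subseteq> carrier G" "g \<in> carrier G" for g s A U
  proof
    assume "reach (signed g s A) U"
    then show "reach A U" unfolding reach_def using signed_signed[OF A(1) _ A(2)] A(2) by (metis m_closed)
  next
    assume "reach A U"
    then obtain h t where h: "h \<in> carrier G" "eqv (signed h t A) U" unfolding reach_def by blast
    have "signed (h \<otimes> inv g) (t = s) (signed g s A) = signed h t A"
      using A h by (simp add: signed_signed m_assoc)
        (cases t; cases s; simp)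
    then show "reach (signed g s A) U" unfolding reach_def using h A by (metis m_closed inv_closed)
  qed
  have reach_eqv: "reach A U \<longleftrightarrow> reach B U" if AB: "proper_ai A" "proper_ai B" "eqv A B" and U: "U \<in> E\<^sub>Y" for A B U
  proof -
    have *: "reach B U" if AB: "proper_ai A" "proper_ai B" "eqv B A" and "reach A U" for A B
    proof -
      obtain h t where h: "h \<in> carrier G" "eqv (signed h t A) U"
        using \<open>reach A U\<close> unfolding reach_def by blast
      have "eqv (signed h t B) (signed h t A)" using eqv_signed AB proper_aiD(1) h(1) by blast
      then have "eqv (signed h t B) U"
        using eqv_trans[OF proper_ai_signed proper_ai_signed pai[OF U] _ h(2)] AB h(1) by blast
      then show ?thesis unfolding reach_def using h(1) by blast
    qed
    show ?thesis using *[OF AB(1,2)] *[OF AB(2,1)] eqv_sym[OF AB] AB(3) by blast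
  qed
  \<comment> \<open>One representative for all \<open>A\<close> whose classes form one orbit.\<close>
  define rep where "rep A = (SOME U. U \<in> E\<^sub>Y \<and> reach A U)" for A
  have rep: "rep A \<in> E\<^sub>Y" "reach A (rep A)" if "A \<in> E\<^sub>Y" for A
  proof -
    have "reach A A"
      unfolding reach_def using signed_one[OF sub[OF that]] eqv_refl
      by (intro bexI[of _ \<one>] exI[of _ True]) simp_all
    then have "rep A \<in> E\<^sub>Y \<and> reach A (rep A)"
      unfolding rep_def using that by (intro someI[of "\<lambda>U. U \<in> E\<^sub>Y \<and> reach A U" A]) simp
    then show "rep A \<in> E\<^sub>Y" "reach A (rep A)" by auto
  qed
  have rep_signed: "rep (signed g s A) = rep A" if "A \<in> E\<^sub>Y" "g \<in> carrier G" for g s A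
    unfolding rep_def using reach_signed[OF sub[OF that(1)] that(2)] by simp
  have rep_eqv: "rep A = rep B" if "A \<in> E\<^sub>Y" "B \<in> E\<^sub>Y" "eqv A B" for A B
  proof -
    have "(\<lambda>U. U \<in> E\<^sub>Y \<and> reach A U) = (\<lambda>U. U \<in> E\<^sub>Y \<and> reach B U)"
      using reach_eqv[OF pai[OF that(1)] pai[OF that(2)] that(3)] by (intro ext conj_cong refl) simp
    then show ?thesis unfolding rep_def by simp
  qed
  define to_rep where "to_rep A = (SOME p. fst p \<in> carrier G \<and> eqv (signed (fst p) (snd p) A) (rep A))" for A
  define g0 where "g0 A = fst (to_rep A)" for A
  define s0 where "s0 A = snd (to_rep A)" for A
  have g0: "g0 A \<in> carrier G" "eqv (signed (g0 A) (s0 A) A) (rep A)" if "A \<in> E\<^sub>Y" for A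
  proof -
    have "\<exists>p. fst p \<in> carrier G \<and> eqv (signed (fst p) (snd p) A) (rep A)"
      using rep(2)[OF that] unfolding reach_def by auto
    from someI_ex[OF this] show "g0 A \<in> carrier G" "eqv (signed (g0 A) (s0 A) A) (rep A)"
      by (auto simp: g0_def s0_def to_rep_def)
  qed
  define \<phi> where "\<phi> A = signed (inv (g0 A)) (s0 A) (\<psi> (rep A) (signed (g0 A) (s0 A) A))" for A
  have \<psi>_mem: "\<psi> U V \<in> eqv_class E\<^sub>Z U" if "U \<in> E\<^sub>Y" "V \<in> eqv_class E\<^sub>Y U" for U V
    by (rule bij_betw_apply[OF \<psi>_bij[OF that(1)] that(2)])
  have cls: "signed g s A \<in> eqv_class E\<^sub>Y (rep A)"
    if "A \<in> E\<^sub>Y" "g \<in> carrier G" "eqv (signed g s A) (rep A)" for A g s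
    using closed[OF that(1,2)] that(3) by (simp add: eqv_class_def)
  \<comment> \<open>The choice of \<open>g0\<close> and \<open>s0\<close> does not matter.\<close>
  have \<phi>_eq: "signed g s (\<phi> A) = \<psi> (rep A) (signed g s A)"
    if A: "A \<in> E\<^sub>Y" and g: "g \<in> carrier G" "eqv (signed g s A) (rep A)" for A g s
  proof -
    note c0 = g0[OF A]
    define k where "k = g \<otimes> inv (g0 A)"
    define r where "r = (s = s0 A)"
    have k: "k \<in> carrier G" using g c0 by (simp add: k_def)
    have kA: "signed k r (signed (g0 A) (s0 A) A) = signed g s A"
      using g c0 k sub[OF A] by (simp add: signed_signed k_def r_def m_assoc)
        (cases s; cases "s0 A"; simp)
    have R: "rep A \<in> E\<^sub>Y" by (rule rep(1)[OF A])
    note cl0 = cls[OF A c0]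
    have kR: "eqv (signed k r (rep A)) (rep A)"
      using eqv_preserves_class[OF pai[OF R] eqv_classD(2,4)[OF good_Y R good_Y cl0] k, of r] kA g(2)
      by simp
    have W: "\<psi> (rep A) (signed (g0 A) (s0 A) A) \<subseteq> carrier G"
      using eqv_classD(3)[OF good_Y R good_Z \<psi>_mem[OF R cl0]] .
    have "\<psi> (rep A) (signed g s A) = signed k r (\<psi> (rep A) (signed (g0 A) (s0 A) A))"
      using \<psi>_signed[OF R k kR cl0] kA by simp
    also have "\<dots> = signed g s (\<phi> A)"
      unfolding \<phi>_def r_def k_def using g(1) c0(1) W by (simp add: signed_signed)
    finally show ?thesis by simp
  qed
  have \<phi>_mem: "\<phi> A \<in> E\<^sub>Z" and \<phi>_eqv: "eqv A (\<phi> A)" if A: "A \<in> E\<^sub>Y" for A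
  proof -
    have R: "rep A \<in> E\<^sub>Y" by (rule rep(1)[OF A])
    note c0 = g0[OF A] and cl0 = cls[OF A g0[OF A]]
    note D = eqv_classD[OF good_Y R good_Z \<psi>_mem[OF R cl0]]
    show m: "\<phi> A \<in> E\<^sub>Z" unfolding \<phi>_def using closedZ[OF D(1)] c0(1) by simp
    have "eqv (signed (g0 A) (s0 A) A) (signed (g0 A) (s0 A) (\<phi> A))"
      unfolding \<phi>_eq[OF A c0]
      using eqv_trans[OF eqv_classD(2)[OF good_Y R good_Y cl0] pai[OF R] D(2) c0(2) D(5)] .
    then show "eqv A (\<phi> A)" using eqv_signed[OF sub[OF A] subZ[OF m] c0(1)] by blast
  qed
  have \<phi>_signed: "\<phi> (signed g s A) = signed g s (\<phi> A)" if A: "A \<in> E\<^sub>Y" and g: "g \<in> carrier G" for A g s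
  proof -
    let ?B = "signed g s A"
    have B: "?B \<in> E\<^sub>Y" by (rule closed[OF A g])
    note c0 = g0[OF B]
    let ?h = "g0 ?B" and ?t = "s0 ?B"
    have e: "signed ?h ?t ?B = signed (?h \<otimes> g) (?t = s) A" using signed_signed[OF sub[OF A] c0(1) g] .
    have "signed ?h ?t (\<phi> ?B) = \<psi> (rep A) (signed (?h \<otimes> g) (?t = s) A)"
      using \<phi>_eq[OF B c0] rep_signed[OF A g] e by simp
    also have "\<dots> = signed (?h \<otimes> g) (?t = s) (\<phi> A)"
      using \<phi>_eq[OF A, of "?h \<otimes> g" "?t = s"] c0 g e rep_signed[OF A g] by simp
    also have "\<dots> = signed ?h ?t (signed g s (\<phi> A))"
      using signed_signed[OF subZ[OF \<phi>_mem[OF A]] c0(1) g] by simp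
    finally have "signed (inv ?h) ?t (signed ?h ?t (\<phi> ?B)) = signed (inv ?h) ?t (signed ?h ?t (signed g s (\<phi> A)))"
      by simp
    then show ?thesis
      using signed_inv(1)[OF subZ[OF \<phi>_mem[OF B]] c0(1)]
        signed_inv(1)[OF signed_subset[OF subZ[OF \<phi>_mem[OF A]] g] c0(1)] by simp
  qed
  have common: "\<exists>g s. g \<in> carrier G \<and> eqv (signed g s A) (rep A) \<and> eqv (signed g s B) (rep A) \<and> rep B = rep A"
    if A: "A \<in> E\<^sub>Y" and B: "B \<in> E\<^sub>Y" and AB: "eqv A B" for A B
  proof -
    note c0 = g0[OF A]
    have "eqv (signed (g0 A) (s0 A) B) (signed (g0 A) (s0 A) A)"
      using eqv_signed sub A B c0(1) eqv_sym[OF pai[OF A] pai[OF B] AB] by blast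
    then have "eqv (signed (g0 A) (s0 A) B) (rep A)"
      using eqv_trans[OF proper_ai_signed proper_ai_signed pai[OF rep(1)[OF A]] _ c0(2)] pai A B c0(1) by blast
    then show ?thesis using c0 rep_eqv[OF A B AB] by metis
  qed
  have \<phi>_mono: "A \<subseteq> B \<longleftrightarrow> \<phi> A \<subseteq> \<phi> B" if A: "A \<in> E\<^sub>Y" and B: "B \<in> E\<^sub>Y" and AB: "eqv A B" for A B
  proof -
    obtain g s where g: "g \<in> carrier G" "eqv (signed g s A) (rep A)" "eqv (signed g s B) (rep A)" "rep B = rep A"
      using common[OF A B AB] by blast
    have sgn: "signed g s X \<subseteq> signed g s X' \<longleftrightarrow> (if s then X \<subseteq> X' else X' \<subseteq> X)"
      if "X \<subseteq> carrier G" "X' \<subseteq> carrier G" for X X'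
    proof -
      have "g \<cdot> X \<subseteq> g \<cdot> X' \<longleftrightarrow> X \<subseteq> X'" if "X \<subseteq> carrier G" "X' \<subseteq> carrier G" for X X'
        using translate_mono[of X X' g] translate_mono[of "g \<cdot> X" "g \<cdot> X'" "inv g"]
          translate_inv(1)[OF that(1) g(1)] translate_inv(1)[OF that(2) g(1)] by metis
      moreover have "complem G C \<subseteq> complem G D \<longleftrightarrow> D \<subseteq> C" if "C \<subseteq> carrier G" "D \<subseteq> carrier G" for C D
        using that by (auto simp: complem_def)
      ultimately show ?thesis using that translate_subset g(1) by (simp add: signed_def)
    qed
    have cA: "signed g s A \<in> eqv_class E\<^sub>Y (rep A)" and cB: "signed g s B \<in> eqv_class E\<^sub>Y (rep A)"
      using closed A B g by (auto simp: eqv_class_def)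
    have eA: "\<psi> (rep A) (signed g s A) = signed g s (\<phi> A)" and eB: "\<psi> (rep A) (signed g s B) = signed g s (\<phi> B)"
      using \<phi>_eq[OF A g(1,2)] \<phi>_eq[OF B g(1), of s] g(3,4) by auto
    have 1: "signed g s A \<subseteq> signed g s B \<longleftrightarrow> signed g s (\<phi> A) \<subseteq> signed g s (\<phi> B)"
      using \<psi>_mono[OF rep(1)[OF A] cA cB] unfolding eA eB .
    have 2: "signed g s B \<subseteq> signed g s A \<longleftrightarrow> signed g s (\<phi> B) \<subseteq> signed g s (\<phi> A)"
      using \<psi>_mono[OF rep(1)[OF A] cB cA] unfolding eA eB .
    show ?thesis
      using 1 2 sgn[OF sub[OF A] sub[OF B]] sgn[OF sub[OF B] sub[OF A]]
        sgn[OF subZ[OF \<phi>_mem[OF A]] subZ[OF \<phi>_mem[OF B]]]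
        sgn[OF subZ[OF \<phi>_mem[OF B]] subZ[OF \<phi>_mem[OF A]]] by (cases s) simp_all
  qed
  have inj: "inj_on \<phi> E\<^sub>Y"
  proof (rule inj_onI)
    fix A B assume A: "A \<in> E\<^sub>Y" and B: "B \<in> E\<^sub>Y" and eq: "\<phi> A = \<phi> B"
    have "eqv A B"
      using eqv_trans[OF pai[OF A] propZ[OF \<phi>_mem[OF A]] pai[OF B] \<phi>_eqv[OF A]]
        eqv_sym[OF pai[OF B] propZ[OF \<phi>_mem[OF B]] \<phi>_eqv[OF B]] eq by simp
    then show "A = B"
      using \<phi>_mono[OF A B] \<phi>_mono[OF B A] eqv_sym[OF pai[OF A] pai[OF B]] eq by blast
  qed
  have surj: "\<exists>A\<in>E\<^sub>Y. \<phi> A = C" if C: "C \<in> E\<^sub>Z" for C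
  proof -
    obtain g i s where g: "g \<in> carrier G" "i \<in> I" "C = signed g s (Z i)" using C unfolding mem_Z by blast
    define A where "A = signed g s (Y i)"
    have A: "A \<in> E\<^sub>Y" unfolding mem_Y A_def using g by blast
    have AC: "eqv C A"
      unfolding A_def g(3) using eqv_signed[OF subset_Z subset_Y g(1)] g(2) eqv_sym proper_Y proper_Z eqv_YZ by blast
    have R: "rep A \<in> E\<^sub>Y" by (rule rep(1)[OF A])
    note c0 = g0[OF A]
    let ?h = "g0 A" and ?t = "s0 A"
    have "eqv (signed ?h ?t C) (signed ?h ?t A)"
      using eqv_signed[OF subZ[OF C] sub[OF A] c0(1)] AC by blast
    then have "eqv (signed ?h ?t C) (rep A)"
      using eqv_trans[OF proper_ai_signed[OF propZ[OF C] c0(1)] proper_ai_signed[OF pai[OF A] c0(1)] pai[OF R] _ c0(2)]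
      by blast
    then have "signed ?h ?t C \<in> eqv_class E\<^sub>Z (rep A)" using closedZ[OF C c0(1)] by (simp add: eqv_class_def)
    then obtain V where V: "V \<in> eqv_class E\<^sub>Y (rep A)" "\<psi> (rep A) V = signed ?h ?t C"
      using bij_betw_imp_surj_on[OF \<psi>_bij[OF R]] by (metis imageE)
    note V' = eqv_classD[OF good_Y R good_Y V(1)]
    define B where "B = signed (inv ?h) ?t V"
    have B: "B \<in> E\<^sub>Y" using closed[OF V'(1)] c0(1) by (simp add: B_def)
    have hB: "signed ?h ?t B = V" using signed_inv(2)[OF V'(3) c0(1)] by (simp add: B_def)
    have BA: "rep B = rep A"
    proof -
      have "rep (signed ?h ?t B) = rep B" by (rule rep_signed[OF B c0(1)])
      moreover have "rep (signed ?h ?t A) = rep A" by (rule rep_signed[OF A c0(1)])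
      moreover have "eqv (signed ?h ?t B) (signed ?h ?t A)"
        unfolding hB
        using eqv_trans[OF V'(2) pai[OF R] proper_ai_signed[OF pai[OF A] c0(1)] V'(4)]
          eqv_sym[OF proper_ai_signed[OF pai[OF A] c0(1)] pai[OF R] c0(2)] by blast
      ultimately show ?thesis using rep_eqv[OF closed[OF B c0(1)] closed[OF A c0(1)]] by metis
    qed
    have "signed ?h ?t (\<phi> B) = signed ?h ?t C"
      using \<phi>_eq[OF B c0(1), of ?t] hB BA V V'(4) by simp
    then have "\<phi> B = C"
      using signed_inv(1)[OF subZ[OF \<phi>_mem[OF B]] c0(1)] signed_inv(1)[OF subZ[OF C] c0(1)] by metis
    then show ?thesis using B by blast
  qed
  have "bij_betw \<phi> E\<^sub>Y E\<^sub>Z" unfolding bij_betw_def using inj \<phi>_mem surj by blast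
  then show ?thesis using \<phi>_eqv \<phi>_signed \<phi>_mono by blast
qed

end

section \<open>Maps of cubed complexes\<close>

lemma cube_point_cong:
  assumes "\<And>S. S \<subseteq> D \<Longrightarrow> f S = g S"
  shows "cube_point D f t = cube_point D g t"
proof -
  have "{S. S \<subseteq> D \<and> f S = v} = {S. S \<subseteq> D \<and> g S = v}" for v using assms by auto
  then show ?thesis by (simp add: cube_point_def)
qed

lemma realise_map_cube_point:
  assumes D: "finite D"
  shows "realise_map \<psi> (cube_point D f t) = cube_point D (\<psi> \<circ> f) t"
proof
  fix u
  let ?w = "\<lambda>S. \<Prod>i\<in>D. if i \<in> S then t i else 1 - t i"
  let ?p = "cube_point D f t"
  have fin: "finite (f ` Pow D)" using D by simp
  have supp: "v \<in> f ` Pow D" if p: "?p v \<noteq> 0" for v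
  proof (rule ccontr)
    assume "v \<notin> f ` Pow D"
    then have e: "{S. S \<subseteq> D \<and> f S = v} = {}" by auto
    show False using p unfolding cube_point_def e by simp
  qed
  have "realise_map \<psi> ?p u = (\<Sum>v\<in>{v \<in> f ` Pow D. \<psi> v = u}. ?p v)"
    unfolding realise_map_def
    by (rule sum.mono_neutral_left) (use fin supp in auto)
  also have "\<dots> = (\<Sum>v\<in>{v \<in> f ` Pow D. \<psi> v = u}. sum ?w {S \<in> {S \<in> Pow D. \<psi> (f S) = u}. f S = v})"
    by (rule sum.cong) (auto simp: cube_point_def intro!: sum.cong)
  also have "\<dots> = sum ?w {S \<in> Pow D. \<psi> (f S) = u}"
    by (rule sum.group) (use D in auto)
  also have "\<dots> = cube_point D (\<psi> \<circ> f) t u"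
    by (simp add: cube_point_def)
  finally show "realise_map \<psi> ?p u = cube_point D (\<psi> \<circ> f) t u" .
qed

lemma cube_finite: "cube verts adj D f \<Longrightarrow> finite D"
  by (induction rule: cube.induct) auto

lemma cube_vertex_in:
  assumes "cube verts adj D f" "S \<subseteq> D"
  shows "f S \<in> verts"
  using assms
proof (induction arbitrary: S rule: cube.induct)
  case (edge f i)
  then show ?case by (cases "S = {}") (auto simp: subset_singleton_iff)
next
  case (attach D f)
  show ?case
  proof (cases "S = D")
    case True
    obtain i where i: "i \<in> D" using attach.hyps(2) by (cases "D = {}") auto
    have "f (insert i (D - {i})) \<in> verts" using attach.IH(2)[OF i, of "D - {i}"] by simp
    then show ?thesis using True i by (simp add: insert_absorb)
  next
    case False
    then obtain i where "i \<in> D" "i \<notin> S" using attach.prems by blast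
    then show ?thesis using attach.IH(1)[of i S] attach.prems by blast
  qed
qed simp

lemma cube_map:
  assumes "cube verts adj D f"
    and "\<And>v. v \<in> verts \<Longrightarrow> \<psi> v \<in> verts'" and "inj_on \<psi> verts"
    and "\<And>v w. v \<in> verts \<Longrightarrow> w \<in> verts \<Longrightarrow> adj v w \<Longrightarrow> adj' (\<psi> v) (\<psi> w)"
  shows "cube verts' adj' D (\<psi> \<circ> f)"
  using assms(1)
proof (induction rule: cube.induct)
  case (vertex f)
  then show ?case by (intro cube.vertex) (simp add: assms(2))
next
  case (edge f i)
  then show ?case by (intro cube.edge) (simp_all add: assms(2,4))
next
  case (attach D f)
  have "cube verts adj D f" by (rule cube.attach) (fact attach.hyps)+
  then have "f ` Pow D \<subseteq> verts" using cube_vertex_in by blast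
  then have "inj_on (\<psi> \<circ> f) (Pow D)"
    using attach.hyps(3) assms(3) by (intro comp_inj_on) (auto intro: inj_on_subset)
  moreover have "cube verts' adj' (D - {i}) (\<lambda>S. (\<psi> \<circ> f) (insert i S))" if "i \<in> D" for i
    using attach.IH(2)[OF that] by (simp add: comp_def)
  ultimately show ?case
    by (intro cube.attach[OF attach.hyps(1,2) _ attach.IH(1)])
qed

lemma topspace_realisation: "topspace (realisation_topology C) = realisation C"
proof (rule subset_antisym)
  show "topspace (realisation_topology C) \<subseteq> realisation C"
    using openin_topspace[of "realisation_topology C"] openin_realisation_topology[of C] by blast
  have "openin (realisation_topology C) (realisation C)"
    unfolding openin_realisation_topology
  proof (intro conjI subset_refl ballI, clarify)
    fix D f assume "(D, f) \<in> C"
    then have "{t \<in> unit_cube D. cube_point D f t \<in> realisation C} =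
        topspace (product_topology (\<lambda>_. top_of_set {0..1}) D)"
      by (auto simp: realisation_def cell_def unit_cube_def)
    then show "openin (product_topology (\<lambda>_. top_of_set {0..1}) D)
        {t \<in> unit_cube D. cube_point D f t \<in> realisation C}"
      by (metis openin_topspace)
  qed
  then show "realisation C \<subseteq> topspace (realisation_topology C)" by (rule openin_subset)
qed

lemma continuous_cube_point:
  assumes "(D, f) \<in> C"
  shows "continuous_map (product_topology (\<lambda>_. top_of_set {0..1}) D) (realisation_topology C) (cube_point D f)"
proof -
  have ts: "topspace (product_topology (\<lambda>_. top_of_set {0..1::real}) D) = unit_cube D"
    by (simp add: unit_cube_def)
  show ?thesis
    unfolding continuous_map_def topspace_realisation ts
    using assms by (auto simp: openin_realisation_topology realisation_def cell_def)
qed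

lemma connectedin_cell:
  assumes "(D, f) \<in> C"
  shows "connectedin (realisation_topology C) (cell D f)"
proof -
  have "connected_space (product_topology (\<lambda>_. top_of_set {0..1::real}) D)"
    by (simp add: connected_space_product_topology connected_space_subtopology connectedin_iff_connected)
  then have "connectedin (realisation_topology C)
      (cube_point D f ` topspace (product_topology (\<lambda>_. top_of_set {0..1}) D))"
    using connectedin_continuous_map_image[OF continuous_cube_point[OF assms]] connectedin_topspace by blast
  then show ?thesis by (simp add: cell_def unit_cube_def)
qed

lemma continuous_realise_map:
  assumes "\<And>D f. (D, f) \<in> C \<Longrightarrow> finite D \<and> (D, \<psi> \<circ> f) \<in> C'"
  shows "continuous_map (realisation_topology C) (realisation_topology C') (realise_map \<psi>)"
proof -
  have into: "realise_map \<psi> p \<in> realisation C'" if p: "p \<in> realisation C" for p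
  proof -
    obtain D f t where "(D, f) \<in> C" "t \<in> unit_cube D" "p = cube_point D f t"
      using p by (auto simp: realisation_def cell_def)
    then show ?thesis
      using assms[of D f] by (auto simp: realise_map_cube_point realisation_def cell_def)
  qed
  show ?thesis
    unfolding continuous_map_def topspace_realisation
  proof (intro conjI allI impI)
    show "realise_map \<psi> \<in> realisation C \<rightarrow> realisation C'" using into by blast
    fix U assume U: "openin (realisation_topology C') U"
    show "openin (realisation_topology C) {p \<in> realisation C. realise_map \<psi> p \<in> U}"
      unfolding openin_realisation_topology
    proof (intro conjI ballI, blast, clarify)
      fix D f assume Df: "(D, f) \<in> C"
      then have D: "finite D" "(D, \<psi> \<circ> f) \<in> C'" using assms by blast+
      have "{t \<in> unit_cube D. cube_point D f t \<in> {p \<in> realisation C. realise_map \<psi> p \<in> U}} =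
          {t \<in> unit_cube D. cube_point D (\<psi> \<circ> f) t \<in> U}"
        using Df by (auto simp: realise_map_cube_point[OF D(1)] realisation_def cell_def)
      then show "openin (product_topology (\<lambda>_. top_of_set {0..1}) D)
          {t \<in> unit_cube D. cube_point D f t \<in> {p \<in> realisation C. realise_map \<psi> p \<in> U}}"
        using U D(2) by (auto simp: openin_realisation_topology)
    qed
  qed
qed

lemma cubing_isomorphism_realise_map:
  assumes C: "\<And>D f. (D, f) \<in> C \<Longrightarrow> finite D \<and> (D, \<psi> \<circ> f) \<in> C' \<and> (\<forall>S\<subseteq>D. \<psi>' (\<psi> (f S)) = f S)"
    and C': "\<And>D f. (D, f) \<in> C' \<Longrightarrow> finite D \<and> (D, \<psi>' \<circ> f) \<in> C \<and> (\<forall>S\<subseteq>D. \<psi> (\<psi>' (f S)) = f S)"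
  shows "cubing_isomorphism C C' (realise_map \<psi>)"
proof -
  have inverse: "realise_map \<psi>' (realise_map \<psi> p) = p"
    if maps: "\<And>D f. (D, f) \<in> C \<Longrightarrow> finite D \<and> (D, \<psi> \<circ> f) \<in> C' \<and> (\<forall>S\<subseteq>D. \<psi>' (\<psi> (f S)) = f S)"
      and p: "p \<in> realisation C"
    for C :: "'c cubes" and C' :: "'d cubes" and \<psi> \<psi>' p
  proof -
    obtain D f t where p: "(D, f) \<in> C" "p = cube_point D f t"
      using p by (auto simp: realisation_def cell_def)
    have "realise_map \<psi>' (realise_map \<psi> p) = cube_point D (\<psi>' \<circ> (\<psi> \<circ> f)) t"
      using maps[OF p(1)] p(2) by (simp add: realise_map_cube_point)
    also have "\<dots> = p" unfolding p(2) using maps[OF p(1)] by (intro cube_point_cong) simp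
    finally show ?thesis .
  qed
  have "homeomorphic_maps (realisation_topology C) (realisation_topology C') (realise_map \<psi>) (realise_map \<psi>')"
    unfolding homeomorphic_maps_def topspace_realisation
    using continuous_realise_map[of C \<psi> C'] continuous_realise_map[of C' \<psi>' C] C C'
      inverse[of C \<psi> C' \<psi>'] inverse[of C' \<psi>' C \<psi>] by blast
  then have "homeomorphic_map (realisation_topology C) (realisation_topology C') (realise_map \<psi>)"
    using homeomorphic_maps_map by blast
  moreover have "\<exists>(D', f')\<in>C'. isometric_cells (realise_map \<psi>) D f D' f'" if "(D, f) \<in> C" for D f
  proof -
    have "isometric_cells (realise_map \<psi>) D f D (\<psi> \<circ> f)"
      unfolding isometric_cells_def
      by (rule exI[of _ "\<lambda>t. t"]) (use C[OF that] in \<open>simp add: realise_map_cube_point bij_betw_def\<close>)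
    then show ?thesis using C[OF that] by blast
  qed
  ultimately show ?thesis unfolding cubing_isomorphism_def by blast
qed

text \<open>At the corner \<open>T\<close> of the unit cube the multilinear weight of every other corner has a vanishing factor.\<close>

lemma vertex_point_in_cell:
  assumes D: "finite D" "T \<subseteq> D"
  shows "vertex_point (f T) \<in> cell D f"
proof -
  define t where "t = (\<lambda>i\<in>D. if i \<in> T then 1 else 0 :: real)"
  have w: "(\<Prod>i\<in>D. if i \<in> S then t i else 1 - t i) = (if S = T then 1 else 0)" if "S \<subseteq> D" for S
  proof (cases "S = T")
    case True
    then show ?thesis by (auto simp: t_def intro!: prod.neutral)
  next
    case False
    have "sym_diff S T \<noteq> {}" "sym_diff S T \<subseteq> D" using False D(2) that by auto
    then obtain i where "i \<in> D" "i \<in> sym_diff S T" by blast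
    then have "\<exists>i\<in>D. (if i \<in> S then t i else 1 - t i) = 0" by (intro bexI[of _ i]) (auto simp: t_def)
    then show ?thesis using D False by (simp add: prod_zero)
  qed
  have "cube_point D f t = vertex_point (f T)"
  proof
    fix v
    have "cube_point D f t v = (\<Sum>S | S \<subseteq> D \<and> f S = v. if S = T then 1 else 0)"
      unfolding cube_point_def by (rule sum.cong) (auto simp: w)
    also have "\<dots> = (if v = f T then 1 else 0)" using D by (auto simp: sum.delta)
    finally show "cube_point D f t v = vertex_point (f T) v" by (simp add: vertex_point_def)
  qed
  moreover have "t \<in> unit_cube D" by (auto simp: t_def unit_cube_def)
  ultimately show ?thesis by (metis cell_def image_eqI)
qed

lemma realise_map_vertex_point: "realise_map \<psi> (vertex_point v) = vertex_point (\<psi> v)"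
proof -
  have "{w. vertex_point v w \<noteq> 0 \<and> \<psi> w = u} = (if \<psi> v = u then {v} else {})" for u
    by (auto simp: vertex_point_def)
  then show ?thesis by (auto simp: realise_map_def vertex_point_def)
qed

lemma vertex_point_in_realisation:
  assumes "v \<in> verts"
  shows "vertex_point v \<in> realisation {(D, f). cube verts adj D f}"
proof -
  have "cube verts adj {} (\<lambda>_. v)" using assms by (intro cube.vertex) simp
  then show ?thesis
    using vertex_point_in_cell[of "{}" "{}" "\<lambda>_. v"] by (auto simp: realisation_def)
qed

lemma connected_component_adjacent:
  assumes "v \<in> verts" "w \<in> verts" "adj v w"
  shows "connected_component_of (realisation_topology {(D, f). cube verts adj D f})
           (vertex_point v) (vertex_point w)"
proof -
  define f where "f S = (if S = {} then v else w)" for S :: "nat set"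
  have "cube verts adj {0} f" using assms by (intro cube.edge) (auto simp: f_def)
  then have "connectedin (realisation_topology {(D, f). cube verts adj D f}) (cell {0} f)"
    by (intro connectedin_cell) simp
  moreover have "vertex_point v \<in> cell {0} f" "vertex_point w \<in> cell {0} f"
    using vertex_point_in_cell[of "{0}" "{}" f] vertex_point_in_cell[of "{0}" "{0}" f] by (simp_all add: f_def)
  ultimately show ?thesis unfolding connected_component_of_def by blast
qed

section \<open>Ultrafilters with finite difference\<close>

context group
begin

lemma ultrafilterD:
  assumes "V \<in> ultrafilters G E"
  shows "V \<subseteq> E" "A \<in> E \<Longrightarrow> A \<in> V \<longleftrightarrow> complem G A \<notin> V"
    "A \<in> V \<Longrightarrow> B \<in> E \<Longrightarrow> ai_le G A B \<Longrightarrow> B \<in> V"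
  using assms unfolding ultrafilters_def by blast+

lemma complem_fixed_iff:
  assumes "good_family E" "A \<in> E" "B \<in> E"
  shows "complem G A = B \<longleftrightarrow> A = complem G B"
  using complem_complem good_familyD(2)[OF assms(1)] assms(2,3) by metis

text \<open>Only the upward closure is at stake: minimality of \<open>A\<close> excludes sets of \<open>V\<close> below \<open>A\<close>, and dually
sets above the complement of \<open>A\<close> whose complements are in \<open>V\<close>.\<close>

lemma ultrafilter_flip:
  assumes E: "good_family E" and V: "V \<in> ultrafilters G E" and A: "A \<in> V"
    and minimal: "\<And>B. B \<in> V \<Longrightarrow> ai_le G B A \<Longrightarrow> B = A"
  shows "(V - {A}) \<union> {complem G A} \<in> ultrafilters G E"
proof -
  note V' = ultrafilterD[OF V]
  have AE: "A \<in> E" using A V'(1) by blast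
  note cl = good_family_complem[OF E] and p = good_familyD(1)[OF E]
  have cA: "complem G A \<in> E" by (rule cl[OF AE])
  have cAV: "complem G A \<notin> V" using V'(2)[OF AE] A by simp
  have ne: "complem G A \<noteq> A" using cAV A by auto
  show ?thesis
    unfolding ultrafilters_def mem_Collect_eq
  proof (intro conjI ballI impI)
    show "V - {A} \<union> {complem G A} \<subseteq> E" using V'(1) cA by blast
    fix B assume B: "B \<in> E"
    show "(B \<in> V - {A} \<union> {complem G A}) \<noteq> (complem G B \<in> V - {A} \<union> {complem G A})"
      using V'(2)[OF B] complem_fixed_iff[OF E AE B] complem_fixed_iff[OF E B AE]
        complem_fixed_iff[OF E B cl[OF AE]] complem_complem[OF good_familyD(2)[OF E AE]] ne A cAV by auto
  next
    fix B C assume B: "B \<in> V - {A} \<union> {complem G A}" and C: "C \<in> E" and le: "ai_le G B C"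
    show "C \<in> V - {A} \<union> {complem G A}"
    proof (cases "B = complem G A")
      case True
      have CA: "C \<noteq> A"
      proof
        assume "C = A"
        then have "ai_le G (complem G A) (complem G (complem G A))"
          using le True complem_complem[OF good_familyD(2)[OF E AE]] by simp
        then show False using not_ai_le_complem[OF p[OF cA]] by blast
      qed
      show ?thesis
      proof (cases "C \<in> V")
        case False
        then have cC: "complem G C \<in> V" using V'(2)[OF C] by blast
        have "ai_le G (complem G C) (complem G (complem G A))"
          using ai_le_complem[OF p[OF cA] p[OF C]] le True by blast
        then have "ai_le G (complem G C) A" using complem_complem[OF good_familyD(2)[OF E AE]] by simp
        then have "complem G C = A" using minimal[OF cC] by blast
        then show ?thesis using complem_fixed_iff[OF E C AE] by blast
      qed (use CA in blast)
    next
      case False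
      then have BV: "B \<in> V" "B \<noteq> A" using B by auto
      then have "C \<in> V" using V'(3) C le by blast
      moreover have "C \<noteq> A" using minimal[OF BV(1)] BV(2) le by blast
      ultimately show ?thesis by blast
    qed
  qed
qed

lemma ex_minimal:
  assumes E: "good_family E" and X: "finite X" "X \<noteq> {}" "X \<subseteq> E"
  obtains m where "m \<in> X" "\<And>b. b \<in> X \<Longrightarrow> ai_le G b m \<Longrightarrow> b = m"
proof -
  let ?R = "\<lambda>a b. ai_le G a b \<and> a \<noteq> b"
  have anti: "ai_le G a b \<Longrightarrow> ai_le G b a \<Longrightarrow> a = b" if "a \<in> X" "b \<in> X" for a b
    using ai_le_antisym good_familyD(1)[OF E] that X(3) by blast
  have "\<exists>m\<in>X. \<forall>x\<in>X. x \<noteq> m \<longrightarrow> \<not> ?R x m"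
  proof (rule Finite_Set.bex_min_element[OF X(1) _ _ X(2)])
    show "asymp_on X ?R" by (rule asymp_onI) (use anti in blast)
    show "transp_on X ?R"
    proof (rule transp_onI)
      fix a b c assume abc: "a \<in> X" "b \<in> X" "c \<in> X" "?R a b" "?R b c"
      then have "ai_le G a c" using ai_le_trans[OF E] X(3) by blast
      moreover have "a \<noteq> c" using anti abc by blast
      ultimately show "?R a c" by blast
    qed
  qed
  then show thesis using that by blast
qed

text \<open>A minimal element of \<open>V - V'\<close> is minimal in \<open>V\<close>, because \<open>V'\<close> is closed upwards.  Flipping it
crosses an edge and brings \<open>V\<close> closer to \<open>V'\<close>.\<close>

lemma connected_component_ultrafilters:
  assumes E: "good_family E" and V': "V' \<in> ultrafilters G E"
    and V: "V \<in> ultrafilters G E" "finite (V - V')"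
  shows "connected_component_of (realisation_topology (Lambda_cubes G E)) (vertex_point V) (vertex_point V')"
  using V
proof (induction "card (V - V')" arbitrary: V rule: less_induct)
  case less
  note Vu = ultrafilterD[OF less.prems(1)] and Vu' = ultrafilterD[OF V']
  show ?case
  proof (cases "V - V' = {}")
    case True
    have "V' \<subseteq> V" 
    proof
      fix A assume A: "A \<in> V'"
      then have AE: "A \<in> E" using Vu'(1) by blast
      then have "complem G A \<notin> V'" using Vu'(2) A by blast
      then show "A \<in> V" using Vu(2)[OF AE] True by blast
    qed
    then have "V = V'" using True by blast
    then show ?thesis
      using vertex_point_in_realisation[OF V'] 
      by (simp add: connected_component_of_refl topspace_realisation Lambda_cubes_def)
  next
    case False
    have "V - V' \<subseteq> E" using Vu(1) by blast
    from ex_minimal[OF E less.prems(2) False this] obtain A where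
      A: "A \<in> V - V'" "\<And>B. B \<in> V - V' \<Longrightarrow> ai_le G B A \<Longrightarrow> B = A" by blast
    have AE: "A \<in> E" using A Vu(1) by blast
    have min: "B = A" if B: "B \<in> V" "ai_le G B A" for B
    proof -
      have "B \<notin> V'" using Vu'(3)[OF _ AE B(2)] A(1) by blast
      then show ?thesis using A(2) B by blast
    qed
    define W where "W = (V - {A}) \<union> {complem G A}"
    have W: "W \<in> ultrafilters G E"
      unfolding W_def using ultrafilter_flip[OF E less.prems(1) _ min] A(1) by blast
    have "complem G A \<in> V'" using Vu'(2)[OF AE] A(1) by blast
    then have WV: "W - V' = (V - V') - {A}" by (auto simp: W_def)
    have "card (W - V') < card (V - V')"
      unfolding WV by (rule card_Diff1_less[OF less.prems(2) A(1)])
    moreover have "finite (W - V')" using less.prems(2) WV by simp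
    ultimately have "connected_component_of (realisation_topology (Lambda_cubes G E)) (vertex_point W) (vertex_point V')"
      using less.hyps W by blast
    moreover have "uf_adjacent G V W" unfolding uf_adjacent_def W_def using A(1) by blast
    then have "connected_component_of (realisation_topology (Lambda_cubes G E)) (vertex_point V) (vertex_point W)"
      unfolding Lambda_cubes_def by (rule connected_component_adjacent[OF less.prems(1) W])
    ultimately show ?thesis using connected_component_of_trans by metis
  qed
qed

section \<open>Basic vertices\<close>

lemma finite_signed_through_point:
  assumes "U \<subseteq> carrier G" "C \<subseteq> carrier G" "x \<in> carrier G" "small U C"
  shows "finite {signed k t U | k t. k \<in> carrier G \<and> x \<in> k \<cdot> C}"
proof (rule finite_subset)
  let ?T = "{k \<cdot> U | k. k \<in> carrier G \<and> x \<in> k \<cdot> C}"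
  show "{signed k t U | k t. k \<in> carrier G \<and> x \<in> k \<cdot> C} \<subseteq> ?T \<union> complem G ` ?T"
    unfolding signed_def by auto
  show "finite (?T \<union> complem G ` ?T)" using finite_translates_through_point[OF assms] by simp
qed

lemma cayley_edge_subset: "S \<subseteq> carrier G \<Longrightarrow> e \<in> cayley_edges G S \<Longrightarrow> e \<subseteq> carrier G"
  by (auto simp: cayley_edges_def)

lemma finite_cayley_ball:
  assumes S: "finite S" "S \<subseteq> carrier G" and g: "g \<in> carrier G"
  shows "finite (cayley_ball G S R g)" "cayley_ball G S R g \<subseteq> carrier G"
proof -
  let ?r = "{(a, b). {a, b} \<in> cayley_edges G S}"
  have step: "{b. (a, b) \<in> ?r} \<subseteq> (\<lambda>s. a \<otimes> s) ` S \<union> (\<lambda>s. a \<otimes> inv s) ` S" if a: "a \<in> carrier G" for a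
  proof
    fix b assume "b \<in> {b. (a, b) \<in> ?r}"
    then obtain h s where hs: "h \<in> carrier G" "s \<in> S" "{a, b} = {h, h \<otimes> s}"
      by (auto simp: cayley_edges_def)
    have "s \<in> carrier G" using hs S by auto
    then have "b = a \<otimes> s \<or> b = a \<otimes> inv s"
      using hs(1,3) by (auto simp: doubleton_eq_iff m_assoc)
    then show "b \<in> (\<lambda>s. a \<otimes> s) ` S \<union> (\<lambda>s. a \<otimes> inv s) ` S" using hs(2) by blast
  qed
  have reach: "finite {x. (g, x) \<in> ?r ^^ k} \<and> {x. (g, x) \<in> ?r ^^ k} \<subseteq> carrier G" for k
  proof (induction k)
    case (Suc k)
    have "{x. (g, x) \<in> ?r ^^ Suc k} = (\<Union>y\<in>{x. (g, x) \<in> ?r ^^ k}. {b. (y, b) \<in> ?r})" by auto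
    moreover have "finite {b. (y, b) \<in> ?r} \<and> {b. (y, b) \<in> ?r} \<subseteq> carrier G" if "y \<in> carrier G" for y
      using finite_subset[OF step[OF that]] step[OF that] S that by (auto simp: subset_eq)
    ultimately show ?case using Suc by auto
  qed (use g in auto)
  have eq: "cayley_ball G S R g = (\<Union>k\<in>{k. real k \<le> R}. {x. (g, x) \<in> ?r ^^ k})"
    by (auto simp: cayley_ball_def)
  have "{k. real k \<le> R} \<subseteq> {..nat \<lfloor>R\<rfloor>}" by (auto simp: le_nat_floor)
  then have "finite {k. real k \<le> R}" using finite_subset by blast
  then show "finite (cayley_ball G S R g)" "cayley_ball G S R g \<subseteq> carrier G"
    unfolding eq using reach by auto
qed

lemma coboundary_complem:
  assumes "S \<subseteq> carrier G" "A \<subseteq> carrier G"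
  shows "coboundary G S (complem G A) = coboundary G S A"
proof -
  have "(e \<inter> complem G A \<noteq> {} \<and> e - complem G A \<noteq> {}) \<longleftrightarrow> (e \<inter> A \<noteq> {} \<and> e - A \<noteq> {})"
    if "e \<subseteq> carrier G" for e
    using that assms(2) unfolding complem_def by blast
  then show ?thesis using cayley_edge_subset[OF assms(1)] unfolding coboundary_def by blast
qed

lemma near_sets_complem:
  assumes "S \<subseteq> carrier G" "good_family E" "A \<in> E"
  shows "complem G A \<in> near_sets G S E R g \<longleftrightarrow> A \<in> near_sets G S E R g"
  using coboundary_complem[OF assms(1) good_familyD(2)[OF assms(2,3)]] good_family_complem[OF assms(2,3)] assms(3)
  by (simp add: near_sets_def)

lemma cayley_ball_subset:
  assumes A: "A \<in> E - near_sets G S E R g" "g \<in> A"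
  shows "cayley_ball G S R g \<subseteq> A"
proof -
  let ?r = "{(a, b). {a, b} \<in> cayley_edges G S}"
  have "x \<in> A" if "real k \<le> R" "(g, x) \<in> ?r ^^ k" for k x
    using that
  proof (induction k arbitrary: x)
    case (Suc k)
    obtain y where y: "(g, y) \<in> ?r ^^ k" "(y, x) \<in> ?r" using Suc.prems(2) by auto
    have "y \<in> A" using Suc.IH[OF _ y(1)] Suc.prems(1) by simp
    show ?case
    proof (rule ccontr)
      assume "x \<notin> A"
      then have "{y, x} \<in> coboundary G S A" using y(2) \<open>y \<in> A\<close> by (auto simp: coboundary_def)
      moreover have "{y, x} \<subseteq> cayley_ball G S R g"
        using y(1) Suc.prems unfolding cayley_ball_def
        by (auto intro: exI[of _ k] exI[of _ "Suc k"] simp del: relpow.simps)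
      ultimately show False using A(1) by (auto simp: near_sets_def)
    qed
  qed (use A in auto)
  then show ?thesis by (auto simp: cayley_ball_def)
qed

text \<open>An edge at \<open>h\<close> crosses the boundary of \<open>k X i\<close> only if \<open>k\<^sup>-\<^sup>1 h\<close> lies in a boundary of \<open>X i\<close>,
which is small.  So there are finitely many such translates for each of the finitely many \<open>h\<close>.\<close>

lemma finite_near_sets:
  assumes S: "finite S" "S \<subseteq> carrier G" and I: "finite I"
    and X: "\<And>i. i \<in> I \<Longrightarrow> proper_ai (X i)" and g: "g \<in> carrier G"
  shows "finite (near_sets G S (translates G X I) R g)"
proof -
  note ball = finite_cayley_ball[OF S g, of R]
  have sub: "X i \<subseteq> carrier G" if "i \<in> I" for i using X[OF that] proper_aiD(1) by blast
  define C where "C i = (\<Union>s\<in>S. {y \<in> X i. y \<otimes> s \<notin> X i} \<union> {y \<in> complem G (X i). y \<otimes> s \<notin> complem G (X i)})" for i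
  have C: "C i \<subseteq> carrier G" "small (X i) (C i)" if i: "i \<in> I" for i
  proof -
    show "C i \<subseteq> carrier G" using sub[OF i] complem_subset by (auto simp: C_def)
    have "small (X i) {y \<in> complem G (X i). y \<otimes> s \<notin> complem G (X i)}" if "s \<in> S" for s
      using proper_aiD(2)[OF proper_ai_complem[OF X[OF i]], of s] S that
        small_complem[OF sub[OF i], of "{y \<in> complem G (X i). y \<otimes> s \<notin> complem G (X i)}"] complem_subset
      by (auto simp: subset_eq)
    then show "small (X i) (C i)"
      unfolding C_def using proper_aiD(2)[OF X[OF i]] S by (intro small_UN) (auto simp: small_Un)
  qed
  have "near_sets G S (translates G X I) R g \<subseteq>
      (\<Union>h\<in>cayley_ball G S R g. \<Union>i\<in>I. {signed k t (X i) | k t. k \<in> carrier G \<and> h \<in> k \<cdot> C i})"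
  proof
    fix A assume "A \<in> near_sets G S (translates G X I) R g"
    then obtain e where A: "A \<in> translates G X I" and e: "e \<in> coboundary G S A" "e \<subseteq> cayley_ball G S R g"
      unfolding near_sets_def by blast
    obtain k i t where k: "k \<in> carrier G" "i \<in> I" "A = signed k t (X i)"
      using A mem_translates_iff[OF sub, where I = I] by auto
    obtain h s where hs: "h \<in> carrier G" "s \<in> S" "e = {h, h \<otimes> s}"
      using e(1) unfolding coboundary_def cayley_edges_def by blast
    have s: "s \<in> carrier G" using hs S by blast
    let ?B = "k \<cdot> X i"
    have "(h \<in> A) \<noteq> (h \<otimes> s \<in> A)" using e(1) unfolding coboundary_def hs(3) by auto
    then have "(h \<in> ?B) \<noteq> (h \<otimes> s \<in> ?B)"
      using hs(1) s by (cases t) (auto simp: k(3) signed_def complem_def)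
    then have "(inv k \<otimes> h \<in> X i) \<noteq> (inv k \<otimes> h \<otimes> s \<in> X i)"
      using mem_translate[OF sub[OF k(2)] k(1)] hs(1) s k(1) by (simp add: m_assoc)
    then have "inv k \<otimes> h \<in> C i"
      using hs(1,2) s k(1) unfolding C_def complem_def by auto
    then have "h \<in> k \<cdot> C i" using mem_translate[OF C(1)[OF k(2)] k(1) hs(1)] by blast
    moreover have "h \<in> cayley_ball G S R g" using e(2) hs(3) by blast
    ultimately show "A \<in> (\<Union>h\<in>cayley_ball G S R g. \<Union>i\<in>I. {signed k t (X i) | k t. k \<in> carrier G \<and> h \<in> k \<cdot> C i})"
      using k by blast
  qed
  moreover have "finite (\<Union>h\<in>cayley_ball G S R g. \<Union>i\<in>I. {signed k t (X i) | k t. k \<in> carrier G \<and> h \<in> k \<cdot> C i})"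
    using ball I sub C by (intro finite_UN_I finite_signed_through_point) auto
  ultimately show ?thesis by (rule finite_subset)
qed

text \<open>What all the stages of the construction of a basic vertex at \<open>g\<close> have in common.  A complete stage is
then an ultrafilter that contains, among the sets whose boundary is far from \<open>g\<close>, exactly those through
\<open>g\<close>.\<close>

definition partial_ultrafilter :: "'a set \<Rightarrow> 'a set set \<Rightarrow> real \<Rightarrow> 'a \<Rightarrow> 'a set set \<Rightarrow> bool" where
  "partial_ultrafilter S E R g U \<longleftrightarrow> U \<subseteq> E \<and> (\<forall>A\<in>U. \<forall>B\<in>E. ai_le G A B \<longrightarrow> B \<in> U) \<and>
     (\<forall>A\<in>U. complem G A \<notin> U) \<and> (\<forall>A\<in>E - near_sets G S E R g. g \<in> A \<longrightarrow> A \<in> U)"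

lemma mem_undecided:
  assumes "good_family E" "U \<subseteq> E"
  shows "B \<in> undecided G E U \<longleftrightarrow> B \<in> E \<and> B \<notin> U \<and> complem G B \<notin> U"
proof -
  have "B \<in> complem G ` U \<longleftrightarrow> complem G B \<in> U" if B: "B \<in> E"
  proof
    assume "B \<in> complem G ` U"
    then obtain C where "C \<in> U" "B = complem G C" by blast
    moreover from this have "complem G B = C"
      using complem_complem[OF good_familyD(2)[OF assms(1)]] assms(2) by blast
    ultimately show "complem G B \<in> U" by simp
  next
    assume "complem G B \<in> U"
    then show "B \<in> complem G ` U"
      using complem_complem[OF good_familyD(2)[OF assms(1) B]] by (metis imageI)
  qed
  then show ?thesis unfolding undecided_def by blast
qed

text \<open>For the first stage the admissible radius shows that everything above a far set through \<open>g\<close>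
contains \<open>g\<close>, which gives consistency.  A later stage adds the sets above an undecided \<open>A\<close>; were both
\<open>B\<close> and its complement among them, \<open>A\<close> would be below its own complement.\<close>

lemma partial_ultrafilter_basic_stage:
  assumes S: "S \<subseteq> carrier G" and E: "good_family E" and R: "admissible_radius G S E R"
    and stage: "basic_stage G S E R g U"
  shows "partial_ultrafilter S E R g U"
  using stage
proof (induction rule: basic_stage.induct)
  case (start Ug)
  let ?N = "near_sets G S E R g"
  have N: "?N \<subseteq> E" by (auto simp: near_sets_def)
  have far: "g \<in> B" if "A \<in> Ug" "B \<in> E" "ai_le G A B" for A B
  proof -
    have A: "A \<in> E" "A \<in> E - ?N" "g \<in> A" using that(1) start by auto
    then show ?thesis
      using R cayley_ball_subset[OF A(2,3)] that(2,3) unfolding admissible_radius_def by blast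
  qed
  let ?U = "Ug \<union> {B \<in> ?N. \<exists>A\<in>Ug. ai_le G A B}"
  have below: "\<exists>C\<in>Ug. ai_le G C A" if "A \<in> ?U" for A
    using that ai_le_refl good_familyD(1)[OF E] start by blast
  have UE: "?U \<subseteq> E" using start N by auto
  have cov: "B \<in> ?U" if "A \<in> Ug" "B \<in> E" "ai_le G A B" for A B
    using far[OF that] that start by blast
  show ?case
    unfolding partial_ultrafilter_def
  proof (intro conjI ballI impI)
    fix A B assume AB: "A \<in> ?U" "B \<in> E" "ai_le G A B"
    obtain C where C: "C \<in> Ug" "ai_le G C A" using below[OF AB(1)] by blast
    have "ai_le G C B" using ai_le_trans[OF E _ _ AB(2) C(2) AB(3)] UE AB(1) C(1) by blast
    then show "B \<in> ?U" using cov[OF C(1) AB(2)] by blast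
  next
    fix A assume A: "A \<in> ?U"
    show "complem G A \<notin> ?U"
    proof
      assume cA: "complem G A \<in> ?U"
      obtain C D where CD: "C \<in> Ug" "ai_le G C A" "D \<in> Ug" "ai_le G D (complem G A)"
        using below[OF A] below[OF cA] by blast
      have AE: "A \<in> E" "C \<in> E" "D \<in> E" using A UE CD by auto
      note p = good_familyD(1)[OF E] and cl = good_family_complem[OF E]
      have "ai_le G (complem G (complem G A)) (complem G D)"
        using ai_le_complem[OF p[OF AE(3)] p[OF cl[OF AE(1)]]] CD(4) by blast
      then have "ai_le G A (complem G D)" using complem_complem good_familyD(2)[OF E AE(1)] by simp
      then have "ai_le G C (complem G D)" using ai_le_trans[OF E AE(2,1) cl[OF AE(3)] CD(2)] by blast
      then have "g \<in> complem G D" using far[OF CD(1) cl[OF AE(3)]] by blast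
      then show False using CD(3) start by (auto simp: complem_def)
    qed
  qed (use UE start in auto)
next
  case (step U A)
  note IH = step.IH[unfolded partial_ultrafilter_def]
  have UE: "U \<subseteq> E" and up: "\<And>A B. A \<in> U \<Longrightarrow> B \<in> E \<Longrightarrow> ai_le G A B \<Longrightarrow> B \<in> U"
    and cons: "\<And>A. A \<in> U \<Longrightarrow> complem G A \<notin> U" and far: "\<And>A. A \<in> E - near_sets G S E R g \<Longrightarrow> g \<in> A \<Longrightarrow> A \<in> U"
    using IH by auto
  note p = good_familyD(1)[OF E] and cl = good_family_complem[OF E] and sub = good_familyD(2)[OF E]
  note undec = mem_undecided[OF E UE]
  let ?U = "U \<union> {B \<in> undecided G E U. ai_le G A B}"
  have AE: "A \<in> E" using step.hyps(2) undec by blast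
  have new: "C \<in> ?U" if C: "C \<in> E" "ai_le G A C" for C
  proof (cases "C \<in> undecided G E U")
    case False
    have "complem G C \<notin> U"
    proof
      assume "complem G C \<in> U"
      moreover have "ai_le G (complem G C) (complem G A)" using ai_le_complem[OF p[OF AE] p[OF C(1)]] C(2) by blast
      ultimately have "complem G A \<in> U" using up cl[OF AE] by blast
      then show False using step.hyps(2) undec by blast
    qed
    then show ?thesis using False undec C(1) by blast
  qed (use C in blast)
  show ?case
    unfolding partial_ultrafilter_def
  proof (intro conjI ballI impI)
    show "?U \<subseteq> E" using UE undec by blast
    fix B C assume BC: "B \<in> ?U" "C \<in> E" "ai_le G B C"
    show "C \<in> ?U"
    proof (cases "B \<in> U")
      case False
      then have B: "B \<in> E" "ai_le G A B" using BC(1) undec by auto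
      show ?thesis by (rule new[OF BC(2) ai_le_trans[OF E AE B(1) BC(2) B(2) BC(3)]])
    qed (use up BC in blast)
  next
    fix B assume B: "B \<in> ?U"
    show "complem G B \<notin> ?U"
    proof
      assume cB: "complem G B \<in> ?U"
      have BE: "B \<in> E" using B UE undec by blast
      have ccB: "complem G (complem G B) = B" using complem_complem[OF sub[OF BE]] .
      have "B \<notin> U"
      proof
        assume "B \<in> U"
        then show False using cons cB undec[of "complem G B"] ccB by auto
      qed
      moreover have "complem G B \<notin> U" using B undec calculation by blast
      ultimately have "ai_le G A B" "ai_le G A (complem G B)" using B cB by auto
      then have "ai_le G B (complem G A)"
        using ai_le_complem[OF p[OF AE] p[OF cl[OF BE]]] ccB by simp
      then have "ai_le G A (complem G A)" using ai_le_trans[OF E AE BE cl[OF AE] \<open>ai_le G A B\<close>] by blast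
      then show False using not_ai_le_complem[OF p[OF AE]] by blast
    qed
  qed (use far in blast)
qed

lemma basic_stage_complete:
  assumes S: "S \<subseteq> carrier G" and E: "good_family E" and R: "admissible_radius G S E R"
    and stage: "basic_stage G S E R g W" "undecided G E W = {}" and g: "g \<in> carrier G"
  shows "W \<in> ultrafilters G E" "A \<in> E - near_sets G S E R g \<Longrightarrow> A \<in> W \<longleftrightarrow> g \<in> A"
proof -
  note W = partial_ultrafilter_basic_stage[OF S E R stage(1), unfolded partial_ultrafilter_def]
  have decided: "A \<in> W \<longleftrightarrow> complem G A \<notin> W" if "A \<in> E" for A
  proof -
    have "A \<notin> undecided G E W" using stage(2) by simp
    then have "A \<in> W \<or> complem G A \<in> W" using mem_undecided[OF E, of W A] W that by simp
    then show ?thesis using W by blast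
  qed
  have "W \<subseteq> E" "\<forall>A\<in>W. \<forall>B\<in>E. ai_le G A B \<longrightarrow> B \<in> W" using W by auto
  then show "W \<in> ultrafilters G E" unfolding ultrafilters_def using decided by simp
  show "A \<in> W \<longleftrightarrow> g \<in> A" if A: "A \<in> E - near_sets G S E R g"
  proof
    assume "A \<in> W"
    then have "complem G A \<notin> W" using decided A by blast
    moreover have "complem G A \<in> E - near_sets G S E R g"
      using A near_sets_complem[OF S E] good_family_complem[OF E] by blast
    ultimately have "g \<notin> complem G A" using W by blast
    then show "g \<in> A" using g by (simp add: complem_def)
  qed (use W A in blast)
qed

text \<open>Only near sets can be undecided, and each stage decides at least the minimal set that it starts from.\<close>

lemma ex_basic_stage_complete:
  assumes S: "S \<subseteq> carrier G" and E: "good_family E" and R: "admissible_radius G S E R"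
    and fin: "finite (near_sets G S E R g)" and g: "g \<in> carrier G"
  shows "\<exists>W. basic_stage G S E R g W \<and> undecided G E W = {}"
proof -
  have extend: "\<exists>W. basic_stage G S E R g W \<and> undecided G E W = {}"
    if "basic_stage G S E R g U" "finite (undecided G E U)" for U
    using that
  proof (induction "card (undecided G E U)" arbitrary: U rule: less_induct)
    case less
    show ?case
    proof (cases "undecided G E U = {}")
      case False
      have "undecided G E U \<subseteq> E" by (auto simp: undecided_def)
      from ex_minimal[OF E less.prems(2) False this] obtain A where
        A: "A \<in> undecided G E U" "\<And>B. B \<in> undecided G E U \<Longrightarrow> ai_le G B A \<Longrightarrow> B = A" by blast
      let ?U = "U \<union> {B \<in> undecided G E U. ai_le G A B}"
      have st: "basic_stage G S E R g ?U" by (rule basic_stage.step[OF less.prems(1) A])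
      have "A \<in> ?U" using A(1) ai_le_refl good_familyD(1)[OF E] by (auto simp: undecided_def)
      then have "undecided G E ?U \<subset> undecided G E U" using A(1) unfolding undecided_def by blast
      then have "card (undecided G E ?U) < card (undecided G E U)" "finite (undecided G E ?U)"
        using less.prems(2) psubset_card_mono finite_subset by blast+
      then show ?thesis using less.hyps st by blast
    qed (use less.prems in blast)
  qed
  define Ug where "Ug = {A \<in> E - near_sets G S E R g. g \<in> A}"
  define U where "U = Ug \<union> {B \<in> near_sets G S E R g. \<exists>A\<in>Ug. ai_le G A B}"
  have st: "basic_stage G S E R g U" unfolding U_def by (rule basic_stage.start[OF Ug_def])
  have "undecided G E U \<subseteq> near_sets G S E R g"
  proof
    fix B assume B: "B \<in> undecided G E U"
    have "U \<subseteq> E" by (auto simp: U_def Ug_def near_sets_def)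
    then have B': "B \<in> E" "B \<notin> U" "complem G B \<notin> U" using mem_undecided[OF E] B by auto
    show "B \<in> near_sets G S E R g"
    proof (rule ccontr)
      assume n: "B \<notin> near_sets G S E R g"
      then have "complem G B \<in> E - near_sets G S E R g"
        using near_sets_complem[OF S E B'(1)] good_family_complem[OF E B'(1)] by blast
      then have "g \<in> B \<Longrightarrow> B \<in> U" "g \<in> complem G B \<Longrightarrow> complem G B \<in> U"
        using n B'(1) by (auto simp: U_def Ug_def)
      then show False using B'(2,3) g by (auto simp: complem_def)
    qed
  qed
  then show ?thesis using extend[OF st] fin finite_subset by blast
qed

section \<open>The isomorphism of cubings\<close>

definition family_iso :: "'a set set \<Rightarrow> 'a set set \<Rightarrow> ('a set \<Rightarrow> 'a set) \<Rightarrow> bool" where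
  "family_iso E E' \<phi> \<longleftrightarrow> bij_betw \<phi> E E' \<and> (\<forall>A\<in>E. eqv A (\<phi> A)) \<and>
     (\<forall>g\<in>carrier G. \<forall>s. \<forall>A\<in>E. \<phi> (signed g s A) = signed g s (\<phi> A)) \<and>
     (\<forall>A\<in>E. \<forall>B\<in>E. ai_le G A B \<longleftrightarrow> ai_le G (\<phi> A) (\<phi> B))"

lemma family_isoD:
  assumes "family_iso E E' \<phi>"
  shows "bij_betw \<phi> E E'" "A \<in> E \<Longrightarrow> eqv A (\<phi> A)"
    "g \<in> carrier G \<Longrightarrow> A \<in> E \<Longrightarrow> \<phi> (signed g s A) = signed g s (\<phi> A)"
    "A \<in> E \<Longrightarrow> B \<in> E \<Longrightarrow> ai_le G A B \<longleftrightarrow> ai_le G (\<phi> A) (\<phi> B)"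
    "A \<in> E \<Longrightarrow> \<phi> A \<in> E'" "inj_on \<phi> E" "\<phi> ` E = E'"
  using assms bij_betw_apply[of \<phi> E E'] by (auto simp: family_iso_def bij_betw_def)

lemma family_iso_inverse:
  assumes E: "good_family E" and E': "good_family E'" and iso: "family_iso E E' \<phi>"
  shows "family_iso E' E (the_inv_into E \<phi>)"
proof -
  let ?\<phi>' = "the_inv_into E \<phi>"
  note i = family_isoD[OF iso]
  have mem: "?\<phi>' B \<in> E" and inv: "\<phi> (?\<phi>' B) = B" if "B \<in> E'" for B
    using that i(7) the_inv_into_into[OF i(6), of B E] f_the_inv_into_f[OF i(6), of B] by auto
  have inv': "?\<phi>' (\<phi> A) = A" if "A \<in> E" for A by (rule the_inv_into_f_f[OF i(6) that])
  have "bij_betw ?\<phi>' E' E" by (rule bij_betw_the_inv_into[OF i(1)])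
  moreover have "eqv B (?\<phi>' B)" if B: "B \<in> E'" for B
    using eqv_sym[OF good_familyD(1)[OF E mem[OF B]] good_familyD(1)[OF E' B]] i(2)[OF mem[OF B]] inv[OF B]
    by simp
  moreover have "?\<phi>' (signed g s B) = signed g s (?\<phi>' B)" if g: "g \<in> carrier G" and B: "B \<in> E'" for g s B
    using i(3)[OF g mem[OF B], of s] inv[OF B] inv'[OF good_familyD(3)[OF E mem[OF B] g, of s]] by simp
  moreover have "ai_le G A B \<longleftrightarrow> ai_le G (?\<phi>' A) (?\<phi>' B)" if "A \<in> E'" "B \<in> E'" for A B
    using i(4)[OF mem[OF that(1)] mem[OF that(2)]] inv that by simp
  ultimately show ?thesis unfolding family_iso_def by blast
qed

lemma family_iso_complem:
  assumes "good_family E" "good_family E'" "family_iso E E' \<phi>" "A \<in> E"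
  shows "\<phi> (complem G A) = complem G (\<phi> A)"
  using family_isoD(3)[OF assms(3) one_closed assms(4), of False] family_isoD(5)[OF assms(3,4)]
    good_familyD(2)[OF assms(1,4)] good_familyD(2)[OF assms(2)] lcos_mult_one by (simp add: signed_def)

lemma family_iso_ultrafilter:
  assumes E: "good_family E" and E': "good_family E'" and iso: "family_iso E E' \<phi>"
    and V: "V \<in> ultrafilters G E"
  shows "\<phi> ` V \<in> ultrafilters G E'"
proof -
  note i = family_isoD[OF iso] and V' = ultrafilterD[OF V]
  have mem: "\<phi> A \<in> \<phi> ` V \<longleftrightarrow> A \<in> V" if "A \<in> E" for A
    by (rule inj_on_image_mem_iff[OF i(6) that V'(1)])
  show ?thesis
    unfolding ultrafilters_def mem_Collect_eq
  proof (intro conjI ballI impI)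
    show "\<phi> ` V \<subseteq> E'" using V'(1) i(7) by blast
    fix B assume "B \<in> E'"
    then obtain A where A: "A \<in> E" "B = \<phi> A" using i(7) by blast
    show "(B \<in> \<phi> ` V) \<noteq> (complem G B \<in> \<phi> ` V)"
      using mem[OF A(1)] mem[OF good_family_complem[OF E A(1)]] V'(2)[OF A(1)]
        family_iso_complem[OF E E' iso A(1)] A(2) by simp
  next
    fix B C assume BC: "B \<in> \<phi> ` V" "C \<in> E'" "ai_le G B C"
    obtain A where A: "A \<in> V" "B = \<phi> A" using BC(1) by blast
    obtain D where D: "D \<in> E" "C = \<phi> D" using BC(2) i(7) by blast
    have "ai_le G A D" using i(4)[OF _ D(1), of A] A V'(1) BC(3) D(2) by blast
    then show "C \<in> \<phi> ` V" using V'(3)[OF A(1) D(1)] D(2) by blast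
  qed
qed

lemma family_iso_adjacent:
  assumes E: "good_family E" and E': "good_family E'" and iso: "family_iso E E' \<phi>"
    and V: "V \<in> ultrafilters G E" and adj: "uf_adjacent G V W"
  shows "uf_adjacent G (\<phi> ` V) (\<phi> ` W)"
proof -
  note i = family_isoD[OF iso] and V' = ultrafilterD[OF V]
  obtain A where A: "A \<in> V" "W = (V - {A}) \<union> {complem G A}" using adj unfolding uf_adjacent_def by blast
  have AE: "A \<in> E" using A(1) V'(1) by blast
  have "\<phi> ` (V - {A}) = \<phi> ` V - {\<phi> A}"
    using inj_on_image_set_diff[OF i(6), of V "{A}"] V'(1) AE by auto
  then have "\<phi> ` W = (\<phi> ` V - {\<phi> A}) \<union> {complem G (\<phi> A)}"
    using family_iso_complem[OF E E' iso AE] A(2) by (simp add: image_Un)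
  then show ?thesis unfolding uf_adjacent_def using A(1) by blast
qed

lemma family_iso_Lambda_cubes:
  assumes E: "good_family E" and E': "good_family E'" and iso: "family_iso E E' \<phi>"
    and Df: "(D, f) \<in> Lambda_cubes G E"
  shows "(D, (\<lambda>V. \<phi> ` V) \<circ> f) \<in> Lambda_cubes G E'"
    "\<forall>T\<subseteq>D. the_inv_into E \<phi> ` \<phi> ` f T = f T"
proof -
  note i = family_isoD[OF iso]
  have c: "cube (ultrafilters G E) (uf_adjacent G) D f" using Df by (simp add: Lambda_cubes_def)
  have "inj_on (\<lambda>V. \<phi> ` V) (ultrafilters G E)"
  proof (rule inj_onI)
    fix V W assume VW: "V \<in> ultrafilters G E" "W \<in> ultrafilters G E" and eq: "\<phi> ` V = \<phi> ` W"
    show "V = W"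
      using inj_on_image_eq_iff[OF i(6) ultrafilterD(1)[OF VW(1)] ultrafilterD(1)[OF VW(2)]] eq by simp
  qed
  then have "cube (ultrafilters G E') (uf_adjacent G) D ((\<lambda>V. \<phi> ` V) \<circ> f)"
    by (intro cube_map[OF c] family_iso_ultrafilter[OF E E' iso] family_iso_adjacent[OF E E' iso])
  then show "(D, (\<lambda>V. \<phi> ` V) \<circ> f) \<in> Lambda_cubes G E'" by (simp add: Lambda_cubes_def)
  show "\<forall>T\<subseteq>D. the_inv_into E \<phi> ` \<phi> ` f T = f T"
  proof (intro allI impI)
    fix T assume "T \<subseteq> D"
    then have "f T \<subseteq> E" using cube_vertex_in[OF c] ultrafilterD(1) by blast
    then have "(\<lambda>A. the_inv_into E \<phi> (\<phi> A)) ` f T = (\<lambda>A. A) ` f T"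
      by (intro image_cong) (auto simp: the_inv_into_f_f[OF i(6)])
    then show "the_inv_into E \<phi> ` \<phi> ` f T = f T" by (simp add: image_image)
  qed
qed

context
  fixes S :: "'a set" and I :: "'i set" and X X' :: "'i \<Rightarrow> 'a set" and R R' :: real
    and \<phi> :: "'a set \<Rightarrow> 'a set"
  assumes S: "finite S" "S \<subseteq> carrier G" and I: "finite I"
    and X: "\<And>i. i \<in> I \<Longrightarrow> proper_ai (X i)" and X': "\<And>i. i \<in> I \<Longrightarrow> proper_ai (X' i)"
    and E: "good_family (translates G X I)" and E': "good_family (translates G X' I)"
    and R: "admissible_radius G S (translates G X I) R" and R': "admissible_radius G S (translates G X' I) R'"
    and iso: "family_iso (translates G X I) (translates G X' I) \<phi>"
begin

text \<open>Build \<open>W'\<close> at the same group element \<open>g\<close> as \<open>W\<close>.  A set \<open>\<phi> A\<close> in the image of \<open>W\<close>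
but not in \<open>W'\<close> forces \<open>A\<close> or \<open>\<phi> A\<close> to be near \<open>g\<close>, or \<open>g\<close> to lie in one of them only; each of
these happens finitely often.\<close>

lemma family_iso_basic_vertex:
  assumes W: "basic_vertex G S (translates G X I) R W"
  shows "\<exists>W'. basic_vertex G S (translates G X' I) R' W' \<and> W \<in> ultrafilters G (translates G X I) \<and>
    connected_component_of (realisation_topology (Lambda_cubes G (translates G X' I)))
      (vertex_point W') (vertex_point (\<phi> ` W))"
proof -
  let ?E = "translates G X I" and ?E' = "translates G X' I"
  note i = family_isoD[OF iso]
  obtain g where g: "g \<in> carrier G" and st: "basic_stage G S ?E R g W" "undecided G ?E W = {}"
    using W unfolding basic_vertex_def by blast
  have fin: "finite (near_sets G S ?E R g)" by (rule finite_near_sets[OF S I X g])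
  have fin': "finite (near_sets G S ?E' R' g)" by (rule finite_near_sets[OF S I X' g])
  obtain W' where st': "basic_stage G S ?E' R' g W'" "undecided G ?E' W' = {}"
    using ex_basic_stage_complete[OF S(2) E' R' fin' g] by blast
  note Wu = basic_stage_complete[OF S(2) E R st g] and Wu' = basic_stage_complete[OF S(2) E' R' st' g]
  have sub: "X i \<subseteq> carrier G" if "i \<in> I" for i using X[OF that] proper_aiD(1) by blast
  have mem: "V \<in> ?E \<longleftrightarrow> (\<exists>k\<in>carrier G. \<exists>i\<in>I. \<exists>t. V = signed k t (X i))" for V
    by (rule mem_translates_iff[OF sub])
  have XE: "X j \<in> ?E" if "j \<in> I" for j
    unfolding mem using signed_one[OF sub[OF that]] that
    by (intro bexI[of _ \<one>] bexI[of _ j] exI[of _ True]) simp_all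
  \<comment> \<open>\<open>A\<close> and \<open>\<phi> A\<close> differ by a finite union of cosets, which avoids \<open>g\<close> for almost all translates.\<close>
  have "finite {A \<in> ?E. g \<in> sym_diff A (\<phi> A)}"
  proof (rule finite_subset)
    let ?T = "\<lambda>i. {signed k t (X i) | k t. k \<in> carrier G \<and> g \<in> k \<cdot> sym_diff (X i) (\<phi> (X i))}"
    show "{A \<in> ?E. g \<in> sym_diff A (\<phi> A)} \<subseteq> (\<Union>i\<in>I. ?T i)"
    proof
      fix A assume A: "A \<in> {A \<in> ?E. g \<in> sym_diff A (\<phi> A)}"
      then have "A \<in> ?E" by blast
      then obtain k j t where k: "k \<in> carrier G" "j \<in> I" "A = signed k t (X j)"
        unfolding mem by blast
      have "\<phi> A = signed k t (\<phi> (X j))" using i(3)[OF k(1) XE[OF k(2)]] k(3) by simp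
      then have "g \<in> sym_diff (signed k t (X j)) (signed k t (\<phi> (X j)))" using A k(3) by auto
      then have "g \<in> k \<cdot> sym_diff (X j) (\<phi> (X j))"
        unfolding sym_diff_signed[OF sub[OF k(2)] good_familyD(2)[OF E' i(5)[OF XE[OF k(2)]]] k(1)] .
      then show "A \<in> (\<Union>i\<in>I. ?T i)" using k by blast
    qed
    have "finite (?T j)" if j: "j \<in> I" for j
      using i(2)[OF XE[OF j]] sub[OF j] good_familyD(2)[OF E' i(5)[OF XE[OF j]]] g
      by (intro finite_signed_through_point) (auto simp: eqv_def)
    then show "finite (\<Union>i\<in>I. ?T i)" using I by blast
  qed
  moreover have "\<phi> ` W - W' \<subseteq> \<phi> ` near_sets G S ?E R g \<union> near_sets G S ?E' R' g \<union>
      \<phi> ` {A \<in> ?E. g \<in> sym_diff A (\<phi> A)}"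
  proof
    fix B assume B: "B \<in> \<phi> ` W - W'"
    then obtain A where A: "A \<in> W" "B = \<phi> A" by blast
    have AE: "A \<in> ?E" using A(1) ultrafilterD(1)[OF Wu(1)] by blast
    show "B \<in> \<phi> ` near_sets G S ?E R g \<union> near_sets G S ?E' R' g \<union>
      \<phi> ` {A \<in> ?E. g \<in> sym_diff A (\<phi> A)}"
      using Wu(2)[of A] Wu'(2)[of B] A AE B i(5)[OF AE] by blast
  qed
  ultimately have "finite (\<phi> ` W - W')" using fin fin' finite_subset by blast
  then have "connected_component_of (realisation_topology (Lambda_cubes G ?E')) (vertex_point (\<phi> ` W)) (vertex_point W')"
    by (rule connected_component_ultrafilters[OF E' Wu'(1) family_iso_ultrafilter[OF E E' iso Wu(1)]])
  then show ?thesis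
    using st' g Wu(1) unfolding basic_vertex_def by (metis connected_component_of_sym)
qed

text \<open>A continuous map takes the component of \<open>W\<close> into the component of its image, which contains a basic
vertex by \<open>family_iso_basic_vertex\<close>.\<close>

lemma family_iso_cubing:
  assumes Df: "(D, f) \<in> cubing G S (translates G X I) R"
  shows "(D, (\<lambda>V. \<phi> ` V) \<circ> f) \<in> cubing G S (translates G X' I) R'"
proof -
  let ?E = "translates G X I" and ?E' = "translates G X' I" and ?\<psi> = "\<lambda>V. \<phi> ` V"
  let ?T = "realisation_topology (Lambda_cubes G ?E)" and ?T' = "realisation_topology (Lambda_cubes G ?E')"
  obtain W where L: "(D, f) \<in> Lambda_cubes G ?E" and W: "basic_vertex G S ?E R W"
    and cell: "cell D f \<subseteq> connected_component_of_set ?T (vertex_point W)"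
    using Df unfolding cubing_def by blast
  obtain W' where W': "basic_vertex G S ?E' R' W'" "W \<in> ultrafilters G ?E"
    and conn: "connected_component_of ?T' (vertex_point W') (vertex_point (\<phi> ` W))"
    using family_iso_basic_vertex[OF W] by blast
  have fin: "finite D'" if "(D', f') \<in> Lambda_cubes G ?E" for D' f'
    using that cube_finite unfolding Lambda_cubes_def by blast
  have cont: "continuous_map ?T ?T' (realise_map ?\<psi>)"
    by (rule continuous_realise_map) (use fin family_iso_Lambda_cubes(1)[OF E E' iso] in blast)
  let ?K = "connected_component_of_set ?T (vertex_point W)"
  have "connectedin ?T' (realise_map ?\<psi> ` ?K)"
    by (rule connectedin_continuous_map_image[OF cont connectedin_connected_component_of])
  moreover have "vertex_point W \<in> ?K"
    using vertex_point_in_realisation[OF W'(2)]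
    by (simp add: connected_component_of_refl topspace_realisation Lambda_cubes_def)
  then have "vertex_point (\<phi> ` W) \<in> realise_map ?\<psi> ` ?K"
    using realise_map_vertex_point[of ?\<psi> W] by (metis image_eqI)
  ultimately have K: "connected_component_of ?T' (vertex_point (\<phi> ` W)) q" if "q \<in> realise_map ?\<psi> ` ?K" for q
    using that unfolding connected_component_of_def by blast
  have "cell D (?\<psi> \<circ> f) \<subseteq> connected_component_of_set ?T' (vertex_point W')"
  proof
    fix q assume "q \<in> cell D (?\<psi> \<circ> f)"
    then have "q \<in> realise_map ?\<psi> ` cell D f"
      by (auto simp: cell_def realise_map_cube_point[OF fin[OF L]] image_image)
    then have "connected_component_of ?T' (vertex_point (\<phi> ` W)) q" using K cell by blast
    then show "q \<in> connected_component_of_set ?T' (vertex_point W')"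
      using connected_component_of_trans[OF conn] by simp
  qed
  then show ?thesis
    unfolding cubing_def using W'(1) family_iso_Lambda_cubes(1)[OF E E' iso L] by blast
qed

end

lemma family_iso_cubing_isomorphism:
  assumes S: "finite S" "S \<subseteq> carrier G" and I: "finite I"
    and X: "\<And>i. i \<in> I \<Longrightarrow> proper_ai (X i)" and X': "\<And>i. i \<in> I \<Longrightarrow> proper_ai (X' i)"
    and E: "good_family (translates G X I)" and E': "good_family (translates G X' I)"
    and R: "admissible_radius G S (translates G X I) R" and R': "admissible_radius G S (translates G X' I) R'"
    and iso: "family_iso (translates G X I) (translates G X' I) \<phi>"
  shows "cubing_isomorphism (cubing G S (translates G X I) R) (cubing G S (translates G X' I) R')
    (realise_map (\<lambda>V. \<phi> ` V))"
proof (rule cubing_isomorphism_realise_map)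
  let ?\<phi>' = "the_inv_into (translates G X I) \<phi>"
  note i = family_isoD[OF iso]
  have iso': "family_iso (translates G X' I) (translates G X I) ?\<phi>'"
    by (rule family_iso_inverse[OF E E' iso])
  have fin: "finite D" if "(D, f) \<in> Lambda_cubes G E" for D f E
    using that cube_finite unfolding Lambda_cubes_def by blast
  have L: "(D, f) \<in> Lambda_cubes G E" if "(D, f) \<in> cubing G S E R" for D f E R
    using that unfolding cubing_def by blast
  show "finite D \<and> (D, (\<lambda>V. \<phi> ` V) \<circ> f) \<in> cubing G S (translates G X' I) R' \<and>
      (\<forall>T\<subseteq>D. ?\<phi>' ` \<phi> ` f T = f T)" if "(D, f) \<in> cubing G S (translates G X I) R" for D f
    using family_iso_cubing[OF S I X X' E E' R R' iso that]
      family_iso_Lambda_cubes(2)[OF E E' iso L[OF that]] fin[OF L[OF that]] by blast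
  show "finite D \<and> (D, (\<lambda>V. ?\<phi>' ` V) \<circ> f) \<in> cubing G S (translates G X I) R \<and>
      (\<forall>T\<subseteq>D. \<phi> ` ?\<phi>' ` f T = f T)" if Df: "(D, f) \<in> cubing G S (translates G X' I) R'" for D f
  proof -
    have "\<phi> ` ?\<phi>' ` f T = f T" if "T \<subseteq> D" for T
    proof -
      have "f T \<subseteq> translates G X' I"
        using L[OF Df] cube_vertex_in that ultrafilterD(1) unfolding Lambda_cubes_def by blast
      then have "(\<lambda>B. \<phi> (?\<phi>' B)) ` f T = (\<lambda>B. B) ` f T"
        using i(7) by (intro image_cong) (auto simp: f_the_inv_into_f[OF i(6)] subset_eq)
      then show ?thesis by (simp add: image_image)
    qed
    then show ?thesis
      using family_iso_cubing[OF S I X' X E' E R' R iso' Df] fin[OF L[OF Df]] by blast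
  qed
qed

lemma family_iso_equivariant:
  assumes E: "good_family E" and iso: "family_iso E E' \<phi>" and g: "g \<in> carrier G"
    and p: "p \<in> realisation (cubing G S E R)"
  shows "realise_map (\<lambda>V. \<phi> ` V) (realise_map (translate_uf G g) p) =
    realise_map (translate_uf G g) (realise_map (\<lambda>V. \<phi> ` V) p)"
proof -
  obtain D f t where L: "(D, f) \<in> Lambda_cubes G E" and p: "p = cube_point D f t"
    using p unfolding realisation_def cell_def cubing_def by blast
  have c: "cube (ultrafilters G E) (uf_adjacent G) D f" using L by (simp add: Lambda_cubes_def)
  have "\<phi> ` translate_uf G g (f T) = translate_uf G g (\<phi> ` f T)" if "T \<subseteq> D" for T
  proof -
    have "f T \<subseteq> E" using cube_vertex_in[OF c that] ultrafilterD(1) by blast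
    then show ?thesis
      unfolding translate_uf_def image_image
      using family_isoD(3)[OF iso g, of _ True] by (intro image_cong) (auto simp: signed_def)
  qed
  then have "cube_point D ((\<lambda>V. \<phi> ` V) \<circ> (translate_uf G g \<circ> f)) t =
      cube_point D (translate_uf G g \<circ> ((\<lambda>V. \<phi> ` V) \<circ> f)) t"
    by (intro cube_point_cong) simp
  then show ?thesis by (simp add: p realise_map_cube_point[OF cube_finite[OF c]])
qed

end

lemma (in matched_families) ex_family_iso: "\<exists>\<phi>. family_iso E\<^sub>Y E\<^sub>Z \<phi>"
proof -
  obtain \<phi> where bij: "bij_betw \<phi> E\<^sub>Y E\<^sub>Z" and eqv: "\<forall>A\<in>E\<^sub>Y. eqv A (\<phi> A)"
    and sgn: "\<forall>g\<in>carrier G. \<forall>s. \<forall>A\<in>E\<^sub>Y. \<phi> (signed g s A) = signed g s (\<phi> A)"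
    and mono: "\<forall>A\<in>E\<^sub>Y. \<forall>B\<in>E\<^sub>Y. eqv A B \<longrightarrow> (A \<subseteq> B \<longleftrightarrow> \<phi> A \<subseteq> \<phi> B)"
    using ex_signed_iso by (elim exE conjE) (rule that)
  have "ai_le G A B \<longleftrightarrow> ai_le G (\<phi> A) (\<phi> B)" if A: "A \<in> E\<^sub>Y" and B: "B \<in> E\<^sub>Y" for A B
  proof (rule ai_le_transfer)
    show "proper_ai A" "proper_ai B" using good_familyD(1)[OF good_Y] A B by auto
    show "proper_ai (\<phi> A)" "proper_ai (\<phi> B)"
      using good_familyD(1)[OF good_Z] bij_betw_apply[OF bij] A B by auto
    show "eqv A (\<phi> A)" "eqv B (\<phi> B)" using eqv A B by auto
    show "A \<subseteq> B \<longleftrightarrow> \<phi> A \<subseteq> \<phi> B" if "eqv A B"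
      using bspec[OF bspec[OF mono A] B] that by (rule mp)
  qed
  then have "family_iso E\<^sub>Y E\<^sub>Z \<phi>"
    unfolding family_iso_def using bij eqv sgn by (intro conjI ballI) simp_all
  then show ?thesis by (intro exI[of _ \<phi>])
qed

theorem mainTheorem4:
  fixes G :: "('g, 'm) monoid_scheme"
    and S :: "'g set"
    and n :: nat
    and Y Z H K :: "nat \<Rightarrow> 'g set"
    and R_Y R_Z :: real
  defines "E_Y \<equiv> translates G Y {1..n}"
    and "E_Z \<equiv> translates G Z {1..n}"
  defines "L_Y \<equiv> cubing G S E_Y R_Y"
    and "L_Z \<equiv> cubing G S E_Z R_Z"
  assumes "group G"
    and "finite S" and "S \<subseteq> carrier G" and "generate G S = carrier G"
    and "\<And>i. i \<in> {1..n} \<Longrightarrow> finitely_generated G (H i) \<and> nontrivial_ai G (H i) (Y i)"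
    and "\<And>i. i \<in> {1..n} \<Longrightarrow> finitely_generated G (K i) \<and> nontrivial_ai G (K i) (Z i)"
    and "good_position G E_Y"
    and "good_position G E_Z"
    and "\<And>i. i \<in> {1..n} \<Longrightarrow> equivalent_ai G (H i) (Y i) (K i) (Z i)"
    and "\<And>i. i \<in> {1..n} \<Longrightarrow> \<not> invertible_ai G (Y i) \<and> \<not> invertible_ai G (Z i)"
    and "equally_redundant G Y Z {1..n}"
    and "admissible_radius G S E_Y R_Y"
    and "admissible_radius G S E_Z R_Z"
  shows "\<exists>\<phi>. bij_betw \<phi> E_Y E_Z \<and>
    (\<forall>g\<in>carrier G. \<forall>A\<in>E_Y. \<phi> (g <#\<^bsub>G\<^esub> A) = g <#\<^bsub>G\<^esub> \<phi> A) \<and>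
    (\<forall>A\<in>E_Y. \<forall>B\<in>E_Y. ai_le G A B \<longleftrightarrow> ai_le G (\<phi> A) (\<phi> B)) \<and>
    (let h = realise_map (\<lambda>V. \<phi> ` V) in
       cubing_isomorphism L_Y L_Z h \<and>
       (\<forall>g\<in>carrier G. \<forall>p\<in>realisation L_Y.
          h (realise_map (translate_uf G g) p) = realise_map (translate_uf G g) (h p)))"
proof -
  interpret group G by fact
  interpret matched_families G "{1..n}" Y Z
  proof
    fix i assume i: "i \<in> {1..n}"
    show "proper_ai (Y i)" "proper_ai (Z i)" using assms(9,10) i proper_ai_of_nontrivial by blast+
    show "eqv (Y i) (Z i)" using equivalent_ai_iff assms(9,10,13) i by blast
    show "\<not> invertible_ai G (Y i)" "\<not> invertible_ai G (Z i)" using assms(14) i by blast+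
  qed (use assms in auto)
  obtain \<phi> where iso: "family_iso (translates G Y {1..n}) (translates G Z {1..n}) \<phi>"
    using ex_family_iso by (elim exE)
  then have \<phi>: "family_iso E_Y E_Z \<phi>" by (simp only: E_Y_def E_Z_def)
  have "\<phi> (g <#\<^bsub>G\<^esub> A) = g <#\<^bsub>G\<^esub> \<phi> A" if "g \<in> carrier G" "A \<in> E_Y" for g A
    using family_isoD(3)[OF \<phi> that, of True] by (simp add: signed_def)
  moreover have "cubing_isomorphism L_Y L_Z (realise_map (\<lambda>V. \<phi> ` V))"
    unfolding L_Y_def L_Z_def E_Y_def E_Z_def
    by (rule family_iso_cubing_isomorphism[OF assms(6,7) finite_index proper_Y proper_Z good_Y good_Z
          assms(16)[unfolded E_Y_def] assms(17)[unfolded E_Z_def] iso])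
  moreover have "realise_map (\<lambda>V. \<phi> ` V) (realise_map (translate_uf G g) p) =
      realise_map (translate_uf G g) (realise_map (\<lambda>V. \<phi> ` V) p)"
    if "g \<in> carrier G" "p \<in> realisation L_Y" for g p
    by (rule family_iso_equivariant[OF good_Y iso that(1) that(2)[unfolded L_Y_def E_Y_def]])
  ultimately show ?thesis
    using family_isoD(1,4)[OF \<phi>] by (intro exI[of _ \<phi>]) (simp add: Let_def)
qed

end
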